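(* Let $\Gamma$ be a finite graph with no loops and no cycles, and let $W$ be the corresponding Weyl group. For any $u,v\in W$, the superpotential $S$ of the BFZ quiver $Q^{u,v}$ is rigid; that is, every oriented cycle in $Q^{u,v}$ is cyclically equivalent to an element of the Jacobian ideal $J(S)$.
   Context: **Weyl group.** Let $\Gamma$ have vertex set $\{1,\dots,r\}$. Its Cartan matrix is $a_{ii}=2$, $a_{ij}=-1$ if $i,j$ are joined by an edge, and $a_{ij}=0$ otherwise. $W$ is the Weyl (Coxeter) group with generators $s_1,\dots,s_r$ and relations $s_i^2=1$, $(s_is_j)^3=1$ if $a_{ij}=-1$, $(s_is_j)^2=1$ if $a_{ij}=0$ ($i\ne j$). $\ell$ is the length function. **Words.** For $u,v\in W$ let $N=\ell(u)+\ell(v)$. A reduced word $\mathbf i=(i_1,\dots,i_N)$ of $(u,v)$ is an arbitrary shuffle of a reduced word of $u$, written with negative indices $-1,\dots,-r$, and a reduced word of $v$, written with positive indices $1,\dots,r$. Put $i_{-j}=-j$ for $1\le j\le r$. The index set is $I=\{-r,\dots,-1\}\cup\{1,\dots,N\}$ with its usual order. For $k\in I$, $k^+$ is the smallest $l\in I$ with $l>k$ and $|i_l|=|i_k|$; if there is none, $k^+=N+1$. $\epsilon(x)=\pm1$ denotes the sign of $x$. An index $k$ is exchangeable if both $k$ and $k^+$ lie in $\{1,\dots,N\}$. **BFZ quiver $Q^{u,v}$** (for a reduced word $\mathbf i$ of $(u,v)$). The vertex set is $I$; exchangeable vertices are mutable and the others frozen. The arrows are: - Vertical (horizontal in BFZ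 terminology): for each $k$ with $l=k^+\le N$, an arrow $k\to l$ if $\epsilon(i_l)=+1$, and $l\to k$ if $\epsilon(i_l)=-1$. - Inclined: for $k<l$ with $l\ge 1$ and $a_{|i_k|,|i_l|}<0$, there is one arrow between $k$ and $l$ if either (1) $l<k^+<l^+$ and $\epsilon(i_l)=\epsilon(i_{k^+})$, or (2) $l<l^+<k^+$ and $\epsilon(i_l)=-\epsilon(i_{l^+})$. It is directed $k\to l$ if $\epsilon(i_l)=-1$ and $l\to k$ if $\epsilon(i_l)=+1$. - Boundary arrows between frozen vertices completing oriented simple cycles: for each edge $\{i,j\}$ of $\Gamma$ such that at least one of $\pm i,\pm j$ occurs in $(i_1,\dots,i_N)$, there is one arrow between $-i$ and $-j$ and one arrow between $t_i$ and $t_j$, where $t_h$ is the largest $k\in I$ with $|i_k|=h$. If the first letter of $(i_1,\dots,i_N)$ with absolute value in $\{i,j\}$ has absolute value $j$, the first arrow is $-i\to -j$ if that letter is positive and $-j\to -i$ if negative. If the last such letter has absolute value $j$, the second arrow is $t_j\to t_i$ if that letter is positive and $t_i\to t_j$ if negative. (Similarly with $i,j$ exchanged.) **Cylinder, sheets, faces.** The cylinder over $\Gamma$ is $\Gamma\times\mathbb R^{\ge0}$. Vertex $k\in I$ is placed on the string $\{|i_k|\}\times\mathbb R^{\ge0}$ at height equal to its position in the ordered set $I$. Vertical arrows are drawn along strings, and all other arrows as straight segments in the strip (edge of $\Gamma$)$\times\mathbb R^{\ge0}$. A branch of $\Gamma$ is a path both of whose ends are endpoints (vertices of degree one) or ramification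 points (vertices of degree greater than two), with no ramification point in its interior. The sheet over a branch is (branch)$\times\mathbb R^{\ge0}$. A face is a bounded region cut out by the arrows in a strip, whose boundary consists entirely of arrows; it is identified with the oriented cycle bounding it. **Superpotential.** Fix a planar orientation on each sheet. The superpotential is $S=\sum(\text{clockwise oriented faces})-\sum(\text{anti-clockwise oriented faces})$, the sum running over the faces of all sheets. **Rigidity.** For a quiver $Q$ with arrow set $Q_1$, $\mathbb C(Q)$ is its path algebra. A potential is a linear combination of oriented cycles. Two potentials $S,S'$ are cyclically equivalent if $S-S'$ lies in the closure (in the topology given by path length) of the span of all elements $\alpha_1\cdots\alpha_l-\alpha_2\cdots\alpha_l\alpha_1$ with $\alpha_1\cdots\alpha_l$ a cycle of positive length. For $a\in Q_1$ the cyclic derivative is $\partial_a(a_1\cdots a_n)=\sum_i\delta_{a,a_i}\,a_{i+1}\cdots a_na_1\cdots a_{i-1}$ on cycles, extended linearly. $J(S)$ is the ideal generated by $\partial_a(S)$ for all $a\in Q_1$ (including arrows between frozen vertices). $(Q,S)$, or $S$, is rigid if every cycle (of positive length) in $Q$ is cyclically equivalent to an element of $J(S)$. *)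

theory Defs
  imports
    "HOL-Analysis.Analysis"
    "HOL-Library.Poly_Mapping"
    "HOL-Algebra.Ideal"
    "Graph_Theory.Arc_Walk"
begin

section \<open>Graphs\<close>

text \<open>
  A graph on the vertex set \<open>{1..r}\<close> is given by its set \<open>E\<close> of edges; an edge is the set of its
  ends, so a loop is a singleton. Parallel edges form a cycle, so nothing is lost by a set of edges.
\<close>

definition is_graph :: "nat \<Rightarrow> nat set set \<Rightarrow> bool" where
  "is_graph r E \<longleftrightarrow> (\<forall>e\<in>E. e \<subseteq> {1..r} \<and> (card e = 1 \<or> card e = 2))"

definition has_loop :: "nat set set \<Rightarrow> bool" where
  "has_loop E \<longleftrightarrow> (\<exists>e\<in>E. card e = 1)"

definition has_cycle :: "nat set set \<Rightarrow> bool" where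
  "has_cycle E \<longleftrightarrow> (\<exists>c. 3 \<le> length c \<and> distinct c \<and>
     (\<forall>m. Suc m < length c \<longrightarrow> {c ! m, c ! Suc m} \<in> E) \<and> {last c, hd c} \<in> E)"

definition degree :: "nat set set \<Rightarrow> nat \<Rightarrow> nat" where
  "degree E i = card {e \<in> E. i \<in> e}"

definition cartan :: "nat set set \<Rightarrow> nat \<Rightarrow> nat \<Rightarrow> int" where
  "cartan E i j = (if i = j then 2 else if {i, j} \<in> E then -1 else 0)"


section \<open>The Weyl group\<close>

definition relators :: "nat \<Rightarrow> nat set set \<Rightarrow> nat list set" where
  "relators r E =
     {[i, i] | i. i \<in> {1..r}} \<union>
     {[i, j, i, j, i, j] | i j. i \<in> {1..r} \<and> j \<in> {1..r} \<and> cartan E i j = -1} \<union>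
     {[i, j, i, j] | i j. i \<in> {1..r} \<and> j \<in> {1..r} \<and> i \<noteq> j \<and> cartan E i j = 0}"

inductive weyl_eq :: "nat \<Rightarrow> nat set set \<Rightarrow> nat list \<Rightarrow> nat list \<Rightarrow> bool" for r E where
  relator: "xs \<in> lists {1..r} \<Longrightarrow> t \<in> relators r E \<Longrightarrow> ys \<in> lists {1..r} \<Longrightarrow>
    weyl_eq r E (xs @ t @ ys) (xs @ ys)"
| refl: "xs \<in> lists {1..r} \<Longrightarrow> weyl_eq r E xs xs"
| sym: "weyl_eq r E xs ys \<Longrightarrow> weyl_eq r E ys xs"
| trans: "weyl_eq r E xs ys \<Longrightarrow> weyl_eq r E ys zs \<Longrightarrow> weyl_eq r E xs zs"

definition weyl_class :: "nat \<Rightarrow> nat set set \<Rightarrow> nat list \<Rightarrow> nat list set" where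
  "weyl_class r E xs = {ys. weyl_eq r E xs ys}"

text \<open>
  The word \<open>[i\<^sub>1, \<dots>, i\<^sub>n]\<close> stands for \<open>s\<^sub>i\<^sub>1 \<cdots> s\<^sub>i\<^sub>n\<close>. Because of \<open>s\<^sub>i\<^sup>2 = 1\<close> no letters for inverses are
  needed, and the monoid with this presentation is the group with this presentation.
\<close>

definition weyl_group :: "nat \<Rightarrow> nat set set \<Rightarrow> nat list set monoid" where
  "weyl_group r E =
    \<lparr>carrier = weyl_class r E ` lists {1..r},
     mult = (\<lambda>A B. \<Union>xs\<in>A. \<Union>ys\<in>B. weyl_class r E (xs @ ys)),
     one = weyl_class r E []\<rparr>"

definition weyl_length :: "nat list set \<Rightarrow> nat" where
  "weyl_length x = (LEAST n. \<exists>xs\<in>x. length xs = n)"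

text \<open>An element of the Weyl group is the set of all words that represent it.\<close>

definition reduced_word :: "nat list set \<Rightarrow> nat list \<Rightarrow> bool" where
  "reduced_word x xs \<longleftrightarrow> xs \<in> x \<and> length xs = weyl_length x"

definition reduced_pair_word :: "nat list set \<Rightarrow> nat list set \<Rightarrow> int list \<Rightarrow> bool" where
  "reduced_pair_word u v w \<longleftrightarrow> (\<exists>us vs. reduced_word u us \<and> reduced_word v vs \<and>
     w \<in> shuffles (map (\<lambda>i. - int i) us) (map int vs))"

lemma weyl_eq_lists:
  assumes "weyl_eq r E xs ys"
  shows "xs \<in> lists {1..r} \<and> ys \<in> lists {1..r}"
  using assms by induction (auto simp: relators_def)

lemma weyl_eq_append:
  assumes "weyl_eq r E xs ys" "as \<in> lists {1..r}" "bs \<in> lists {1..r}"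
  shows "weyl_eq r E (as @ xs @ bs) (as @ ys @ bs)"
  using assms
proof induction
  case (relator xs t ys)
  then have "weyl_eq r E ((as @ xs) @ t @ (ys @ bs)) ((as @ xs) @ (ys @ bs))"
    by (intro weyl_eq.relator) auto
  then show ?case by simp
next
  case (refl xs)
  then show ?case by (intro weyl_eq.refl) auto
next
  case (sym xs ys)
  then show ?case using weyl_eq.sym by metis
next
  case (trans xs ys zs)
  then show ?case using weyl_eq.trans by metis
qed

lemma weyl_eq_cong:
  assumes "weyl_eq r E xs xs'" "weyl_eq r E ys ys'"
  shows "weyl_eq r E (xs @ ys) (xs' @ ys')"
proof (rule weyl_eq.trans)
  show "weyl_eq r E (xs @ ys) (xs' @ ys)"
    using weyl_eq_append[OF assms(1), of "[]" ys] weyl_eq_lists[OF assms(2)] by simp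
  show "weyl_eq r E (xs' @ ys) (xs' @ ys')"
    using weyl_eq_append[OF assms(2), of xs' "[]"] weyl_eq_lists[OF assms(1)] by simp
qed

lemma weyl_class_eq: "weyl_eq r E xs ys \<Longrightarrow> weyl_class r E xs = weyl_class r E ys"
  unfolding weyl_class_def using weyl_eq.sym weyl_eq.trans by (intro Collect_cong iffI) metis+

lemma weyl_group_simps:
  "carrier (weyl_group r E) = weyl_class r E ` lists {1..r}"
  "\<one>\<^bsub>weyl_group r E\<^esub> = weyl_class r E []"
  by (simp_all add: weyl_group_def)

lemma weyl_mult:
  assumes "xs \<in> lists {1..r}" "ys \<in> lists {1..r}"
  shows "weyl_class r E xs \<otimes>\<^bsub>weyl_group r E\<^esub> weyl_class r E ys = weyl_class r E (xs @ ys)"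
proof -
  have *: "weyl_class r E (xs' @ ys') = weyl_class r E (xs @ ys)"
    if "xs' \<in> weyl_class r E xs" "ys' \<in> weyl_class r E ys" for xs' ys'
    using that weyl_class_eq[OF weyl_eq_cong, of r E xs xs' ys ys'] by (simp add: weyl_class_def)
  have "xs \<in> weyl_class r E xs" "ys \<in> weyl_class r E ys"
    using assms by (auto simp: weyl_class_def intro: weyl_eq.refl)
  then show ?thesis
    unfolding weyl_group_def monoid.simps using * by blast
qed

lemma weyl_group_is_group: "group (weyl_group r E)"
proof (rule groupI)
  fix x assume "x \<in> carrier (weyl_group r E)"
  then obtain xs where xs: "xs \<in> lists {1..r}" "x = weyl_class r E xs"
    by (auto simp: weyl_group_def)
  have "weyl_eq r E (rev xs @ xs) []"
    using xs(1)
  proof (induction xs)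
    case Nil
    then show ?case by (auto intro: weyl_eq.refl)
  next
    case (Cons a xs)
    have "weyl_eq r E (rev xs @ [a, a] @ xs) (rev xs @ xs)"
      using Cons by (intro weyl_eq.relator) (auto simp: relators_def)
    moreover have "weyl_eq r E (rev xs @ xs) []" using Cons by simp
    ultimately show ?case using weyl_eq.trans[of r E _ "rev xs @ xs" "[]"] by simp
  qed
  then have "weyl_class r E (rev xs) \<otimes>\<^bsub>weyl_group r E\<^esub> x = \<one>\<^bsub>weyl_group r E\<^esub>"
    unfolding xs(2) weyl_group_simps
    using xs(1) weyl_class_eq[OF \<open>weyl_eq r E (rev xs @ xs) []\<close>] by (subst weyl_mult) auto
  then show "\<exists>y\<in>carrier (weyl_group r E). y \<otimes>\<^bsub>weyl_group r E\<^esub> x = \<one>\<^bsub>weyl_group r E\<^esub>"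
    using xs(1) by (intro bexI[of _ "weyl_class r E (rev xs)"]) (auto simp: weyl_group_simps)
next
  fix x y z
  assume "x \<in> carrier (weyl_group r E)" "y \<in> carrier (weyl_group r E)"
    "z \<in> carrier (weyl_group r E)"
  then obtain xs ys zs where "xs \<in> lists {1..r}" "x = weyl_class r E xs"
    "ys \<in> lists {1..r}" "y = weyl_class r E ys" "zs \<in> lists {1..r}" "z = weyl_class r E zs"
    by (auto simp: weyl_group_def)
  then show "x \<otimes>\<^bsub>weyl_group r E\<^esub> y \<otimes>\<^bsub>weyl_group r E\<^esub> z =
      x \<otimes>\<^bsub>weyl_group r E\<^esub> (y \<otimes>\<^bsub>weyl_group r E\<^esub> z)"
    by (simp add: weyl_mult)
next
  fix x y assume "x \<in> carrier (weyl_group r E)" "y \<in> carrier (weyl_group r E)"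
  then obtain xs ys where "xs \<in> lists {1..r}" "x = weyl_class r E xs"
    "ys \<in> lists {1..r}" "y = weyl_class r E ys"
    by (auto simp: weyl_group_def)
  then have "x \<otimes>\<^bsub>weyl_group r E\<^esub> y = weyl_class r E (xs @ ys)" "xs @ ys \<in> lists {1..r}"
    by (auto simp: weyl_mult)
  then show "x \<otimes>\<^bsub>weyl_group r E\<^esub> y \<in> carrier (weyl_group r E)"
    by (auto simp: weyl_group_def)
next
  show "\<one>\<^bsub>weyl_group r E\<^esub> \<in> carrier (weyl_group r E)" by (auto simp: weyl_group_def)
next
  fix x assume "x \<in> carrier (weyl_group r E)"
  then obtain xs where "xs \<in> lists {1..r}" "x = weyl_class r E xs"
    by (auto simp: weyl_group_def)
  moreover have "\<one>\<^bsub>weyl_group r E\<^esub> = weyl_class r E []" by (simp add: weyl_group_def)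
  ultimately show "\<one>\<^bsub>weyl_group r E\<^esub> \<otimes>\<^bsub>weyl_group r E\<^esub> x = x"
    by (simp add: weyl_mult)
qed


section \<open>The path algebra of a quiver, potentials and rigidity\<close>

text \<open>
  A quiver is a digraph in the sense of the Graph Theory library. A path is a pair of its start
  and its list of arrows, the pair \<open>(u, [])\<close> being the trivial path at \<open>u\<close>; the product
  \<open>\<alpha>\<^sub>1 \<cdots> \<alpha>\<^sub>l\<close> is read from left to right, i.e. the head of \<open>\<alpha>\<^sub>i\<close> is the tail of \<open>\<alpha>\<^sub>i\<^sub>+\<^sub>1\<close>.
\<close>

type_synonym ('v, 'a) path = "'v \<times> 'a list"
type_synonym ('v, 'a) path_comb = "('v, 'a) path \<Rightarrow>\<^sub>0 complex"

definition paths :: "('v, 'a) pre_digraph \<Rightarrow> ('v, 'a) path set" where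
  "paths Q = {(u, p). \<exists>v. pre_digraph.awalk Q u p v}"

definition path_end :: "('v, 'a) pre_digraph \<Rightarrow> ('v, 'a) path \<Rightarrow> 'v" where
  "path_end Q x = pre_digraph.awlast Q (fst x) (snd x)"

definition path_mult ::
  "('v, 'a) pre_digraph \<Rightarrow> ('v, 'a) path_comb \<Rightarrow> ('v, 'a) path_comb \<Rightarrow> ('v, 'a) path_comb" where
  "path_mult Q x y = (\<Sum>s\<in>Poly_Mapping.keys x. \<Sum>t\<in>Poly_Mapping.keys y.
     if path_end Q s = fst t
     then Poly_Mapping.single (fst s, snd s @ snd t) (Poly_Mapping.lookup x s * Poly_Mapping.lookup y t)
     else 0)"

definition path_algebra :: "('v, 'a) pre_digraph \<Rightarrow> ('v, 'a) path_comb ring" where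
  "path_algebra Q =
    \<lparr>carrier = {x. Poly_Mapping.keys x \<subseteq> paths Q},
     mult = path_mult Q,
     one = (\<Sum>u\<in>verts Q. Poly_Mapping.single (u, []) 1),
     zero = 0,
     add = (+)\<rparr>"

definition path_scale :: "complex \<Rightarrow> ('v, 'a) path_comb \<Rightarrow> ('v, 'a) path_comb" where
  "path_scale c = Poly_Mapping.map (\<lambda>z. c * z)"

interpretation path_space: vector_space "path_scale :: complex \<Rightarrow> ('v, 'a) path_comb \<Rightarrow> _"
proof
  fix c d :: complex and x y :: "('v, 'a) path_comb"
  have lookup: "Poly_Mapping.lookup (path_scale c z) s = c * Poly_Mapping.lookup z s"
    for c and z :: "('v, 'a) path_comb" and s
    by (simp add: path_scale_def Poly_Mapping.map.rep_eq when_def)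
  show "path_scale c (x + y) = path_scale c x + path_scale c y"
    "path_scale (c + d) x = path_scale c x + path_scale d x"
    "path_scale c (path_scale d x) = path_scale (c * d) x"
    "path_scale 1 x = x"
    by (auto intro!: poly_mapping_eqI simp: lookup lookup_add algebra_simps)
qed

lemma path_mult_superset:
  assumes "finite A" "finite B" "Poly_Mapping.keys x \<subseteq> A" "Poly_Mapping.keys y \<subseteq> B"
  shows "path_mult Q x y = (\<Sum>s\<in>A. \<Sum>t\<in>B.
     if path_end Q s = fst t
     then Poly_Mapping.single (fst s, snd s @ snd t) (Poly_Mapping.lookup x s * Poly_Mapping.lookup y t)
     else 0)"
  unfolding path_mult_def
proof (rule sum.mono_neutral_cong_left)
  show "\<forall>s\<in>A - Poly_Mapping.keys x. (\<Sum>t\<in>B. if path_end Q s = fst t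
     then Poly_Mapping.single (fst s, snd s @ snd t) (Poly_Mapping.lookup x s * Poly_Mapping.lookup y t)
     else 0) = 0"
    by (auto intro!: sum.neutral simp: in_keys_iff)
next
  fix s
  show "(\<Sum>t\<in>Poly_Mapping.keys y. if path_end Q s = fst t
     then Poly_Mapping.single (fst s, snd s @ snd t) (Poly_Mapping.lookup x s * Poly_Mapping.lookup y t)
     else 0) = (\<Sum>t\<in>B. if path_end Q s = fst t
     then Poly_Mapping.single (fst s, snd s @ snd t) (Poly_Mapping.lookup x s * Poly_Mapping.lookup y t)
     else 0)"
    using assms by (intro sum.mono_neutral_left) (auto simp: in_keys_iff)
qed (use assms in auto)

lemma path_mult_add_left: "path_mult Q (x + y) z = path_mult Q x z + path_mult Q y z"
proof -
  let ?A = "Poly_Mapping.keys x \<union> Poly_Mapping.keys y \<union> Poly_Mapping.keys (x + y)"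
  show ?thesis
    by (subst (1 2 3) path_mult_superset[where A = ?A and B = "Poly_Mapping.keys z"])
      (auto simp: lookup_add distrib_right single_add sum.distrib[symmetric] intro!: sum.cong)
qed

lemma path_mult_add_right: "path_mult Q z (x + y) = path_mult Q z x + path_mult Q z y"
proof -
  let ?A = "Poly_Mapping.keys x \<union> Poly_Mapping.keys y \<union> Poly_Mapping.keys (x + y)"
  show ?thesis
    by (subst (1 2 3) path_mult_superset[where B = ?A and A = "Poly_Mapping.keys z"])
      (auto simp: lookup_add distrib_left single_add sum.distrib[symmetric] intro!: sum.cong)
qed

lemma path_mult_zero [simp]: "path_mult Q 0 x = 0" "path_mult Q x 0 = 0"
  by (auto simp: path_mult_def)

lemma path_mult_single:
  "path_mult Q (Poly_Mapping.single s c) (Poly_Mapping.single t d) =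
    (if path_end Q s = fst t then Poly_Mapping.single (fst s, snd s @ snd t) (c * d) else 0)"
  by (subst path_mult_superset[where A = "{s}" and B = "{t}"]) (auto simp: lookup_single)

lemma path_mult_sum_left: "path_mult Q (sum f A) z = (\<Sum>a\<in>A. path_mult Q (f a) z)"
  by (induction A rule: infinite_finite_induct) (auto simp: path_mult_add_left)

lemma path_mult_sum_right: "path_mult Q z (sum f A) = (\<Sum>a\<in>A. path_mult Q z (f a))"
  by (induction A rule: infinite_finite_induct) (auto simp: path_mult_add_right)

lemma path_comb_decomp:
  fixes x :: "('v, 'a) path_comb"
  shows "x = (\<Sum>s\<in>Poly_Mapping.keys x. Poly_Mapping.single s (Poly_Mapping.lookup x s))"
  by (rule poly_mapping_eqI)
    (auto simp: lookup_sum lookup_single when_def in_keys_iff sum.delta)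

lemma path_end_append:
  "path_end Q (u, p) = v \<Longrightarrow> path_end Q (u, p @ q) = path_end Q (v, q)"
  by (auto simp: path_end_def pre_digraph.awalk_verts_conv)

lemma path_mult_assoc: "path_mult Q (path_mult Q x y) z = path_mult Q x (path_mult Q y z)"
proof -
  have *: "path_mult Q (path_mult Q (Poly_Mapping.single s a) (Poly_Mapping.single t b)) (Poly_Mapping.single q c) =
      path_mult Q (Poly_Mapping.single s a) (path_mult Q (Poly_Mapping.single t b) (Poly_Mapping.single q c))"
    for s t q a b c
    by (cases s; cases t) (auto simp: path_mult_single mult.assoc path_end_append)
  show ?thesis
    by (subst (1 2) path_comb_decomp[of x], subst (1 2) path_comb_decomp[of y],
        subst (1 2) path_comb_decomp[of z])
      (simp only: path_mult_sum_left path_mult_sum_right *)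
qed

lemma paths_append:
  assumes "(u, p) \<in> paths Q" "(v, q) \<in> paths Q" "path_end Q (u, p) = v"
  shows "(u, p @ q) \<in> paths Q"
proof -
  have cas: "pre_digraph.cas Q u' (p @ q) w'"
    if "pre_digraph.cas Q u' p v'" "pre_digraph.cas Q v' q w'" for u' v' w'
    using that by (induction p arbitrary: u') (auto simp: pre_digraph.cas.simps)
  have "v' = pre_digraph.awlast Q u' p" if "pre_digraph.cas Q u' p v'" for u' v'
    using that by (induction p arbitrary: u')
      (auto simp: pre_digraph.cas.simps pre_digraph.awalk_verts.simps pre_digraph.awalk_verts_conv)
  then show ?thesis
    using assms cas unfolding paths_def pre_digraph.awalk_def path_end_def by fastforce
qed

text \<open>The library notion of generated ideal presupposes a ring.\<close>

lemma ring_path_algebra: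
  assumes "fin_digraph Q"
  shows "ring (path_algebra Q)"
proof -
  interpret fin_digraph Q by fact
  have closed: "Poly_Mapping.keys (path_mult Q x y) \<subseteq> paths Q"
    if "Poly_Mapping.keys x \<subseteq> paths Q" "Poly_Mapping.keys y \<subseteq> paths Q" for x y
  proof -
    have "Poly_Mapping.keys (sum f A) \<subseteq> paths Q"
      if "\<And>a. a \<in> A \<Longrightarrow> Poly_Mapping.keys (f a) \<subseteq> paths Q"
      for A and f :: "('a, 'b) path \<Rightarrow> ('a, 'b) path_comb"
      using that keys_sum by (metis (no_types, lifting) UN_least order_trans)
    note keys_sum_paths = this
    show ?thesis
      unfolding path_mult_def
    proof (intro keys_sum_paths)
      fix s t assume "s \<in> Poly_Mapping.keys x" "t \<in> Poly_Mapping.keys y"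
      then show "Poly_Mapping.keys (if path_end Q s = fst t
         then Poly_Mapping.single (fst s, snd s @ snd t) (Poly_Mapping.lookup x s * Poly_Mapping.lookup y t)
         else 0) \<subseteq> paths Q"
        using that paths_append[of "fst s" "snd s" Q "fst t" "snd t"] by auto
    qed
  qed
  have end_verts: "path_end Q s \<in> verts Q" if "s \<in> paths Q" for s
    using that by (auto simp: paths_def path_end_def)
  have start_verts: "fst s \<in> verts Q" if "s \<in> paths Q" for s
    using that by (auto simp: paths_def)
  let ?one = "\<Sum>u\<in>verts Q. Poly_Mapping.single (u, []) 1 :: ('a, 'b) path_comb"
  have left: "path_mult Q ?one x = x" if "Poly_Mapping.keys x \<subseteq> paths Q" for x
  proof -
    have "path_mult Q ?one (Poly_Mapping.single s c) = Poly_Mapping.single s c"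
      if "s \<in> paths Q" for s c
      using start_verts[OF that]
      by (simp add: path_mult_sum_left path_mult_single path_end_def sum.delta)
    then have "path_mult Q ?one (\<Sum>s\<in>Poly_Mapping.keys x. Poly_Mapping.single s (Poly_Mapping.lookup x s))
        = (\<Sum>s\<in>Poly_Mapping.keys x. Poly_Mapping.single s (Poly_Mapping.lookup x s))"
      unfolding path_mult_sum_right[of Q ?one] using that by (intro sum.cong) auto
    then show ?thesis by (simp flip: path_comb_decomp)
  qed
  have right: "path_mult Q x ?one = x" if "Poly_Mapping.keys x \<subseteq> paths Q" for x
  proof -
    have "path_mult Q (Poly_Mapping.single s c) ?one = Poly_Mapping.single s c"
      if "s \<in> paths Q" for s c
      using end_verts[OF that]
      by (simp add: path_mult_sum_right path_mult_single sum.delta')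
    then have "path_mult Q (\<Sum>s\<in>Poly_Mapping.keys x. Poly_Mapping.single s (Poly_Mapping.lookup x s)) ?one
        = (\<Sum>s\<in>Poly_Mapping.keys x. Poly_Mapping.single s (Poly_Mapping.lookup x s))"
      unfolding path_mult_sum_left[of Q _ _ ?one] using that by (intro sum.cong) auto
    then show ?thesis by (simp flip: path_comb_decomp)
  qed
  have one: "Poly_Mapping.keys ?one \<subseteq> paths Q"
    using keys_sum[of "\<lambda>u. Poly_Mapping.single (u, []) (1::complex)" "verts Q"]
    by (force simp: paths_def awalk_Nil_iff split: if_splits)
  have add: "Poly_Mapping.keys (x + y) \<subseteq> paths Q"
    if "Poly_Mapping.keys x \<subseteq> paths Q" "Poly_Mapping.keys y \<subseteq> paths Q" for x y :: "('a, 'b) path_comb"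
    using that keys_add[of x y] by blast
  show ?thesis
  proof (rule ringI)
    show "abelian_group (path_algebra Q)"
    proof (rule abelian_groupI)
      fix x y assume "x \<in> carrier (path_algebra Q)" "y \<in> carrier (path_algebra Q)"
      then show "x \<oplus>\<^bsub>path_algebra Q\<^esub> y \<in> carrier (path_algebra Q)"
        using add[of x y] by (simp add: path_algebra_def)
    next
      fix x assume "x \<in> carrier (path_algebra Q)"
      moreover have "Poly_Mapping.keys (- x) = Poly_Mapping.keys x"
        by (auto simp: in_keys_iff lookup_uminus)
      ultimately show "\<exists>y\<in>carrier (path_algebra Q). y \<oplus>\<^bsub>path_algebra Q\<^esub> x = \<zero>\<^bsub>path_algebra Q\<^esub>"
        by (intro bexI[of _ "- x"]) (simp_all add: path_algebra_def)
    qed (simp_all add: path_algebra_def add_ac)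
    show "Group.monoid (path_algebra Q)"
      by (rule monoidI) (simp_all add: path_algebra_def closed one left right path_mult_assoc)
  qed (simp_all add: path_algebra_def path_mult_add_left path_mult_add_right)
qed

text \<open>
  The relations \<open>\<alpha>\<^sub>1 \<cdots> \<alpha>\<^sub>l - \<alpha>\<^sub>2 \<cdots> \<alpha>\<^sub>l \<alpha>\<^sub>1\<close> (with \<open>\<alpha>\<^sub>1 = a\<close>) and their linear span.
\<close>

definition rotation_span :: "('v, 'a) pre_digraph \<Rightarrow> ('v, 'a) path_comb set" where
  "rotation_span Q = module.span path_scale
     {Poly_Mapping.single (tail Q a, a # p) 1 - Poly_Mapping.single (head Q a, p @ [a]) 1 | a p.
        pre_digraph.awalk Q (tail Q a) (a # p) (tail Q a)}"

text \<open>
  In the topology given by path length, the sets of all combinations of paths of length at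
  least \<open>n\<close> form a neighbourhood basis of \<open>0\<close>.
\<close>

definition path_closure :: "('v, 'a) path_comb set \<Rightarrow> ('v, 'a) path_comb set" where
  "path_closure X = {x. \<forall>n. \<exists>z\<in>X. \<forall>(u, p)\<in>Poly_Mapping.keys (x - z). n \<le> length p}"

definition cyclically_equivalent ::
  "('v, 'a) pre_digraph \<Rightarrow> ('v, 'a) path_comb \<Rightarrow> ('v, 'a) path_comb \<Rightarrow> bool" where
  "cyclically_equivalent Q x y \<longleftrightarrow> x - y \<in> path_closure (rotation_span Q)"

definition cyclic_derivative ::
  "('v, 'a) pre_digraph \<Rightarrow> 'a \<Rightarrow> ('v, 'a) path_comb \<Rightarrow> ('v, 'a) path_comb" where
  "cyclic_derivative Q a S = (\<Sum>(u, p)\<in>Poly_Mapping.keys S. \<Sum>i | i < length p \<and> p ! i = a.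
     Poly_Mapping.single (head Q a, drop (Suc i) p @ take i p) (Poly_Mapping.lookup S (u, p)))"

definition jacobian_ideal ::
  "('v, 'a) pre_digraph \<Rightarrow> ('v, 'a) path_comb \<Rightarrow> ('v, 'a) path_comb set" where
  "jacobian_ideal Q S = genideal (path_algebra Q) {cyclic_derivative Q a S | a. a \<in> arcs Q}"

text \<open>Here an oriented cycle is any closed path of positive length.\<close>

definition rigid :: "('v, 'a) pre_digraph \<Rightarrow> ('v, 'a) path_comb \<Rightarrow> bool" where
  "rigid Q S \<longleftrightarrow> (\<forall>u p. pre_digraph.awalk Q u p u \<and> p \<noteq> [] \<longrightarrow>
     (\<exists>x\<in>jacobian_ideal Q S. cyclically_equivalent Q (Poly_Mapping.single (u, p) 1) x))"

section \<open>The BFZ quiver\<close>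

text \<open>
  Throughout, \<open>w = [i\<^sub>1, \<dots>, i\<^sub>N]\<close> is a word in the letters \<open>\<plusminus>1, \<dots>, \<plusminus>r\<close>; \<open>letter w k\<close> is \<open>i\<^sub>k\<close> and
  \<open>strand w k\<close> is \<open>\<bar>i\<^sub>k\<bar>\<close>, the vertex of the graph over which \<open>k\<close> is placed.
\<close>

definition index_set :: "nat \<Rightarrow> int list \<Rightarrow> int set" where
  "index_set r w = {- int r..-1} \<union> {1..int (length w)}"

definition letter :: "int list \<Rightarrow> int \<Rightarrow> int" where
  "letter w k = (if k < 0 then k else w ! nat (k - 1))"

definition strand :: "int list \<Rightarrow> int \<Rightarrow> nat" where
  "strand w k = nat \<bar>letter w k\<bar>"

definition next_index :: "nat \<Rightarrow> int list \<Rightarrow> int \<Rightarrow> int" where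
  "next_index r w k =
     Min (insert (int (length w) + 1) {l \<in> index_set r w. k < l \<and> strand w l = strand w k})"

definition vertical_arrows :: "nat \<Rightarrow> int list \<Rightarrow> (int \<times> int) set" where
  "vertical_arrows r w =
     {(k, l) | k l. k \<in> index_set r w \<and> l = next_index r w k \<and> l \<le> int (length w) \<and>
        sgn (letter w l) = 1} \<union>
     {(l, k) | k l. k \<in> index_set r w \<and> l = next_index r w k \<and> l \<le> int (length w) \<and>
        sgn (letter w l) = -1}"

definition inclined_pair :: "nat \<Rightarrow> nat set set \<Rightarrow> int list \<Rightarrow> int \<Rightarrow> int \<Rightarrow> bool" where
  "inclined_pair r E w k l \<longleftrightarrow>
     k \<in> index_set r w \<and> l \<in> index_set r w \<and> k < l \<and> 1 \<le> l \<and>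
     cartan E (strand w k) (strand w l) < 0 \<and>
     (l < next_index r w k \<and> next_index r w k < next_index r w l \<and>
        sgn (letter w l) = sgn (letter w (next_index r w k)) \<or>
      l < next_index r w l \<and> next_index r w l < next_index r w k \<and>
        sgn (letter w l) = - sgn (letter w (next_index r w l)))"

definition inclined_arrows :: "nat \<Rightarrow> nat set set \<Rightarrow> int list \<Rightarrow> (int \<times> int) set" where
  "inclined_arrows r E w =
     {(k, l) | k l. inclined_pair r E w k l \<and> sgn (letter w l) = -1} \<union>
     {(l, k) | k l. inclined_pair r E w k l \<and> sgn (letter w l) = 1}"

definition positions :: "int list \<Rightarrow> nat \<Rightarrow> nat \<Rightarrow> int set" where
  "positions w i j = {k \<in> {1..int (length w)}. strand w k \<in> {i, j}}"

definition last_on :: "nat \<Rightarrow> int list \<Rightarrow> nat \<Rightarrow> int" where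
  "last_on r w h = Max {k \<in> index_set r w. strand w k = h}"

text \<open>
  The edge \<open>{i, j}\<close> is named such that \<open>j\<close> is the absolute value of the first (for the lower arrow)
  or last (for the upper arrow) letter in question.
\<close>

definition boundary_arrows :: "nat \<Rightarrow> nat set set \<Rightarrow> int list \<Rightarrow> (int \<times> int) set" where
  "boundary_arrows r E w =
     {(- int i, - int j) | i j. {i, j} \<in> E \<and> positions w i j \<noteq> {} \<and>
        strand w (Min (positions w i j)) = j \<and> letter w (Min (positions w i j)) > 0} \<union>
     {(- int j, - int i) | i j. {i, j} \<in> E \<and> positions w i j \<noteq> {} \<and>
        strand w (Min (positions w i j)) = j \<and> letter w (Min (positions w i j)) < 0} \<union>
     {(last_on r w j, last_on r w i) | i j. {i, j} \<in> E \<and> positions w i j \<noteq> {} \<and>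
        strand w (Max (positions w i j)) = j \<and> letter w (Max (positions w i j)) > 0} \<union>
     {(last_on r w i, last_on r w j) | i j. {i, j} \<in> E \<and> positions w i j \<noteq> {} \<and>
        strand w (Max (positions w i j)) = j \<and> letter w (Max (positions w i j)) < 0}"

text \<open>
  No two indices are joined by more than one arrow: vertical arrows stay on one strand, an inclined
  pair has \<open>l \<ge> 1\<close> and one member that is not the last index on its strand, and the two boundary
  arrows of an edge differ because one of its strands carries a positive index. Hence an arrow can
  be encoded by the pair of its tail and head. Which vertices are frozen is not recorded, since
  derivatives are taken with respect to all arrows.
\<close>

definition bfz_quiver :: "nat \<Rightarrow> nat set set \<Rightarrow> int list \<Rightarrow> (int, int \<times> int) pre_digraph" where
  "bfz_quiver r E w =
     \<lparr>verts = index_set r w,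
      arcs = vertical_arrows r w \<union> inclined_arrows r E w \<union> boundary_arrows r E w,
      tail = fst, head = snd\<rparr>"


lemma fin_digraph_bfz_quiver:
  assumes "is_graph r E"
  shows "fin_digraph (bfz_quiver r E w)"
proof -
  have fin: "finite (index_set r w)" by (simp add: index_set_def)
  have nxt: "next_index r w k \<in> index_set r w" if "next_index r w k \<le> int (length w)" for k
    using Min_in[of "insert (int (length w) + 1) {l \<in> index_set r w. k < l \<and> strand w l = strand w k}"]
      fin that by (auto simp: next_index_def)
  have ends: "- int i \<in> index_set r w" "last_on r w i \<in> index_set r w"
    if "{i, j} \<in> E" for i j
  proof -
    have "1 \<le> i" "i \<le> r" using assms that by (auto simp: is_graph_def)
    then show *: "- int i \<in> index_set r w" by (simp add: index_set_def)
    have "strand w (- int i) = i" using \<open>1 \<le> i\<close> by (simp add: strand_def letter_def)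
    then show "last_on r w i \<in> index_set r w"
      unfolding last_on_def using Max_in[of "{k \<in> index_set r w. strand w k = i}"] fin * by auto
  qed
  have ends': "- int j \<in> index_set r w" "last_on r w j \<in> index_set r w"
    if "{i, j} \<in> E" for i j
    using ends[of j i] that by (simp_all add: insert_commute)
  have sub: "arcs (bfz_quiver r E w) \<subseteq> index_set r w \<times> index_set r w"
    unfolding bfz_quiver_def vertical_arrows_def inclined_arrows_def inclined_pair_def boundary_arrows_def
    using nxt ends ends' by auto
  then have "finite (arcs (bfz_quiver r E w))" using fin by (simp add: finite_subset)
  then show ?thesis
    using sub fin by unfold_locales (auto simp: bfz_quiver_def)
qed


section \<open>Sheets, faces and the superpotential\<close>

definition branch :: "nat \<Rightarrow> nat set set \<Rightarrow> nat list \<Rightarrow> bool" where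
  "branch r E p \<longleftrightarrow>
     2 \<le> length p \<and> distinct p \<and> set p \<subseteq> {1..r} \<and>
     (\<forall>m. Suc m < length p \<longrightarrow> {p ! m, p ! Suc m} \<in> E) \<and>
     (\<forall>i\<in>{hd p, last p}. degree E i = 1 \<or> degree E i > 2) \<and>
     (\<forall>m. 0 < m \<and> Suc m < length p \<longrightarrow> \<not> degree E (p ! m) > 2)"

text \<open>
  A list \<open>p\<close> and its reverse are the same branch. A planar orientation of the sheet over it is
  a choice between the two: the sheet is drawn in the plane with height as second coordinate
  and with \<open>p\<close> running from left to right.
\<close>

definition sheet_orientation :: "nat \<Rightarrow> nat set set \<Rightarrow> nat list set \<Rightarrow> bool" where
  "sheet_orientation r E P \<longleftrightarrow>
     (\<forall>p\<in>P. branch r E p) \<and> (\<forall>p. branch r E p \<longrightarrow> (p \<in> P) \<noteq> (rev p \<in> P))"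

definition height :: "nat \<Rightarrow> int list \<Rightarrow> int \<Rightarrow> real" where
  "height r w k = real (card {l \<in> index_set r w. l \<le> k})"

text \<open>
  The strip over the edge \<open>{a, b}\<close>, drawn in the plane with \<open>a\<close> on the left and \<open>b\<close> on the right.
\<close>

definition strip :: "(real \<times> real) set" where
  "strip = {0..1} \<times> {0..}"

definition point :: "nat \<Rightarrow> int list \<Rightarrow> nat \<Rightarrow> int \<Rightarrow> real \<times> real" where
  "point r w a k = (if strand w k = a then 0 else 1, height r w k)"

definition segment :: "nat \<Rightarrow> int list \<Rightarrow> nat \<Rightarrow> int \<times> int \<Rightarrow> (real \<times> real) set" where
  "segment r w a e = closed_segment (point r w a (fst e)) (point r w a (snd e))"

definition strip_arrows :: "nat \<Rightarrow> nat set set \<Rightarrow> int list \<Rightarrow> nat \<Rightarrow> nat \<Rightarrow> (int \<times> int) set" where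
  "strip_arrows r E w a b =
     {e \<in> arcs (bfz_quiver r E w). strand w (fst e) \<in> {a, b} \<and> strand w (snd e) \<in> {a, b}}"

definition faces :: "nat \<Rightarrow> nat set set \<Rightarrow> int list \<Rightarrow> nat \<Rightarrow> nat \<Rightarrow> (real \<times> real) set set" where
  "faces r E w a b =
     {F \<in> components (strip - \<Union> (segment r w a ` strip_arrows r E w a b)).
        bounded F \<and> frontier F \<subseteq> \<Union> (segment r w a ` strip_arrows r E w a b)}"

text \<open>
  The oriented cycle bounding a face, as a list of arrows. It is unique up to the choice of the
  starting point, which affects the superpotential only up to cyclic equivalence and does not
  affect its cyclic derivatives at all.
\<close>

definition bounding_cycle ::
  "nat \<Rightarrow> nat set set \<Rightarrow> int list \<Rightarrow> nat \<Rightarrow> nat \<Rightarrow> (real \<times> real) set \<Rightarrow> (int \<times> int) list" where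
  "bounding_cycle r E w a b F =
     (SOME c. pre_digraph.cycle (bfz_quiver r E w) c \<and> set c \<subseteq> strip_arrows r E w a b \<and>
        \<Union> (segment r w a ` set c) = frontier F)"

text \<open>The signed area enclosed by a polygon (shoelace formula); it is negative for clockwise ones.\<close>

definition signed_area :: "nat \<Rightarrow> int list \<Rightarrow> nat \<Rightarrow> (int \<times> int) list \<Rightarrow> real" where
  "signed_area r w a c = (\<Sum>(k, l)\<leftarrow>c.
     fst (point r w a k) * snd (point r w a l) - fst (point r w a l) * snd (point r w a k)) / 2"

definition cycle_potential :: "(int \<times> int) list \<Rightarrow> (int, int \<times> int) path_comb" where
  "cycle_potential c = Poly_Mapping.single (fst (hd c), c) 1"

definition superpotential ::
  "nat \<Rightarrow> nat set set \<Rightarrow> int list \<Rightarrow> nat list set \<Rightarrow> (int, int \<times> int) path_comb" where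
  "superpotential r E w P = (\<Sum>p\<in>P. \<Sum>m<length p - 1.
     let a = p ! m; b = p ! Suc m; c = bounding_cycle r E w a b in
     (\<Sum>F | F \<in> faces r E w a b \<and> signed_area r w a (c F) < 0. cycle_potential (c F)) -
     (\<Sum>F | F \<in> faces r E w a b \<and> signed_area r w a (c F) > 0. cycle_potential (c F)))"

end

theory Submission
  imports Defs
begin

text \<open>
  Over a single edge \<open>{a, b}\<close> of the graph the quiver is easy to describe. Draw the strand of \<open>a\<close> on
  the left and the strand of \<open>b\<close> on the right, and read the word from left to right, keeping track
  of the last index on either strand, the two tops. Call a letter of the strip clockwise if it is
  positive on the left or negative on the right; then its vertical arrow runs clockwise around the
  faces that it bounds. The tops are joined by an arrow precisely at those times, called levels
  here, after which the orientation of the letters of the strip changes; with suitable conventions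
  this covers the two boundary arrows, before the first and after the last letter
  (\<open>arcs_bfz_quiver\<close>). So the level arrows cut the strip into trapezoids (some of them triangles),
  one for every block of consecutive letters of the same orientation, and these are the faces
  (\<open>faces_eq\<close>). The cycle around a face consists of its bottom level arrow and of its roof: the path
  that goes up one strand, crosses the strip along the top level arrow and goes down the other
  strand.

  Let \<open>\<gamma>\<close> be the bottom level arrow of a face. Apart from that face, only the face below \<open>\<gamma>\<close>, if there
  is one, contains \<open>\<gamma>\<close>. The graph being a forest, every edge lies in exactly one sheet
  (\<open>edge_in_unique_sheet\<close>), so that each face enters the superpotential just once, with coefficient
  \<open>1\<close> or \<open>-1\<close>. Hence the derivative by \<open>\<gamma>\<close> is, up to signs, the roof over \<open>\<gamma>\<close> plus the path that leads
  around the face below \<open>\<gamma>\<close>; modulo the Jacobian ideal, a roof is a multiple of a path that crosses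
  the strip further down, or it is zero (\<open>superpotential_derivative\<close>).

  It remains to see that every closed walk contains a roof, up to rotation
  (\<open>closed_walk_contains_roof\<close>). Cut the walk at its crossings from one strand to another into runs
  along strands. Two neighbours on a strand are joined by a single arrow, so that every run goes only
  up or only down. Among all runs take one whose lowest vertex \<open>v\<close> is as high as possible, and suppose
  that the walk contains no roof. If \<open>v\<close> is positive, consider the crossing before the run and the
  face below it. The walk leaves this face before it reaches both bottom corners, and as the run on
  the other side of the crossing gets down to \<open>v\<close> or lower, \<open>v\<close> lies strictly above the bottom of the
  face; being on the side where the walk descends, the letter \<open>v\<close> is negative. In the same way the
  crossing after the run shows that \<open>v\<close> is positive as a letter, a contradiction. If \<open>v\<close> is negative
  as an index, then all runs touch the bottom, so every crossing above the lowest level does lie on a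
  roof. There is such a crossing, because a closed walk in a forest traverses some edge in both
  directions, whereas each strip has only one lowest arrow.

  Replacing roofs in this way lowers the crossings of the walk, so after finitely many steps every
  closed walk is, up to rotation, in the Jacobian ideal (\<open>closed_walk_reduces\<close>).
\<close>

section \<open>The arrows over an edge\<close>

definition strand_top :: "nat \<Rightarrow> int list \<Rightarrow> nat \<Rightarrow> int \<Rightarrow> int" where
  "strand_top r w a n = Max {k \<in> index_set r w. strand w k = a \<and> k \<le> n}"

text \<open>
  For a letter on one of the strands \<open>a\<close> and \<open>b\<close>: drawn with \<open>a\<close> on the left and \<open>b\<close> on the right,
  its vertical arrow goes up on the left or down on the right.
\<close>

definition clockwise_letter :: "int list \<Rightarrow> nat \<Rightarrow> int \<Rightarrow> bool" where
  "clockwise_letter w a m \<longleftrightarrow> (strand w m = a \<longleftrightarrow> letter w m > 0)"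

text \<open>
  The orientation of the last letter of the strip up to time \<open>n\<close>. Before the first letter it is
  opposite to the one of that letter, by convention; this turns the lower boundary arrow of the
  strip into an ordinary level arrow.
\<close>

definition orient :: "int list \<Rightarrow> nat \<Rightarrow> nat \<Rightarrow> int \<Rightarrow> bool" where
  "orient w a b n =
     (if \<exists>m\<in>positions w a b. m \<le> n then clockwise_letter w a (Max {m \<in> positions w a b. m \<le> n})
      else \<not> clockwise_letter w a (Min (positions w a b)))"

text \<open>
  A pair of tops persists for a while. It is registered at the last moment before the
  next letter of the strip, so that every arrow between the strands belongs to just one level.
\<close>

definition level :: "int list \<Rightarrow> nat \<Rightarrow> nat \<Rightarrow> int \<Rightarrow> bool" where
  "level w a b n \<longleftrightarrow> positions w a b \<noteq> {} \<and> 0 \<le> n \<and> n \<le> int (length w) \<and>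
     (n = int (length w) \<or> orient w a b n \<noteq> orient w a b (n + 1))"

definition vertical_at :: "nat \<Rightarrow> int list \<Rightarrow> int \<Rightarrow> int \<times> int" where
  "vertical_at r w m =
     (if letter w m > 0 then (strand_top r w (strand w m) (m - 1), m)
      else (m, strand_top r w (strand w m) (m - 1)))"

definition crossing_arrows :: "nat \<Rightarrow> nat set set \<Rightarrow> int list \<Rightarrow> (int \<times> int) set" where
  "crossing_arrows r E w = {(strand_top r w x n, strand_top r w y n) | x y n.
     {x, y} \<in> E \<and> level w x y n \<and> orient w x y n}"

lemma positions_commute: "positions w a b = positions w b a"
  by (auto simp: positions_def)

lemma finite_positions [simp]: "finite (positions w a b)"
  by (rule finite_subset[of _ "{1..int (length w)}"]) (auto simp: positions_def)

locale signed_word =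
  fixes r :: nat and w :: "int list"
  assumes letters: "x \<in> set w \<Longrightarrow> x \<noteq> 0 \<and> \<bar>x\<bar> \<le> int r"
begin

abbreviation "len \<equiv> int (length w)"
abbreviation "tp \<equiv> strand_top r w"

lemma letter_in_set: "1 \<le> m \<Longrightarrow> m \<le> len \<Longrightarrow> letter w m \<in> set w"
  by (auto simp: letter_def)

lemma letter_nonzero: "1 \<le> m \<Longrightarrow> m \<le> len \<Longrightarrow> letter w m \<noteq> 0"
  using letters letter_in_set by blast

lemma finite_index_set [simp]: "finite (index_set r w)"
  by (simp add: index_set_def)

lemma strand_neg: "k < 0 \<Longrightarrow> strand w k = nat (- k)"
  by (simp add: strand_def letter_def)

lemma strand_range: "k \<in> index_set r w \<Longrightarrow> strand w k \<in> {1..r}"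
  using letters[OF letter_in_set[of k]] by (auto simp: index_set_def strand_def letter_def)

lemma pos_index: "1 \<le> m \<Longrightarrow> m \<le> len \<Longrightarrow> m \<in> index_set r w"
  by (simp add: index_set_def)

lemma strand_top_props:
  assumes "a \<in> {1..r}" "0 \<le> n"
  shows strand_top_in: "tp a n \<in> index_set r w"
    and strand_strand_top: "strand w (tp a n) = a"
    and strand_top_le: "tp a n \<le> n"
proof -
  have "- int a \<in> {k \<in> index_set r w. strand w k = a \<and> k \<le> n}"
    using assms by (auto simp: index_set_def strand_neg)
  then have "tp a n \<in> {k \<in> index_set r w. strand w k = a \<and> k \<le> n}"
    unfolding strand_top_def by (intro Max_in) auto
  then show "tp a n \<in> index_set r w" "strand w (tp a n) = a" "tp a n \<le> n" by auto
qed

lemma strand_top_ge: "k \<in> index_set r w \<Longrightarrow> strand w k = a \<Longrightarrow> k \<le> n \<Longrightarrow> k \<le> tp a n"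
  unfolding strand_top_def by (intro Max_ge) auto

lemma strand_top_eqI:
  assumes "k \<in> index_set r w" "strand w k = a" "k \<le> n"
    and "\<And>l. l \<in> index_set r w \<Longrightarrow> strand w l = a \<Longrightarrow> l \<le> n \<Longrightarrow> l \<le> k"
  shows "tp a n = k"
  unfolding strand_top_def using assms by (intro Max_eqI) auto

lemma strand_top_zero:
  assumes "a \<in> {1..r}"
  shows "tp a 0 = - int a"
  using assms by (intro strand_top_eqI) (auto simp: index_set_def strand_neg)

lemma strand_top_step:
  assumes "a \<in> {1..r}" "1 \<le> m" "m \<le> len"
  shows "tp a m = (if strand w m = a then m else tp a (m - 1))"
proof (cases "strand w m = a")
  case True
  then show ?thesis using assms by (auto intro!: strand_top_eqI pos_index)
next
  case False
  have "{k \<in> index_set r w. strand w k = a \<and> k \<le> m} =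
      {k \<in> index_set r w. strand w k = a \<and> k \<le> m - 1}"
    using False by (auto simp: order_le_less)
  then show ?thesis using False by (simp add: strand_top_def)
qed

lemma strand_top_mono:
  assumes "a \<in> {1..r}" "0 \<le> n" "n \<le> n'"
  shows "tp a n \<le> tp a n'"
  using assms strand_top_props[of a n] by (intro strand_top_ge) auto

lemma strand_top_self:
  assumes "k \<in> index_set r w"
  shows "tp (strand w k) (max k 0) = k"
  using assms strand_neg by (intro strand_top_eqI) (auto simp: index_set_def)

lemma strand_top_eq_if_none:
  assumes "a \<in> {1..r}" "0 \<le> n" "n \<le> n'" "n' \<le> len"
    and "\<And>m. n < m \<Longrightarrow> m \<le> n' \<Longrightarrow> strand w m \<noteq> a"
  shows "tp a n' = tp a n"
proof (rule strand_top_eqI)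
  fix l assume l: "l \<in> index_set r w" "strand w l = a" "l \<le> n'"
  then have "l \<le> n" using assms(5)[of l] by force
  then show "l \<le> tp a n" using l by (intro strand_top_ge)
qed (use assms strand_top_props[of a n] in auto)

lemma last_on_eq: "last_on r w a = tp a len"
proof -
  have "{k \<in> index_set r w. strand w k = a} = {k \<in> index_set r w. strand w k = a \<and> k \<le> len}"
    by (auto simp: index_set_def)
  then show ?thesis by (simp add: last_on_def strand_top_def)
qed

text \<open>
  The value \<open>len + 1\<close> stands for a missing next index; otherwise the next index is a positive
  one, since each strand has only one negative index.
\<close>

lemma next_index_cases:
  assumes "k \<in> index_set r w"
  obtains "next_index r w k = len + 1"
      "\<And>l. l \<in> index_set r w \<Longrightarrow> strand w l = strand w k \<Longrightarrow> l \<le> k"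
  | "next_index r w k \<in> index_set r w" "1 \<le> next_index r w k" "next_index r w k \<le> len"
      "k < next_index r w k" "strand w (next_index r w k) = strand w k"
      "\<And>l. l \<in> index_set r w \<Longrightarrow> strand w l = strand w k \<Longrightarrow> k < l \<Longrightarrow> next_index r w k \<le> l"
proof -
  let ?S = "{l \<in> index_set r w. k < l \<and> strand w l = strand w k}"
  have fin: "finite ?S" by simp
  show ?thesis
  proof (cases "?S = {}")
    case True
    have "next_index r w k = len + 1" unfolding next_index_def True by simp
    moreover have "l \<le> k" if "l \<in> index_set r w" "strand w l = strand w k" for l
      using True that by (metis (mono_tags, lifting) empty_Collect_eq linorder_not_le)
    ultimately show ?thesis using that(1) by blast
  next
    case False
    have "Min ?S \<in> ?S" using Min_in[OF fin False] .
    then have "Min ?S \<le> len" by (auto simp: index_set_def)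
    then have eq: "next_index r w k = Min ?S"
      unfolding next_index_def Min_insert[OF fin False] by simp
    have nS: "next_index r w k \<in> ?S" using eq Min_in[OF fin False] by simp
    have "next_index r w k > 0"
    proof (rule ccontr)
      assume "\<not> 0 < next_index r w k"
      then have "next_index r w k < 0" "k < 0" using nS by (auto simp: index_set_def)
      then show False using nS by (auto simp: strand_neg)
    qed
    moreover have "next_index r w k \<le> l"
      if "l \<in> index_set r w" "strand w l = strand w k" "k < l" for l
      using eq fin that by auto
    ultimately show ?thesis using that(2) nS \<open>Min ?S \<le> len\<close> eq by auto
  qed
qed

text \<open>
  An index is on top of its strand from its own time until the next index on the strand appears.
\<close>

lemma strand_top_before_next:
  assumes "k \<in> index_set r w" "k \<le> n" "n < next_index r w k"
  shows "tp (strand w k) n = k"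
proof (rule strand_top_eqI)
  fix l assume l: "l \<in> index_set r w" "strand w l = strand w k" "l \<le> n"
  show "l \<le> k"
    using assms(1)
    by (rule next_index_cases) (use l assms in force)+
qed (use assms in auto)

lemma next_index_strand_top:
  assumes "1 \<le> m" "m \<le> len"
  shows "next_index r w (tp (strand w m) (m - 1)) = m"
proof -
  let ?k = "tp (strand w m) (m - 1)"
  have k: "?k \<in> index_set r w" "strand w ?k = strand w m" "?k \<le> m - 1"
    using assms strand_top_props[of "strand w m" "m - 1"] strand_range[OF pos_index[of m]] by auto
  show ?thesis
    using k(1)
  proof (rule next_index_cases)
    assume "\<And>l. l \<in> index_set r w \<Longrightarrow> strand w l = strand w ?k \<Longrightarrow> l \<le> ?k"
    then have "m \<le> ?k" using k pos_index assms by simp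
    then show ?thesis using k by simp
  next
    assume *: "next_index r w ?k \<in> index_set r w" "?k < next_index r w ?k"
      "strand w (next_index r w ?k) = strand w ?k"
      "\<And>l. l \<in> index_set r w \<Longrightarrow> strand w l = strand w ?k \<Longrightarrow> ?k < l \<Longrightarrow> next_index r w ?k \<le> l"
    have "next_index r w ?k \<le> m" using *(4)[of m] k pos_index assms by simp
    moreover have "\<not> next_index r w ?k \<le> m - 1"
      using strand_top_ge[of "next_index r w ?k" "strand w m" "m - 1"] * k by auto
    ultimately show ?thesis by simp
  qed
qed

lemma next_index_ge_if_other_strand:
  assumes "a \<in> {1..r}" "0 \<le> n" "n + 1 \<le> len" "strand w (n + 1) \<noteq> a"
  shows "n + 1 < next_index r w (tp a n)"
proof -
  have t: "tp a n \<in> index_set r w" "strand w (tp a n) = a" "tp a n \<le> n"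
    using strand_top_props assms by auto
  show ?thesis
    using t(1)
  proof (rule next_index_cases)
    assume *: "next_index r w (tp a n) \<in> index_set r w" "tp a n < next_index r w (tp a n)"
      "strand w (next_index r w (tp a n)) = strand w (tp a n)"
    have "\<not> next_index r w (tp a n) \<le> n" using strand_top_ge[OF *(1), of a n] * t by auto
    moreover have "next_index r w (tp a n) \<noteq> n + 1" using * t assms by auto
    ultimately show ?thesis by simp
  qed (use assms in auto)
qed

lemma vertical_arrows_eq: "vertical_arrows r w = vertical_at r w ` {1..len}"
proof (intro equalityI subsetI)
  fix e assume "e \<in> vertical_arrows r w"
  then obtain k l where kl: "k \<in> index_set r w" "l = next_index r w k" "l \<le> len"
    "e = (k, l) \<and> sgn (letter w l) = 1 \<or> e = (l, k) \<and> sgn (letter w l) = -1"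
    by (auto simp: vertical_arrows_def)
  have l: "1 \<le> l" "k < l" "strand w l = strand w k"
    using kl(3) unfolding kl(2) by - (rule next_index_cases[OF kl(1)]; simp)+
  have "tp (strand w l) (l - 1) = k"
    using strand_top_before_next[OF kl(1), of "l - 1"] kl(2) l by simp
  then have "e = vertical_at r w l"
    using kl(4) by (auto simp: vertical_at_def sgn_if split: if_splits)
  then show "e \<in> vertical_at r w ` {1..len}" using l kl by auto
next
  fix e assume "e \<in> vertical_at r w ` {1..len}"
  then obtain m where m: "1 \<le> m" "m \<le> len" "e = vertical_at r w m" by auto
  have "tp (strand w m) (m - 1) \<in> index_set r w"
    using m strand_top_props[of "strand w m" "m - 1"] strand_range[OF pos_index[of m]] by auto
  then show "e \<in> vertical_arrows r w"
    using m next_index_strand_top[of m] letter_nonzero[of m]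
    unfolding vertical_arrows_def vertical_at_def by (auto simp: sgn_if)
qed

lemma orient_step:
  assumes "positions w a b \<noteq> {}" "0 \<le> n" "n < len"
  shows "orient w a b (n + 1) =
    (if n + 1 \<in> positions w a b then clockwise_letter w a (n + 1) else orient w a b n)"
proof (cases "n + 1 \<in> positions w a b")
  case True
  have "Max {m \<in> positions w a b. m \<le> n + 1} = n + 1"
    using True by (intro Max_eqI) auto
  then show ?thesis using True by (auto simp: orient_def)
next
  case False
  have "{m \<in> positions w a b. m \<le> n + 1} = {m \<in> positions w a b. m \<le> n}"
    using False by (auto simp: order_le_less)
  moreover have "(\<exists>m\<in>positions w a b. m \<le> n + 1) \<longleftrightarrow> (\<exists>m\<in>positions w a b. m \<le> n)"
    using calculation by blast
  ultimately show ?thesis using False by (simp add: orient_def)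
qed

lemma clockwise_letter_swap:
  "m \<in> positions w a b \<Longrightarrow> a \<noteq> b \<Longrightarrow> clockwise_letter w b m \<longleftrightarrow> \<not> clockwise_letter w a m"
  by (auto simp: clockwise_letter_def positions_def)

lemma orient_swap:
  assumes "positions w a b \<noteq> {}" "a \<noteq> b"
  shows "orient w b a n \<longleftrightarrow> \<not> orient w a b n"
proof -
  have "Max {m \<in> positions w a b. m \<le> n} \<in> {m \<in> positions w a b. m \<le> n}"
    if "\<exists>m\<in>positions w a b. m \<le> n"
    using that by (intro Max_in) auto
  moreover have "Min (positions w a b) \<in> positions w a b"
    using assms by (intro Min_in) auto
  ultimately show ?thesis
    unfolding orient_def positions_commute[of w b a]
    using clockwise_letter_swap[of _ a b] assms(2) by auto
qed

lemma level_swap: "a \<noteq> b \<Longrightarrow> level w b a n \<longleftrightarrow> level w a b n"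
  unfolding level_def positions_commute[of w b a] using orient_swap[of a b] by auto

lemma level_bounds: "level w a b n \<Longrightarrow> 0 \<le> n \<and> n \<le> len"
  by (simp add: level_def)

lemma level_next_letter:
  assumes "level w a b n" "n < len"
  shows "n + 1 \<in> positions w a b"
  using assms orient_step[of a b n] by (auto simp: level_def split: if_splits)

lemma level_length: "positions w a b \<noteq> {} \<Longrightarrow> level w a b len"
  by (simp add: level_def)

end

locale bfz_data = signed_word r w for r w +
  fixes E :: "nat set set"
  assumes graph: "is_graph r E" and no_loop: "\<not> has_loop E" and no_cycle: "\<not> has_cycle E"
begin

lemma edge:
  assumes "{a, b} \<in> E"
  shows "a \<noteq> b" "a \<in> {1..r}" "b \<in> {1..r}"
  using assms graph no_loop by (auto simp: is_graph_def has_loop_def)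

text \<open>
  The level is the time just before either strand gets a new letter. At that time \<open>k\<close> and \<open>l\<close> are the
  tops and \<open>l\<close> is the last letter of the strip; both alternatives in the definition of an inclined
  pair say that the next letter of the strip has the other orientation than \<open>l\<close>.
\<close>

lemma inclined_pair_eq_level:
  assumes "inclined_pair r E w k l"
  obtains n where "{strand w k, strand w l} \<in> E" "level w (strand w k) (strand w l) n"
    "k = tp (strand w k) n" "l = tp (strand w l) n"
    "orient w (strand w k) (strand w l) n \<longleftrightarrow> letter w l < 0"
proof -
  let ?a = "strand w k" and ?b = "strand w l"
  let ?p = "next_index r w k" and ?q = "next_index r w l"
  have kl: "k \<in> index_set r w" "l \<in> index_set r w" "k < l" "1 \<le> l" "l \<le> len"
    and cartan: "cartan E ?a ?b < 0"
    and alt: "l < ?p \<and> ?p < ?q \<and> sgn (letter w l) = sgn (letter w ?p) \<or>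
      l < ?q \<and> ?q < ?p \<and> sgn (letter w l) = - sgn (letter w ?q)"
    using assms by (auto simp: inclined_pair_def index_set_def)
  have E: "{?a, ?b} \<in> E" and ab: "?a \<noteq> ?b"
    using cartan by (auto simp: cartan_def split: if_splits)
  define n where "n = min ?p ?q - 1"
  have p_le: "?p \<le> len + 1" and q_le: "?q \<le> len + 1"
    using next_index_cases[OF kl(1)] next_index_cases[OF kl(2)] by fastforce+
  have n: "l \<le> n" "n < len" using alt p_le q_le by (auto simp: n_def)
  have k_top: "tp ?a n = k" using strand_top_before_next[OF kl(1), of n] kl n by (auto simp: n_def)
  have l_top: "tp ?b n = l" using strand_top_before_next[OF kl(2), of n] kl n by (auto simp: n_def)
  have l_pos: "l \<in> positions w ?a ?b" using kl by (simp add: positions_def)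
  have "Max {m \<in> positions w ?a ?b. m \<le> n} = l"
  proof (rule Max_eqI)
    fix m assume m: "m \<in> {m \<in> positions w ?a ?b. m \<le> n}"
    then have "m \<le> tp ?a n \<or> m \<le> tp ?b n"
      using strand_top_ge[of m _ n] by (auto simp: positions_def intro: pos_index)
    then show "m \<le> l" using k_top l_top kl by auto
  qed (use l_pos n in auto)
  then have o: "orient w ?a ?b n \<longleftrightarrow> letter w l < 0"
    using l_pos n ab letter_nonzero[of l] kl by (auto simp: orient_def clockwise_letter_def)
  have nz: "letter w l \<noteq> 0" "letter w (n + 1) \<noteq> 0"
    using letter_nonzero kl n by auto
  have pos: "positions w ?a ?b \<noteq> {}" using l_pos by blast
  have o1: "orient w ?a ?b (n + 1) = clockwise_letter w ?a (n + 1)"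
    if "strand w (n + 1) = ?a \<or> strand w (n + 1) = ?b"
  proof -
    have "n + 1 \<in> positions w ?a ?b" using that n kl by (auto simp: positions_def)
    then show ?thesis using orient_step[OF pos] n kl by simp
  qed
  have "level w ?a ?b n"
    using alt
  proof
    assume A: "l < ?p \<and> ?p < ?q \<and> sgn (letter w l) = sgn (letter w ?p)"
    then have np: "n + 1 = ?p" by (simp add: n_def)
    have "strand w ?p = ?a"
      using kl(1) by (rule next_index_cases) (use np n in auto)
    then show ?thesis
      using o1 o n kl pos nz A ab np[symmetric]
      by (auto simp: level_def clockwise_letter_def sgn_if split: if_splits)
  next
    assume A: "l < ?q \<and> ?q < ?p \<and> sgn (letter w l) = - sgn (letter w ?q)"
    then have np: "n + 1 = ?q" by (simp add: n_def)
    have "strand w ?q = ?b"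
      using kl(2) by (rule next_index_cases) (use np n in auto)
    then show ?thesis
      using o1 o n kl pos nz A ab np[symmetric]
      by (auto simp: level_def clockwise_letter_def sgn_if split: if_splits)
  qed
  then show ?thesis using that[OF E] k_top l_top o by simp
qed

text \<open>
  The converse: the last letter \<open>l\<close> of the strip and the top of the other strand form an inclined pair,
  because the next letter of the strip is at once the next index of one of the two and comes before
  the next index of the other one.
\<close>

lemma level_inclined_pair:
  assumes "{z, z'} \<in> E" "level w z z' n" "n < len"
    and l: "l \<in> positions w z z'" "l = Max {m \<in> positions w z z'. m \<le> n}" "l \<le> n" "strand w l = z"
  shows "inclined_pair r E w (tp z' n) l" "l = tp z n" "orient w z z' n \<longleftrightarrow> letter w l > 0"
proof -
  note e = edge[OF assms(1)]
  have n: "0 \<le> n" using level_bounds assms by auto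
  have lr: "1 \<le> l" "l \<le> len" using l by (auto simp: positions_def)
  have l_max: "m \<le> l" if "m \<in> positions w z z'" "m \<le> n" for m
    unfolding l(2) using that by (intro Max_ge) auto
  show l_top: "l = tp z n"
  proof (rule strand_top_eqI[symmetric])
    fix m assume m: "m \<in> index_set r w" "strand w m = z" "m \<le> n"
    then show "m \<le> l" using l_max[of m] lr
      by (cases "m \<ge> 1") (auto simp: positions_def index_set_def)
  qed (use l lr pos_index in auto)
  show o: "orient w z z' n \<longleftrightarrow> letter w l > 0"
    using l by (auto simp: orient_def clockwise_letter_def)
  let ?k = "tp z' n"
  have k: "?k \<in> index_set r w" "strand w ?k = z'" "?k \<le> n"
    using strand_top_props[of z' n] e n by auto
  have "?k \<noteq> l" using k l e by auto
  moreover have "?k \<le> l"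
    using l_max[of ?k] lr k by (cases "?k \<ge> 1") (auto simp: positions_def index_set_def)
  ultimately have kl: "?k < l" by simp
  have np: "n + 1 \<in> positions w z z'" using level_next_letter assms by auto
  have nz: "letter w l \<noteq> 0" "letter w (n + 1) \<noteq> 0" using letter_nonzero lr n assms by auto
  have o': "orient w z z' n \<noteq> orient w z z' (n + 1)" using assms by (simp add: level_def)
  have o1: "orient w z z' (n + 1) = clockwise_letter w z (n + 1)"
    using orient_step[of z z' n] np n assms by auto
  have cart: "cartan E (strand w ?k) (strand w l) < 0"
    using assms(1) e l k by (auto simp: cartan_def insert_commute)
  show "inclined_pair r E w ?k l"
  proof (cases "strand w (n + 1) = z")
    case True
    have nl: "next_index r w l = n + 1"
      using next_index_strand_top[of "n + 1"] True n assms l_top by simp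
    moreover have "n + 1 < next_index r w ?k"
      using next_index_ge_if_other_strand[of z' n] e True n assms by auto
    moreover have "sgn (letter w l) = - sgn (letter w (n + 1))"
      using o o' o1 nz True by (auto simp: clockwise_letter_def sgn_if)
    ultimately show ?thesis
      unfolding inclined_pair_def using k kl lr cart pos_index l(3) by auto
  next
    case False
    then have z': "strand w (n + 1) = z'" using np by (auto simp: positions_def)
    have nl: "next_index r w ?k = n + 1"
      using next_index_strand_top[of "n + 1"] z' n assms by simp
    moreover have "n + 1 < next_index r w l"
      using next_index_ge_if_other_strand[of z n] e False n assms l_top by auto
    moreover have "sgn (letter w l) = sgn (letter w (n + 1))"
      using o o' o1 nz False by (auto simp: clockwise_letter_def sgn_if)
    ultimately show ?thesis
      unfolding inclined_pair_def using k kl lr cart pos_index l(3) by auto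
  qed
qed

lemma inclined_subset: "inclined_arrows r E w \<subseteq> crossing_arrows r E w"
proof
  fix e assume "e \<in> inclined_arrows r E w"
  then obtain k l where kl: "inclined_pair r E w k l"
    "e = (k, l) \<and> sgn (letter w l) = -1 \<or> e = (l, k) \<and> sgn (letter w l) = 1"
    by (auto simp: inclined_arrows_def)
  from kl(1) obtain n where n: "{strand w k, strand w l} \<in> E" "level w (strand w k) (strand w l) n"
    "k = tp (strand w k) n" "l = tp (strand w l) n"
    "orient w (strand w k) (strand w l) n \<longleftrightarrow> letter w l < 0"
    by (rule inclined_pair_eq_level)
  have pos: "positions w (strand w k) (strand w l) \<noteq> {}" using n by (simp add: level_def)
  show "e \<in> crossing_arrows r E w"
    using kl(2)
  proof
    assume "e = (k, l) \<and> sgn (letter w l) = -1"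
    then show ?thesis unfolding crossing_arrows_def using n by (force simp: sgn_if split: if_splits)
  next
    assume A: "e = (l, k) \<and> sgn (letter w l) = 1"
    then have "\<not> orient w (strand w k) (strand w l) n" using n
      by (auto simp: sgn_if split: if_splits)
    then have "orient w (strand w l) (strand w k) n" "level w (strand w l) (strand w k) n"
      using orient_swap[OF pos] level_swap edge[OF n(1)] n by auto
    moreover have "{strand w l, strand w k} \<in> E" using n by (simp add: insert_commute)
    moreover have "e = (tp (strand w l) n, tp (strand w k) n)" using A n by simp
    ultimately show ?thesis unfolding crossing_arrows_def by blast
  qed
qed

text \<open>
  Below the first letter of the strip the tops are the two negative indices.
\<close>

lemma lowest_level:
  assumes "{i, j} \<in> E" "positions w i j \<noteq> {}" "m = Min (positions w i j)"
  shows "level w i j (m - 1)" "tp i (m - 1) = - int i" "tp j (m - 1) = - int j"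
    "orient w i j (m - 1) \<longleftrightarrow> \<not> clockwise_letter w i m"
proof -
  note e = edge[OF assms(1)]
  have m: "m \<in> positions w i j" unfolding assms(3) using assms(2) by (intro Min_in) auto
  then have mr: "1 \<le> m" "m \<le> len" by (auto simp: positions_def)
  have least: "m \<le> l" if "l \<in> positions w i j" for l
    unfolding assms(3) using that by (intro Min_le) auto
  then have "\<not> (\<exists>l\<in>positions w i j. l \<le> m - 1)" by force
  then show o: "orient w i j (m - 1) \<longleftrightarrow> \<not> clockwise_letter w i m"
    using assms(3) by (simp add: orient_def)
  then show "level w i j (m - 1)"
    using orient_step[of i j "m - 1"] assms(2) m mr by (simp add: level_def)
  have "tp a (m - 1) = - int a" if "a \<in> {i, j}" for a
  proof -
    have "tp a (m - 1) = tp a 0"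
    proof (rule strand_top_eq_if_none)
      fix l assume "0 < l" "l \<le> m - 1"
      then show "strand w l \<noteq> a" using least[of l] that mr by (auto simp: positions_def)
    qed (use that e mr in auto)
    then show ?thesis using strand_top_zero[of a] that e by auto
  qed
  then show "tp i (m - 1) = - int i" "tp j (m - 1) = - int j" by auto
qed

lemma highest_orient:
  assumes "positions w i j \<noteq> {}"
  shows "orient w i j len \<longleftrightarrow> clockwise_letter w i (Max (positions w i j))"
proof -
  have "{m \<in> positions w i j. m \<le> len} = positions w i j" by (auto simp: positions_def)
  moreover have "\<exists>m\<in>positions w i j. m \<le> len" using assms by (auto simp: positions_def)
  ultimately show ?thesis by (simp add: orient_def)
qed

lemma crossingI:
  "{x, y} \<in> E \<Longrightarrow> level w x y n \<Longrightarrow> orient w x y n \<Longrightarrow> (tp x n, tp y n) \<in> crossing_arrows r E w"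
  by (auto simp: crossing_arrows_def)

text \<open>
  The four cases in the definition distinguish the sign of the first or last letter and the strand it
  is on. Only their combination, the orientation of that letter, matters.
\<close>

lemma boundary_arrows_iff:
  "e \<in> boundary_arrows r E w \<longleftrightarrow> (\<exists>x y. {x, y} \<in> E \<and> positions w x y \<noteq> {} \<and>
     (e = (- int x, - int y) \<and> \<not> clockwise_letter w x (Min (positions w x y)) \<or>
      e = (last_on r w x, last_on r w y) \<and> clockwise_letter w x (Max (positions w x y))))"
  (is "_ \<longleftrightarrow> ?R")
proof
  have swap: "{j, i} \<in> E" "positions w j i = positions w i j" "i \<noteq> j" if "{i, j} \<in> E"
    for i j
    using that edge by (auto simp: insert_commute positions_commute)
  assume "e \<in> boundary_arrows r E w"
  then show ?R
    unfolding boundary_arrows_def Un_iff mem_Collect_eq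
  proof (elim disjE exE conjE)
    fix i j assume "e = (- int i, - int j)" "{i, j} \<in> E" "positions w i j \<noteq> {}"
      "strand w (Min (positions w i j)) = j" "0 < letter w (Min (positions w i j))"
    then show ?R using swap[of i j]
      by (intro exI[of _ i] exI[of _ j]) (simp add: clockwise_letter_def)
  next
    fix i j assume "e = (- int j, - int i)" "{i, j} \<in> E" "positions w i j \<noteq> {}"
      "strand w (Min (positions w i j)) = j" "letter w (Min (positions w i j)) < 0"
    then show ?R using swap[of i j]
      by (intro exI[of _ j] exI[of _ i]) (simp add: clockwise_letter_def)
  next
    fix i j assume "e = (last_on r w j, last_on r w i)" "{i, j} \<in> E" "positions w i j \<noteq> {}"
      "strand w (Max (positions w i j)) = j" "0 < letter w (Max (positions w i j))"
    then show ?R using swap[of i j]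
      by (intro exI[of _ j] exI[of _ i]) (simp add: clockwise_letter_def)
  next
    fix i j assume "e = (last_on r w i, last_on r w j)" "{i, j} \<in> E" "positions w i j \<noteq> {}"
      "strand w (Max (positions w i j)) = j" "letter w (Max (positions w i j)) < 0"
    then show ?R using swap[of i j]
      by (intro exI[of _ i] exI[of _ j]) (simp add: clockwise_letter_def)
  qed
next
  have cw: "clockwise_letter w x m \<and> (strand w m = x \<and> letter w m > 0 \<or> strand w m = y \<and> letter w m < 0) \<or>
      \<not> clockwise_letter w x m \<and> (strand w m = y \<and> letter w m > 0 \<or> strand w m = x \<and> letter w m < 0)"
    if "{x, y} \<in> E" "m \<in> positions w x y" for x y m
    using that edge letter_nonzero[of m] by (auto simp: clockwise_letter_def positions_def)
  assume ?R
  then obtain x y where xy: "{x, y} \<in> E" "positions w x y \<noteq> {}" and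
    alt: "e = (- int x, - int y) \<and> \<not> clockwise_letter w x (Min (positions w x y)) \<or>
      e = (last_on r w x, last_on r w y) \<and> clockwise_letter w x (Max (positions w x y))"
    by blast
  have yx: "{y, x} \<in> E" "positions w y x = positions w x y"
    using xy by (auto simp: insert_commute positions_commute)
  note low = cw[OF xy(1) Min_in[OF finite_positions xy(2)]]
    and high = cw[OF xy(1) Max_in[OF finite_positions xy(2)]]
  from alt show "e \<in> boundary_arrows r E w"
  proof
    assume "e = (- int x, - int y) \<and> \<not> clockwise_letter w x (Min (positions w x y))"
    then show ?thesis
      using low xy yx unfolding boundary_arrows_def Un_iff mem_Collect_eq by metis
  next
    assume "e = (last_on r w x, last_on r w y) \<and> clockwise_letter w x (Max (positions w x y))"
    then show ?thesis
      using high xy yx unfolding boundary_arrows_def Un_iff mem_Collect_eq by metis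
  qed
qed

lemma boundary_subset: "boundary_arrows r E w \<subseteq> crossing_arrows r E w"
proof
  fix e assume "e \<in> boundary_arrows r E w"
  then obtain x y where xy: "{x, y} \<in> E" "positions w x y \<noteq> {}" and
    alt: "e = (- int x, - int y) \<and> \<not> clockwise_letter w x (Min (positions w x y)) \<or>
      e = (last_on r w x, last_on r w y) \<and> clockwise_letter w x (Max (positions w x y))"
    unfolding boundary_arrows_iff by blast
  from alt show "e \<in> crossing_arrows r E w"
  proof
    assume "e = (- int x, - int y) \<and> \<not> clockwise_letter w x (Min (positions w x y))"
    then show ?thesis
      using lowest_level[OF xy HOL.refl] crossingI[of x y "Min (positions w x y) - 1"] xy by simp
  next
    assume "e = (last_on r w x, last_on r w y) \<and> clockwise_letter w x (Max (positions w x y))"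
    then show ?thesis
      using highest_orient[OF xy(2)] crossingI[of x y len] xy level_length by (simp add: last_on_eq)
  qed
qed

lemma crossing_subset: "crossing_arrows r E w \<subseteq> inclined_arrows r E w \<union> boundary_arrows r E w"
proof
  fix e assume "e \<in> crossing_arrows r E w"
  then obtain x y n where e: "e = (tp x n, tp y n)" and xy: "{x, y} \<in> E" and
    lev: "level w x y n" and o: "orient w x y n"
    by (auto simp: crossing_arrows_def)
  note ed = edge[OF xy]
  have yx: "{y, x} \<in> E" "level w y x n" "positions w y x = positions w x y"
    using xy level_swap[of x y n] ed lev by (auto simp: insert_commute positions_commute)
  have pos: "positions w x y \<noteq> {}" using lev by (simp add: level_def)
  have o': "\<not> orient w y x n" using o orient_swap[OF pos] ed by simp
  consider (top) "n = len" | (bottom) "n < len" "\<not> (\<exists>m\<in>positions w x y. m \<le> n)"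
    | (middle) "n < len" "\<exists>m\<in>positions w x y. m \<le> n"
    using level_bounds[OF lev] by linarith
  then show "e \<in> inclined_arrows r E w \<union> boundary_arrows r E w"
  proof cases
    case top
    then have "e \<in> boundary_arrows r E w"
      unfolding boundary_arrows_iff e last_on_eq using xy pos o highest_orient[OF pos] by blast
    then show ?thesis ..
  next
    case bottom
    define m where "m = Min (positions w x y)"
    have m: "m \<in> positions w x y" unfolding m_def using pos by (intro Min_in) auto
    have np: "n + 1 \<in> positions w x y" using level_next_letter lev bottom by auto
    have "m \<le> n + 1" unfolding m_def using np by (intro Min_le) auto
    then have nm: "n = m - 1" using bottom m by force
    have "\<not> clockwise_letter w x (Min (positions w x y))" using o bottom by (auto simp: orient_def)
    moreover have "e = (- int x, - int y)"
      unfolding e nm using lowest_level[OF xy pos m_def] by simp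
    ultimately have "e \<in> boundary_arrows r E w"
      unfolding boundary_arrows_iff using xy pos by blast
    then show ?thesis ..
  next
    case middle
    define l where "l = Max {m \<in> positions w x y. m \<le> n}"
    have l': "l \<in> {m \<in> positions w x y. m \<le> n}"
      unfolding l_def using middle by (intro Max_in) auto
    then have l: "l \<in> positions w x y" "l \<le> n" by auto
    have nz: "letter w l \<noteq> 0" using l letter_nonzero by (auto simp: positions_def)
    have "e \<in> inclined_arrows r E w"
    proof (cases "strand w l = x")
      case True
      then show ?thesis
        using level_inclined_pair[OF xy lev middle(1) l(1) l_def l(2)] o
        unfolding e inclined_arrows_def by (auto simp: sgn_if)
    next
      case False
      then have ly: "strand w l = y" using l by (auto simp: positions_def)
      have l1: "l \<in> positions w y x" "l = Max {m \<in> positions w y x. m \<le> n}"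
        using l l_def yx by auto
      show ?thesis
        using level_inclined_pair[OF yx(1,2) middle(1) l1 l(2) ly] o' nz
        unfolding e inclined_arrows_def by (auto simp: sgn_if)
    qed
    then show ?thesis ..
  qed
qed

text \<open>
  With the conventions on levels, inclined and boundary arrows become a single family.
\<close>

lemma arcs_bfz_quiver:
  "arcs (bfz_quiver r E w) = vertical_at r w ` {1..len} \<union> crossing_arrows r E w"
  using inclined_subset boundary_subset crossing_subset vertical_arrows_eq
  by (auto simp: bfz_quiver_def)

end

section \<open>Walks in forests and walks along strands\<close>

text \<open>
  In the quiver an arrow is the pair of its ends, so walks are chains of pairs.
\<close>

fun chain :: "'v \<Rightarrow> ('v \<times> 'v) list \<Rightarrow> 'v \<Rightarrow> bool" where
  "chain u [] v \<longleftrightarrow> u = v"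
| "chain u (e # p) v \<longleftrightarrow> fst e = u \<and> chain (snd e) p v"

lemma chain_append: "chain u (p @ q) v \<longleftrightarrow> (\<exists>m. chain u p m \<and> chain m q v)"
  by (induction p arbitrary: u) auto

lemma chain_snoc: "chain u (p @ [e]) v \<longleftrightarrow> chain u p (fst e) \<and> snd e = v"
  by (auto simp: chain_append)

lemma chain_start: "chain u p v \<Longrightarrow> p \<noteq> [] \<Longrightarrow> fst (hd p) = u"
  by (cases p) auto

lemma chain_end_unique: "chain u p v \<Longrightarrow> chain u p v' \<Longrightarrow> v = v'"
  by (induction p arbitrary: u) auto

lemma cas_bfz_quiver: "pre_digraph.cas (bfz_quiver r E w) u p v \<longleftrightarrow> chain u p v"
  by (induction p arbitrary: u) (auto simp: pre_digraph.cas.simps bfz_quiver_def)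

lemma not_distinct_map_decomp:
  assumes "\<not> distinct (map f h)"
  obtains X e Y e' Z where "h = X @ e # Y @ e' # Z" "f e = f e'"
proof -
  obtain xs ys zs y where "map f h = xs @ [y] @ ys @ [y] @ zs"
    using not_distinct_decomp[OF assms] by auto
  then show ?thesis
    using that by (auto simp: append_eq_map_conv Cons_eq_map_conv map_eq_append_conv map_eq_Cons_conv)
qed

text \<open>
  A shortest closed subwalk visits no vertex twice. With three or more steps it would be a cycle of
  the graph, with one step a loop; so it has two steps.
\<close>

lemma closed_walk_in_forest:
  assumes "chain s g s" "g \<noteq> []"
    and edges: "\<And>x y. (x, y) \<in> set g \<Longrightarrow> {x, y} \<in> E"
    and "\<not> has_loop E" "\<not> has_cycle E"
  shows "\<exists>x y. (x, y) \<in> set g \<and> (y, x) \<in> set g"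
proof -
  define P where "P h \<longleftrightarrow> h \<noteq> [] \<and> set h \<subseteq> set g \<and> (\<exists>t. chain t h t)" for h
  have "P g" using assms by (auto simp: P_def)
  then obtain h where h: "P h" and min: "\<And>h'. P h' \<Longrightarrow> length h \<le> length h'"
    using ex_has_least_nat[of P g length] by auto
  obtain t where t: "chain t h t" using h by (auto simp: P_def)
  have hE: "{fst e, snd e} \<in> E" if "e \<in> set h" for e
    using edges[of "fst e" "snd e"] h that by (auto simp: P_def)
  have dist: "distinct (map fst h)"
  proof (rule ccontr)
    assume "\<not> distinct (map fst h)"
    then obtain X e Y e' Z where h_eq: "h = X @ e # Y @ e' # Z" and ee: "fst e = fst e'"
      by (rule not_distinct_map_decomp)
    have "P (e # Y)" using h t ee unfolding P_def h_eq by (auto simp: chain_append)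
    then show False using min[of "e # Y"] by (simp add: h_eq)
  qed
  have next_edge: "snd (h ! i) = fst (h ! Suc i)" if "Suc i < length h" for i
  proof -
    have "h = take i h @ h ! i # h ! Suc i # drop (Suc (Suc i)) h"
      using that by (metis Cons_nth_drop_Suc Suc_lessD append_take_drop_id)
    then show ?thesis using t by (metis chain.simps(2) chain_append)
  qed
  have last: "snd (last h) = fst (hd h)"
    using t h chain_start[OF t] by (cases h rule: rev_cases) (auto simp: P_def chain_snoc)
  consider "length h = 1" | "length h = 2" | "length h \<ge> 3"
    using h length_0_conv[of h] unfolding P_def by linarith
  then show ?thesis
  proof cases
    case 1
    then obtain e where "h = [e]" by (auto simp: length_Suc_conv)
    then have "{fst e} \<in> E" using t hE[of e] by auto
    then show ?thesis using \<open>\<not> has_loop E\<close> by (auto simp: has_loop_def)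
  next
    case 2
    then obtain e e' where "h = [e, e']" by (auto simp: numeral_2_eq_2 length_Suc_conv)
    then show ?thesis using t h unfolding P_def by (cases e; cases e') auto
  next
    case 3
    let ?c = "map fst h"
    have "{?c ! m, ?c ! Suc m} \<in> E" if "Suc m < length ?c" for m
      using hE[of "h ! m"] next_edge[of m] that by simp
    moreover have "{last ?c, hd ?c} \<in> E"
      using hE[of "last h"] last h by (simp add: P_def last_map hd_map)
    ultimately have "has_cycle E" unfolding has_cycle_def
      using 3 dist by (intro exI[of _ ?c]) auto
    then show ?thesis using \<open>\<not> has_cycle E\<close> by simp
  qed
qed

definition up :: "nat \<Rightarrow> int list \<Rightarrow> nat \<Rightarrow> int \<Rightarrow> int \<Rightarrow> (int \<times> int) list" where
  "up r w a n n' = map (\<lambda>m. (strand_top r w a (m - 1), m)) (filter (\<lambda>m. strand w m = a) [n + 1..n'])"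

definition down :: "nat \<Rightarrow> int list \<Rightarrow> nat \<Rightarrow> int \<Rightarrow> int \<Rightarrow> (int \<times> int) list" where
  "down r w a n n' = rev (map (\<lambda>m. (m, strand_top r w a (m - 1))) (filter (\<lambda>m. strand w m = a) [n + 1..n']))"

text \<open>
  For a block from \<open>n\<close> to \<open>n'\<close> whose letters are positive on \<open>x\<close> and negative on \<open>y\<close>, this is the way around
  the face, without its bottom arrow.
\<close>

definition roof :: "nat \<Rightarrow> int list \<Rightarrow> nat \<Rightarrow> nat \<Rightarrow> int \<Rightarrow> int \<Rightarrow> (int \<times> int) list" where
  "roof r w x y n n' =
     up r w x n n' @ (strand_top r w x n', strand_top r w y n') # down r w y n n'"

text \<open>
  Two consecutive levels; the letters of the strip in between bound a face.
\<close>

definition block :: "int list \<Rightarrow> nat \<Rightarrow> nat \<Rightarrow> int \<Rightarrow> int \<Rightarrow> bool" where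
  "block w a b n n' \<longleftrightarrow> level w a b n \<and> level w a b n' \<and> n < n' \<and>
     (\<forall>l. n < l \<and> l < n' \<longrightarrow> \<not> level w a b l)"

lemma up_empty [simp]: "up r w a n n = []" by (simp add: up_def)
lemma down_empty [simp]: "down r w a n n = []" by (simp add: down_def)

lemma up_step: "n \<le> n' \<Longrightarrow> up r w a n (n' + 1) =
    up r w a n n' @ (if strand w (n' + 1) = a then [(strand_top r w a n', n' + 1)] else [])"
  by (simp add: up_def upto_rec2[of "n + 1" "n' + 1"])

lemma down_step: "n \<le> n' \<Longrightarrow> down r w a n (n' + 1) =
    (if strand w (n' + 1) = a then [(n' + 1, strand_top r w a n')] else []) @ down r w a n n'"
  by (simp add: down_def upto_rec2[of "n + 1" "n' + 1"])

lemma up_split: "n \<le> k \<Longrightarrow> k \<le> n' \<Longrightarrow> up r w a n n' = up r w a n k @ up r w a k n'"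
  using upto_split2[of "n + 1" k n'] by (cases "n = k") (simp_all add: up_def)

lemma down_split: "n \<le> k \<Longrightarrow> k \<le> n' \<Longrightarrow> down r w a n n' = down r w a k n' @ down r w a n k"
  using upto_split2[of "n + 1" k n'] by (cases "n = k") (simp_all add: down_def)

lemma set_up: "set (up r w a n n') = {(strand_top r w a (m - 1), m) | m. strand w m = a \<and> n < m \<and> m \<le> n'}"
  by (auto simp: up_def)

lemma set_down: "set (down r w a n n') = {(m, strand_top r w a (m - 1)) | m. strand w m = a \<and> n < m \<and> m \<le> n'}"
  by (auto simp: down_def)

context signed_word
begin

lemma up_Nil_if_top_eq:
  assumes "a \<in> {1..r}" "0 \<le> n" "n' \<le> len" "tp a n' = tp a n"
  shows "up r w a n n' = []" "down r w a n n' = []"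
proof -
  have False if "strand w m = a" "n < m" "m \<le> n'" for m
    using strand_top_ge[of m a n'] strand_top_props[of a n] assms that pos_index[of m] by simp
  then show "up r w a n n' = []" "down r w a n n' = []"
    unfolding set_empty[symmetric] set_up set_down by blast+
qed

lemma chain_up:
  assumes "a \<in> {1..r}" "0 \<le> n" "n \<le> n'" "n' \<le> len"
  shows "chain (tp a n) (up r w a n n') (tp a n')"
  using assms(3,4)
proof (induction n' rule: int_ge_induct)
  case (step i)
  then show ?case using assms strand_top_step[of a "i + 1"]
    by (auto simp: up_step chain_snoc)
qed simp

lemma chain_down:
  assumes "a \<in> {1..r}" "0 \<le> n" "n \<le> n'" "n' \<le> len"
  shows "chain (tp a n') (down r w a n n') (tp a n)"
  using assms(3,4)
proof (induction n' rule: int_ge_induct)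
  case (step i)
  then show ?case using assms strand_top_step[of a "i + 1"]
    by (auto simp: down_step)
qed simp

lemma vertical_at_props:
  assumes "1 \<le> m" "m \<le> len" "a = strand w m"
  shows "a \<in> {1..r}" "tp a (m - 1) \<in> index_set r w" "strand w (tp a (m - 1)) = a"
    "tp a (m - 1) \<le> m - 1" "tp a m = m"
  using strand_top_props[of a "m - 1"] strand_range[OF pos_index[of m]] strand_top_step[of a m] assms
  by auto

text \<open>
  Neighbours on a strand are joined by an arrow in one direction only.
\<close>

lemma vertical_arrow_up_iff:
  assumes "1 \<le> m" "m \<le> len"
  shows "(tp (strand w m) (m - 1), m) \<in> vertical_at r w ` {1..len} \<longleftrightarrow> letter w m > 0"
    and "(m, tp (strand w m) (m - 1)) \<in> vertical_at r w ` {1..len} \<longleftrightarrow> letter w m < 0"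
proof -
  let ?t = "tp (strand w m) (m - 1)"
  have t: "?t < m" using vertical_at_props[OF assms HOL.refl] by simp
  have less: "tp (strand w m') (m' - 1) < m'" if "m' \<in> {1..len}" for m'
    using vertical_at_props[of m', OF _ _ HOL.refl] that by simp
  have *: "e = (?t, m) \<Longrightarrow> letter w m > 0" "e = (m, ?t) \<Longrightarrow> letter w m < 0"
    if e: "e = vertical_at r w m'" "m' \<in> {1..len}" for e m'
  proof -
    have "letter w m' \<noteq> 0" using letter_nonzero[of m'] e by simp
    then have m': "e = (tp (strand w m') (m' - 1), m') \<and> letter w m' > 0 \<or>
        e = (m', tp (strand w m') (m' - 1)) \<and> letter w m' < 0"
      using e by (auto simp: vertical_at_def)
    have less: "tp (strand w m') (m' - 1) < m'" using less e by simp
    show "letter w m > 0" if "e = (?t, m)"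
      using m'
    proof
      assume "e = (m', tp (strand w m') (m' - 1)) \<and> letter w m' < 0"
      then show ?thesis using that less t by simp
    qed (use that in simp)
    show "letter w m < 0" if "e = (m, ?t)"
      using m'
    proof
      assume "e = (tp (strand w m') (m' - 1), m') \<and> letter w m' > 0"
      then show ?thesis using that less t by simp
    qed (use that in simp)
  qed
  have m: "m \<in> {1..len}" using assms by simp
  have "(?t, m) = vertical_at r w m" if "letter w m > 0" using that by (simp add: vertical_at_def)
  then show "(?t, m) \<in> vertical_at r w ` {1..len} \<longleftrightarrow> letter w m > 0"
    using *(1)[OF _ _ HOL.refl] m by blast
  have "(m, ?t) = vertical_at r w m" if "letter w m < 0" using that by (simp add: vertical_at_def)
  then show "(m, ?t) \<in> vertical_at r w ` {1..len} \<longleftrightarrow> letter w m < 0"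
    using *(2)[OF _ _ HOL.refl] m by blast
qed

lemma no_index_between:
  assumes "1 \<le> m" "m \<le> len" "k \<in> index_set r w" "strand w k = strand w m" "k < m"
  shows "k \<le> tp (strand w m) (m - 1)"
  using strand_top_ge[of k "strand w m" "m - 1"] assms by simp

lemma up_down_single:
  assumes "1 \<le> m" "m \<le> len" "a = strand w m" "k = tp a (m - 1)"
  shows "up r w a (max k 0) m = [(k, m)]" "down r w a (max k 0) m = [(m, k)]"
proof -
  note v = vertical_at_props[OF assms(1-3)]
  have e: "tp a (m - 1) = tp a (max k 0)" using strand_top_self[of k] v assms by simp
  have le: "max k 0 \<le> m - 1" using v assms by simp
  show "up r w a (max k 0) m = [(k, m)]"
    using up_step[OF le, of r w a] up_Nil_if_top_eq(1)[OF v(1) _ _ e] assms by simp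
  show "down r w a (max k 0) m = [(m, k)]"
    using down_step[OF le, of r w a] up_Nil_if_top_eq(2)[OF v(1) _ _ e] assms by simp
qed

text \<open>
  A walk along a strand cannot turn, because turning would use the arrow between two neighbours in both
  directions. So it is determined by its ends. The time at which an index \<open>u\<close> first is on top is
  \<open>max u 0\<close>, since negative indices are there from the beginning.
\<close>

lemma vertical_walk:
  assumes "set q \<subseteq> vertical_at r w ` {1..len}" "chain u q v" "u \<in> index_set r w"
  shows "v \<in> index_set r w \<and> strand w v = strand w u \<and>
    (u \<le> v \<and> q = up r w (strand w u) (max u 0) (max v 0) \<or>
     v \<le> u \<and> q = down r w (strand w u) (max v 0) (max u 0))"
  using assms
proof (induction q arbitrary: u)
  case (Cons e q)
  from Cons.prems obtain m where m: "1 \<le> m" "m \<le> len" "e = vertical_at r w m" by auto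
  define a where "a = strand w m"
  define k where "k = tp a (m - 1)"
  note vp = vertical_at_props[OF m(1,2) a_def]
  note ud = up_down_single[OF m(1,2) a_def k_def]
  have k: "k \<in> index_set r w" "strand w k = a" "k \<le> m - 1" using vp k_def by auto
  have mm: "max m 0 = m" using m by simp
  show ?case
  proof (cases "letter w m > 0")
    case True
    then have e: "e = (k, m)" using m a_def k_def by (simp add: vertical_at_def)
    then have u: "u = k" and ch: "chain m q v" using Cons.prems by auto
    have IH: "v \<in> index_set r w" "strand w v = a"
      "m \<le> v \<and> q = up r w a m (max v 0) \<or> v \<le> m \<and> q = down r w a (max v 0) m"
      using Cons.IH[OF _ ch] Cons.prems pos_index[OF m(1,2)] a_def mm by auto
    \<comment> \<open>going down from \<open>m\<close> would use the arrow from \<open>m\<close> to \<open>k\<close>, which points the other way\<close>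
    have "m \<le> v \<and> q = up r w a m (max v 0)"
    proof (rule ccontr)
      assume "\<not> ?thesis"
      then have v: "v < m" "q = down r w a (max v 0) m" using IH(3) mm by (auto simp: le_less)
      then have "(m, tp a (m - 1)) \<in> set q" unfolding v(2) set_down using a_def m by auto
      then have "letter w m < 0"
        using Cons.prems(1) vertical_arrow_up_iff(2)[OF m(1,2)] a_def by auto
      then show False using True by simp
    qed
    then have "k \<le> v \<and> e # q = up r w a (max k 0) (max v 0)"
      using k m e ud up_split[of "max k 0" m "max v 0" r w a] by auto
    then show ?thesis using IH u k by simp
  next
    case False
    then have e: "e = (m, k)" using m a_def k_def by (simp add: vertical_at_def)
    then have u: "u = m" and ch: "chain k q v" using Cons.prems by auto
    have IH: "v \<in> index_set r w" "strand w v = a"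
      "k \<le> v \<and> q = up r w a (max k 0) (max v 0) \<or> v \<le> k \<and> q = down r w a (max v 0) (max k 0)"
      using Cons.IH[OF _ ch] Cons.prems k by auto
    \<comment> \<open>going up from \<open>k\<close> would use the arrow from \<open>k\<close> to \<open>m\<close>, which points the other way\<close>
    have "v \<le> k \<and> q = down r w a (max v 0) (max k 0)"
    proof (rule ccontr)
      assume "\<not> ?thesis"
      then have v: "k < v" "q = up r w a (max k 0) (max v 0)" using IH(3) mm by (auto simp: le_less)
      have "m \<le> v" using no_index_between[OF m(1,2) IH(1)] IH(2) v a_def k_def by force
      then have "(tp a (m - 1), m) \<in> set q" unfolding v(2) set_up using a_def m k by auto
      then have "letter w m > 0"
        using Cons.prems(1) vertical_arrow_up_iff(1)[OF m(1,2)] a_def by auto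
      then show False using False by simp
    qed
    then have "v \<le> m \<and> e # q = down r w a (max v 0) (max m 0)"
      using k m e ud down_split[of "max v 0" "max k 0" m r w a] by auto
    then show ?thesis using IH u a_def by simp
  qed
qed simp

text \<open>
  The orientation is constant inside a block, since it only changes at levels, and the lower end
  of the block is a level.
\<close>

lemma block_orient:
  assumes "block w a b n n'"
  shows "n < m \<Longrightarrow> m \<le> n' \<Longrightarrow> orient w a b m = orient w a b n'"
    and "orient w a b n \<noteq> orient w a b n'"
proof -
  have *: "n < m \<longrightarrow> orient w a b m = orient w a b n'" if "m \<le> n'" for m
    using that
  proof (induction m rule: int_le_induct)
    case (step i)
    show ?case
    proof
      assume "n < i - 1"
      then have "\<not> level w a b (i - 1)" using assms step by (auto simp: block_def)
      then have "orient w a b (i - 1) = orient w a b i"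
        using assms step \<open>n < i - 1\<close> by (auto simp: level_def block_def)
      then show "orient w a b (i - 1) = orient w a b n'" using step \<open>n < i - 1\<close> by simp
    qed
  qed simp
  then show "n < m \<Longrightarrow> m \<le> n' \<Longrightarrow> orient w a b m = orient w a b n'"
    by blast
  have b: "n < n + 1" "n + 1 \<le> n'" using assms by (simp_all add: block_def)
  have "orient w a b (n + 1) = orient w a b n'" using *[OF b(2)] b(1) by (rule mp)
  moreover have "orient w a b n \<noteq> orient w a b (n + 1)"
    using assms by (auto simp: block_def level_def)
  ultimately show "orient w a b n \<noteq> orient w a b n'" by metis
qed

lemma block_letter:
  assumes "block w a b n n'" "m \<in> positions w a b" "n < m" "m \<le> n'"
  shows "clockwise_letter w a m = orient w a b n'"
proof -
  have "orient w a b m = clockwise_letter w a m"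
    using orient_step[of a b "m - 1"] assms by (auto simp: positions_def)
  then show ?thesis using block_orient(1)[OF assms(1,3,4)] by simp
qed

lemma block_letter_sign:
  assumes "block w x y n n'" "orient w x y n'" "x \<noteq> y" "1 \<le> m" "n < m" "m \<le> n'"
  shows "strand w m = x \<Longrightarrow> letter w m > 0" "strand w m = y \<Longrightarrow> letter w m < 0"
proof -
  have m: "m \<le> len" using assms(1,6) level_bounds[of x y n'] by (simp add: block_def)
  have cw: "clockwise_letter w x m" if "strand w m = x \<or> strand w m = y"
  proof -
    have "m \<in> positions w x y" using that m assms(4) by (simp add: positions_def)
    then show ?thesis using block_letter[OF assms(1) _ assms(5,6)] assms(2) by simp
  qed
  show "letter w m > 0" if "strand w m = x"
    using cw that by (simp add: clockwise_letter_def)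
  show "letter w m < 0" if "strand w m = y"
    using cw that assms(3) letter_nonzero[OF assms(4) m] by (simp add: clockwise_letter_def)
qed

lemma block_swap: "a \<noteq> b \<Longrightarrow> block w b a n n' \<longleftrightarrow> block w a b n n'"
  by (simp add: block_def level_swap)

lemma finite_levels: "finite {n. level w a b n}"
  by (rule finite_subset[of _ "{0..len}"]) (auto simp: level_def)

lemma block_above:
  assumes "level w a b n" "n < len"
  obtains n' where "block w a b n n'"
proof -
  let ?S = "{l. level w a b l \<and> n < l}"
  have fin: "finite ?S" using finite_levels[of a b] by simp
  have "positions w a b \<noteq> {}" using assms by (simp add: level_def)
  then have "len \<in> ?S" using assms(2) level_length by simp
  then have "Min ?S \<in> ?S" using fin by (intro Min_in) auto
  moreover have "\<not> level w a b l" if "n < l" "l < Min ?S" for l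
    using Min_le[OF fin, of l] that by auto
  ultimately have "block w a b n (Min ?S)" using assms(1) unfolding block_def by blast
  then show ?thesis by (rule that)
qed

lemma block_below:
  assumes "level w a b l" "level w a b n" "l < n"
  obtains n' where "block w a b n' n"
proof -
  let ?S = "{l. level w a b l \<and> l < n}"
  have fin: "finite ?S" using finite_levels[of a b] by simp
  then have "Max ?S \<in> ?S" using assms by (intro Max_in) auto
  moreover have "\<not> level w a b l" if "Max ?S < l" "l < n" for l
    using Max_ge[OF fin, of l] that by auto
  ultimately have "block w a b (Max ?S) n" using assms(2) unfolding block_def by blast
  then show ?thesis by (rule that)
qed

lemma level_tops_less:
  assumes "a \<in> {1..r}" "b \<in> {1..r}" "level w a b n" "level w a b n'" "n < n'"
  shows "tp a n + tp b n < tp a n' + tp b n'" "tp a n \<le> tp a n'" "tp b n \<le> tp b n'"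
proof -
  have b: "0 \<le> n" "n' \<le> len" using assms level_bounds by auto
  have p: "n + 1 \<in> positions w a b" using level_next_letter assms b by auto
  show m: "tp a n \<le> tp a n'" "tp b n \<le> tp b n'" using strand_top_mono assms b by auto
  have "tp c n < tp c n'" if "strand w (n + 1) = c" "c \<in> {1..r}" for c
    using strand_top_ge[of "n + 1" c n'] strand_top_le[of c n] that assms b pos_index[of "n + 1"] by auto
  then show "tp a n + tp b n < tp a n' + tp b n'"
    using p m assms by (auto simp: positions_def intro: add_less_le_mono add_le_less_mono)
qed

end

section \<open>Closed walks contain roofs\<close>

definition crossing :: "int list \<Rightarrow> int \<times> int \<Rightarrow> bool" where
  "crossing w e \<longleftrightarrow> strand w (fst e) \<noteq> strand w (snd e)"

definition rotation :: "'a list \<Rightarrow> 'a list \<Rightarrow> bool" where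
  "rotation p q \<longleftrightarrow> (\<exists>k. q = rotate k p)"

lemma rotation_refl: "rotation p p"
  unfolding rotation_def by (rule exI[of _ 0]) simp

lemma rotation_swap: "rotation p (x @ y) \<Longrightarrow> rotation p (y @ x)"
  unfolding rotation_def by (metis rotate_append rotate_rotate)

lemma set_rotation: "rotation p q \<Longrightarrow> set q = set p"
  by (auto simp: rotation_def)

lemma rotation_Cons_iff: "e \<in> set p \<Longrightarrow> \<exists>q. rotation p (e # q)"
  using rotation_swap[of p] rotation_refl[of p] by (metis append_Cons split_list)

lemma closed_chain_rotate:
  assumes "chain u p u"
  shows "\<exists>v. chain v (rotate k p) v"
proof (induction k)
  case 0
  then show ?case using assms by auto
next
  case (Suc k)
  then obtain v where "chain v (rotate k p) v" by blast
  then show ?case by (cases "rotate k p") (auto simp: chain_snoc)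
qed

lemma closed_chain_rotation: "chain u p u \<Longrightarrow> rotation p q \<Longrightarrow> \<exists>v. chain v q v"
  by (auto simp: rotation_def closed_chain_rotate)

context bfz_data
begin

abbreviation "Q \<equiv> bfz_quiver r E w"

lemma vertical_not_crossing: "e \<in> vertical_at r w ` {1..len} \<Longrightarrow> \<not> crossing w e"
  using vertical_at_props(3) by (auto simp: crossing_def vertical_at_def)

lemma crossing_arrow_cases:
  assumes "e \<in> arcs Q" "crossing w e"
  obtains x y n where "{x, y} \<in> E" "level w x y n" "orient w x y n" "e = (tp x n, tp y n)"
proof -
  have "e \<in> crossing_arrows r E w"
    using assms(1) vertical_not_crossing[of e] assms(2) unfolding arcs_bfz_quiver by blast
  then show ?thesis using that by (auto simp: crossing_arrows_def)
qed

lemma crossing_ends: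
  assumes "{x, y} \<in> E" "level w x y n"
  shows "strand w (tp x n) = x" "strand w (tp y n) = y"
    "tp x n \<in> index_set r w" "tp y n \<in> index_set r w"
  using edge[OF assms(1)] level_bounds[OF assms(2)] strand_top_props[of _ n] by auto

lemma not_crossing_vertical:
  assumes "set q \<subseteq> arcs Q" "\<forall>e\<in>set q. \<not> crossing w e"
  shows "set q \<subseteq> vertical_at r w ` {1..len}"
proof
  fix e assume e: "e \<in> set q"
  show "e \<in> vertical_at r w ` {1..len}"
  proof (rule ccontr)
    assume "e \<notin> vertical_at r w ` {1..len}"
    then have "e \<in> crossing_arrows r E w" using e assms by (auto simp: arcs_bfz_quiver)
    then have "crossing w e"
      using crossing_ends edge by (force simp: crossing_arrows_def crossing_def)
    then show False using assms e by blast
  qed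
qed

lemma arc_ends:
  assumes "e \<in> arcs Q"
  shows "fst e \<in> index_set r w" "snd e \<in> index_set r w"
proof -
  have *: "fst e \<in> index_set r w \<and> snd e \<in> index_set r w"
  proof (cases "e \<in> crossing_arrows r E w")
    case True
    then show ?thesis using crossing_ends by (auto simp: crossing_arrows_def)
  next
    case False
    then show ?thesis using assms vertical_at_props(2) pos_index
      by (auto simp: arcs_bfz_quiver vertical_at_def)
  qed
  then show "fst e \<in> index_set r w" "snd e \<in> index_set r w" by auto
qed

lemma crossing_walk_strands:
  assumes "set p \<subseteq> arcs Q" "chain u p v" "u \<in> index_set r w"
  shows "chain (strand w u) (map (\<lambda>e. (strand w (fst e), strand w (snd e))) (filter (crossing w) p))
    (strand w v)"
  using assms
proof (induction p arbitrary: u)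
  case (Cons e p)
  have "chain (strand w (snd e)) (map (\<lambda>e. (strand w (fst e), strand w (snd e))) (filter (crossing w) p))
    (strand w v)"
    using Cons.IH[of "snd e"] Cons.prems arc_ends by auto
  then show ?case using Cons.prems by (cases "crossing w e") (auto simp: crossing_def[of w e])
qed simp

text \<open>
  A walk along a strand to the top corner of a face that has been at or below the bottom corner comes up
  along the whole side of the face. Since the walk is monotone, its lowest point is one of its ends.
\<close>

lemma run_into_crossing:
  assumes q: "set q \<subseteq> vertical_at r w ` {1..len}" "chain u q (tp x n')" "u \<in> index_set r w"
    and x: "x \<in> {1..r}" and n: "0 \<le> n" "n \<le> n'" "n' \<le> len"
      and low: "min u (tp x n') \<le> tp x n"
  shows "\<exists>q'. q = q' @ up r w x n n'"
proof -
  let ?t = "tp x n'"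
  have t: "?t \<in> index_set r w" "strand w ?t = x" "?t \<le> n'"
    using strand_top_props[OF x, of n'] n by auto
  have mono: "tp x n \<le> ?t" using strand_top_mono x n by simp
  have "strand w u = x" using vertical_walk[OF q] t by simp
  note vw = vertical_walk[OF q, unfolded this]
  show ?thesis
  proof (cases "tp x n = ?t")
    case True
    then show ?thesis using up_Nil_if_top_eq(1)[OF x n(1,3)] by simp
  next
    case False
    then have "tp x n < ?t" using mono by simp
    then have u: "u \<le> tp x n" "u < ?t" using low by auto
    then have q_eq: "q = up r w x (max u 0) (max ?t 0)" using vw by auto
    have t0: "0 < ?t"
    proof (rule ccontr)
      assume "\<not> 0 < ?t"
      then have "?t < 0" "tp x n < 0" using t False mono by (auto simp: index_set_def)
      then show False using False t strand_neg[of ?t] strand_neg[of "tp x n"]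
          strand_strand_top[OF x n(1)] by simp
    qed
    have "tp x n' = tp x (max ?t 0)" using strand_top_self[OF t(1)] t by simp
    then have "up r w x (max ?t 0) n' = []"
      using up_Nil_if_top_eq(1)[OF x, of "max ?t 0" n'] n by simp
    then have "q = up r w x (max u 0) n'"
      using q_eq up_split[of "max u 0" "max ?t 0" n' r w x] u t t0 n by simp
    moreover have "max u 0 \<le> n" using u strand_top_le[OF x n(1)] n by simp
    then have "up r w x (max u 0) n' = up r w x (max u 0) n @ up r w x n n'"
      by (rule up_split[OF _ n(2)])
    ultimately show ?thesis by blast
  qed
qed

lemma run_out_of_crossing:
  assumes q: "set q \<subseteq> vertical_at r w ` {1..len}" "chain (tp y n') q v"
    and y: "y \<in> {1..r}" and n: "0 \<le> n" "n \<le> n'" "n' \<le> len"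
      and low: "min (tp y n') v \<le> tp y n"
  shows "\<exists>q'. q = down r w y n n' @ q'"
proof -
  let ?t = "tp y n'"
  have t: "?t \<in> index_set r w" "strand w ?t = y" "?t \<le> n'"
    using strand_top_props[OF y, of n'] n by auto
  have mono: "tp y n \<le> ?t" using strand_top_mono y n by simp
  note vw = vertical_walk[OF q t(1), unfolded t(2)]
  show ?thesis
  proof (cases "tp y n = ?t")
    case True
    then show ?thesis using up_Nil_if_top_eq(2)[OF y n(1,3)] by simp
  next
    case False
    then have "tp y n < ?t" using mono by simp
    then have u: "v \<le> tp y n" "v < ?t" using low by auto
    then have q_eq: "q = down r w y (max v 0) (max ?t 0)" using vw by auto
    have t0: "0 < ?t"
    proof (rule ccontr)
      assume "\<not> 0 < ?t"
      then have "?t < 0" "tp y n < 0" using t False mono by (auto simp: index_set_def)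
      then show False using False t strand_neg[of ?t] strand_neg[of "tp y n"]
          strand_strand_top[OF y n(1)] by simp
    qed
    have "tp y n' = tp y (max ?t 0)" using strand_top_self[OF t(1)] t by simp
    then have "down r w y (max ?t 0) n' = []"
      using up_Nil_if_top_eq(2)[OF y, of "max ?t 0" n'] n by simp
    then have "q = down r w y (max v 0) n'"
      using q_eq down_split[of "max v 0" "max ?t 0" n' r w y] u t t0 n by simp
    moreover have "max v 0 \<le> n" using u strand_top_le[OF y n(1)] n by simp
    then have "down r w y (max v 0) n' = down r w y n n' @ down r w y (max v 0) n"
      by (rule down_split[OF _ n(2)])
    ultimately show ?thesis by blast
  qed
qed

definition contains_roof :: "(int \<times> int) list \<Rightarrow> bool" where
  "contains_roof p \<longleftrightarrow> (\<exists>x y n n' s. {x, y} \<in> E \<and> block w x y n n' \<and> orient w x y n' \<and>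
     rotation p (roof r w x y n n' @ s))"

text \<open>
  A part of \<open>p\<close>, up to rotation: the walk \<open>q\<close> along a strand from \<open>u\<close>, the crossing \<open>e\<close>, and the walk \<open>q'\<close>
  along another strand to \<open>v\<close>.
\<close>

definition passage :: "(int \<times> int) list \<Rightarrow> int \<Rightarrow> (int \<times> int) list \<Rightarrow> int \<times> int \<Rightarrow> (int \<times> int) list \<Rightarrow> int \<Rightarrow> bool" where
  "passage p u q e q' v \<longleftrightarrow> (\<exists>s. rotation p (q @ e # q' @ s)) \<and> crossing w e \<and>
     u \<in> index_set r w \<and> v \<in> index_set r w \<and>
     (\<forall>d\<in>set q \<union> set q'. \<not> crossing w d) \<and> chain u q (fst e) \<and> chain (snd e) q' v"

lemma passage_contains_roof:
  assumes "set p \<subseteq> arcs Q" "passage p u q (tp x n', tp y n') q' v"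
    and "{x, y} \<in> E" "block w x y n n'" "orient w x y n'"
    and "min u (tp x n') \<le> tp x n" "min (tp y n') v \<le> tp y n"
  shows "contains_roof p"
proof -
  let ?e = "(tp x n', tp y n')"
  obtain s where rot: "rotation p (q @ ?e # q' @ s)" using assms by (auto simp: passage_def)
  have sub: "set q \<subseteq> arcs Q" "set q' \<subseteq> arcs Q"
    using set_rotation[OF rot] assms(1) by auto
  then have vert: "set q \<subseteq> vertical_at r w ` {1..len}" "set q' \<subseteq> vertical_at r w ` {1..len}"
    using not_crossing_vertical assms(2) by (auto simp: passage_def)
  have n: "0 \<le> n" "n \<le> n'" "n' \<le> len" using assms(4) level_bounds by (auto simp: block_def)
  have ch: "chain u q (tp x n')" "u \<in> index_set r w" "chain (tp y n') q' v"
    using assms(2) by (simp_all add: passage_def)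
  obtain q1 where "q = q1 @ up r w x n n'"
    using run_into_crossing[OF vert(1) ch(1,2) edge(2)[OF assms(3)] n assms(6)] by blast
  moreover obtain q2 where "q' = down r w y n n' @ q2"
    using run_out_of_crossing[OF vert(2) ch(3) edge(3)[OF assms(3)] n assms(7)] by blast
  ultimately have "rotation p (q1 @ (roof r w x y n n' @ q2 @ s))"
    using rot by (simp add: roof_def)
  then have "rotation p ((roof r w x y n n' @ q2 @ s) @ q1)" by (rule rotation_swap)
  then have "rotation p (roof r w x y n n' @ (q2 @ s @ q1))" by simp
  then show ?thesis unfolding contains_roof_def using assms(3-5) by blast
qed

text \<open>
  Compare the lowest points of the two runs. Unless the passage contains a roof, one of the runs stops
  above the bottom of the face below the crossing. Then the higher one of the two points, if positive,
  is a letter of the block of that face; the face goes up on the side before the crossing and down on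
  the side after it, which gives the sign.
\<close>

lemma passage_letter_sign:
  assumes "set p \<subseteq> arcs Q" "passage p u q e q' v" "\<not> contains_roof p"
  shows "min u (fst e) \<le> min (snd e) v \<Longrightarrow> 0 < min (snd e) v \<Longrightarrow> letter w (min (snd e) v) < 0"
    and "min (snd e) v \<le> min u (fst e) \<Longrightarrow> 0 < min u (fst e) \<Longrightarrow> letter w (min u (fst e)) > 0"
proof -
  obtain s where rot: "rotation p (q @ e # q' @ s)" using assms by (auto simp: passage_def)
  have arcs: "set q \<subseteq> arcs Q" "set q' \<subseteq> arcs Q" "e \<in> arcs Q"
    using set_rotation[OF rot] assms(1) by auto
  then have vert: "set q \<subseteq> vertical_at r w ` {1..len}" "set q' \<subseteq> vertical_at r w ` {1..len}"
    using not_crossing_vertical assms(2) by (auto simp: passage_def)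
  obtain x y n' where xy: "{x, y} \<in> E" and lev: "level w x y n'" and o: "orient w x y n'"
    and e: "e = (tp x n', tp y n')"
    using crossing_arrow_cases[OF arcs(3)] assms(2) by (auto simp: passage_def)
  note ed = edge[OF xy] and ends = crossing_ends[OF xy lev]
  define m where "m = min u (fst e)"
  define m' where "m' = min (snd e) v"
  have "strand w u = x" "u \<in> index_set r w"
    using vertical_walk[OF vert(1)] assms(2) ends e by (auto simp: passage_def)
  then have m: "strand w m = x" "m \<in> index_set r w" "m \<le> tp x n'"
    using ends e by (auto simp: m_def min_def)
  have "strand w v = y" "v \<in> index_set r w"
    using vertical_walk[OF vert(2)] assms(2) ends e by (auto simp: passage_def)
  then have m': "strand w m' = y" "m' \<in> index_set r w" "m' \<le> tp y n'"
    using ends e by (auto simp: m'_def min_def)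
  have n': "0 \<le> n'" "n' \<le> len" using level_bounds[OF lev] by auto
  have le: "m \<le> n'" "m' \<le> n'" using m m' strand_top_le[of _ n'] ed n' by force+
  have sign: "letter w (max m m') > 0 \<and> max m m' = m \<or> letter w (max m m') < 0 \<and> max m m' = m'"
    if pos: "0 < max m m'"
  proof -
    have mp: "max m m' \<in> positions w x y" "max m m' \<le> n'"
      using m m' pos le n' by (auto simp: positions_def max_def)
    then have ne: "positions w x y \<noteq> {}" by blast
    have "Min (positions w x y) \<le> max m m'" using mp(1) by (rule Min_le[OF finite_positions])
    then have low: "Min (positions w x y) - 1 < n'" using mp(2) by linarith
    obtain n where bl: "block w x y n n'"
      using block_below[OF lowest_level(1)[OF xy ne HOL.refl] lev low] by blast
    have n: "0 \<le> n" using bl level_bounds by (auto simp: block_def)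
    \<comment> \<open>one of the two runs stops above its bottom corner, hence at an index after \<open>n\<close>\<close>
    have "\<not> (m \<le> tp x n \<and> m' \<le> tp y n)"
      using passage_contains_roof[OF assms(1) assms(2)[unfolded e] xy bl o] assms(3) e
      by (auto simp: m_def m'_def)
    then have "n < max m m'"
      using strand_top_ge[of m x n] strand_top_ge[of m' y n] m m' by linarith
    then show ?thesis
      using block_letter_sign[OF bl o ed(1), of m] block_letter_sign[OF bl o ed(1), of m'] m m' le pos
      by (auto simp: max_def)
  qed
  have ne: "m \<noteq> m'" using m m' ed by auto
  show "letter w (min (snd e) v) < 0" if "min u (fst e) \<le> min (snd e) v" "0 < min (snd e) v"
    using sign that ne unfolding m_def[symmetric] m'_def[symmetric] by (auto simp: max_def)
  show "letter w (min u (fst e)) > 0" if "min (snd e) v \<le> min u (fst e)" "0 < min u (fst e)"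
    using sign that ne unfolding m_def[symmetric] m'_def[symmetric] by (auto simp: max_def)
qed

context
  fixes p u
  assumes closed: "chain u p u" and p_arcs: "set p \<subseteq> arcs Q" and u: "u \<in> index_set r w"
begin

lemma rotation_arcs: "rotation p q \<Longrightarrow> set q \<subseteq> arcs Q"
  using p_arcs set_rotation by metis

text \<open>
  After a crossing the walk has to leave the new strand again in order to close up.
\<close>

lemma crossings_follow:
  assumes "rotation p (e # s)" "crossing w e"
  obtains q e' s' where "s = q @ e' # s'" "crossing w e'" "\<forall>d\<in>set q. \<not> crossing w d"
    "chain (snd e) q (fst e')"
proof -
  obtain v where v: "chain v (e # s) v" using closed_chain_rotation[OF closed assms(1)] by blast
  have arcs: "set (e # s) \<subseteq> arcs Q" by (rule rotation_arcs[OF assms(1)])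
  have "\<exists>d\<in>set s. crossing w d"
  proof (rule ccontr)
    assume "\<not> (\<exists>d\<in>set s. crossing w d)"
    then have "set s \<subseteq> vertical_at r w ` {1..len}" using not_crossing_vertical arcs by auto
    then have "strand w v = strand w (snd e)" using vertical_walk[of s "snd e" v] v arcs arc_ends by auto
    then show False using v assms(2) by (auto simp: crossing_def)
  qed
  then obtain q e' s' where s: "s = q @ e' # s'" "crossing w e'" "\<forall>d\<in>set q. \<not> crossing w d"
    by (metis split_list_first_prop)
  then have "chain (snd e) q (fst e')" using v by (auto simp: chain_append)
  then show ?thesis using that s by blast
qed

lemma crossings_precede:
  assumes "rotation p (e # s)" "crossing w e"
  obtains q e' s' where "s = s' @ e' # q" "crossing w e'" "\<forall>d\<in>set q. \<not> crossing w d"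
    "chain (snd e') q (fst e)"
proof -
  obtain v where v: "chain v (e # s) v" using closed_chain_rotation[OF closed assms(1)] by blast
  have "\<exists>d\<in>set s. crossing w d" using crossings_follow[OF assms] by (metis in_set_conv_decomp)
  then obtain q e' s' where s: "s = s' @ e' # q" "crossing w e'" "\<forall>d\<in>set q. \<not> crossing w d"
    by (metis split_list_last_prop)
  then have "chain (snd e') q (fst e)" using v by (auto simp: chain_append)
  then show ?thesis using that s by blast
qed

lemma crossing_exists:
  assumes "p \<noteq> []"
  shows "\<exists>e\<in>set p. crossing w e"
proof (rule ccontr)
  assume "\<not> ?thesis"
  then have "set p \<subseteq> vertical_at r w ` {1..len}" using not_crossing_vertical p_arcs by blast
  then have "p = []" using vertical_walk[OF _ closed u] by auto
  then show False using assms by simp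
qed

text \<open>
  Runs are monotone, so the smaller one of its ends is the lowest point of a run.
\<close>

definition run_minima :: "int set" where
  "run_minima = {min (snd e) v | e q e' s v. rotation p (e # q @ e' # s) \<and> crossing w e \<and> crossing w e' \<and>
     (\<forall>d\<in>set q. \<not> crossing w d) \<and> chain (snd e) q v}"

lemma run_minima_sub: "run_minima \<subseteq> index_set r w"
proof
  fix m assume "m \<in> run_minima"
  then obtain e q e' s v where *: "m = min (snd e) v" "rotation p (e # q @ e' # s)"
    "\<forall>d\<in>set q. \<not> crossing w d" "chain (snd e) q v"
    by (auto simp: run_minima_def)
  have arcs: "set (e # q @ e' # s) \<subseteq> arcs Q" by (rule rotation_arcs[OF *(2)])
  then have "set q \<subseteq> vertical_at r w ` {1..len}" using not_crossing_vertical * by auto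
  then have "v \<in> index_set r w" using vertical_walk *(4) arcs arc_ends by auto
  then show "m \<in> index_set r w" using *(1) arcs arc_ends by (auto simp: min_def)
qed

lemma chain_in_rotation:
  assumes "rotation p (e # q @ e' # s)"
  shows "chain (snd e) q (fst e')"
proof -
  obtain v where "chain v (e # q @ e' # s) v" using closed_chain_rotation[OF closed assms] by blast
  then show ?thesis by (auto simp: chain_append)
qed

lemma run_minimaI:
  assumes "rotation p (e # q @ e' # s)" "crossing w e" "crossing w e'" "\<forall>d\<in>set q. \<not> crossing w d"
  shows "min (snd e) (fst e') \<in> run_minima"
  unfolding run_minima_def mem_Collect_eq
  using assms chain_in_rotation[OF assms(1)]
  by (intro exI[of _ e] exI[of _ q] exI[of _ e'] exI[of _ s] exI[of _ "fst e'"]) simp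

text \<open>
  Of two splittings of a list, the second is not in front of the first, since \<open>e\<close> does not occur behind
  the second one.
\<close>

lemma append_Cons_eq_decomp:
  assumes "q @ e # s = s0 @ e0 # q0" "e \<notin> set q0"
  obtains t where "s0 @ [e0] = q @ t"
proof -
  consider (1) us where "q = s0 @ us" "us @ e # s = e0 # q0"
    | (2) us where "q @ us = s0"
    using assms(1) by (auto simp: append_eq_append_conv2)
  then show ?thesis
  proof cases
    case 1
    then show ?thesis using assms(2) that[of "[e0]"] by (cases us) auto
  next
    case 2
    then show ?thesis using that[of "us @ [e0]"] by simp
  qed
qed

text \<open>
  A run extends to a passage at the crossing before it. The runs on both sides of that crossing do not
  overlap in \<open>p\<close>, even if \<open>p\<close> has only two crossings.
\<close>

lemma passage_with_run_after:
  assumes "rotation p (e # q' @ e' # s)" "crossing w e" "crossing w e'" "\<forall>d\<in>set q'. \<not> crossing w d"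
  obtains u' q where "passage p u' q e q' (fst e')" "min u' (fst e) \<in> run_minima"
proof -
  obtain q0 e0 s0 where B: "q' @ e' # s = s0 @ e0 # q0" "crossing w e0" "\<forall>d\<in>set q0. \<not> crossing w d"
    "chain (snd e0) q0 (fst e)"
    using crossings_precede[OF assms(1,2)] .
  have rot: "rotation p ((e # s0) @ (e0 # q0))" using assms(1) B(1) by simp
  then have rotB: "rotation p (e0 # q0 @ e # s0)" using rotation_swap by fastforce
  have min: "min (snd e0) (fst e) \<in> run_minima"
    using run_minimaI[OF rotB] B assms by blast
  have "e' \<notin> set q0" using B(3) assms(3) by blast
  then obtain t where t: "s0 @ [e0] = q' @ t" using append_Cons_eq_decomp[OF B(1)] by blast
  have "rotation p ((e # s0 @ [e0]) @ q0)" using rot by simp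
  then have "rotation p (q0 @ e # q' @ t)" using rotation_swap t by fastforce
  moreover have "snd e0 \<in> index_set r w" "fst e' \<in> index_set r w"
    using rotation_arcs[OF rotB] rotation_arcs[OF assms(1)] arc_ends by auto
  ultimately have "passage p (snd e0) q0 e q' (fst e')"
    unfolding passage_def using B assms chain_in_rotation[OF assms(1)] by blast
  then show ?thesis using that min by blast
qed

lemma passage_with_run_before:
  assumes "rotation p (e # q @ e' # s)" "crossing w e" "crossing w e'" "\<forall>d\<in>set q. \<not> crossing w d"
  obtains q' v where "passage p (snd e) q e' q' v" "min (snd e') v \<in> run_minima"
proof -
  have "rotation p ((e # q) @ (e' # s))" using assms(1) by simp
  then have rot: "rotation p (e' # (s @ e # q))" using rotation_swap by fastforce
  obtain q2 e2 s2 where B: "s @ e # q = q2 @ e2 # s2" "crossing w e2" "\<forall>d\<in>set q2. \<not> crossing w d"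
    "chain (snd e') q2 (fst e2)"
    using crossings_follow[OF rot assms(3)] .
  have rotB: "rotation p (e' # q2 @ e2 # s2)" using rot B(1) by simp
  have min: "min (snd e') (fst e2) \<in> run_minima"
    using run_minimaI[OF rotB] B assms by blast
  have "e2 \<notin> set q" using B(2) assms(4) by blast
  then obtain t where t: "s @ [e] = q2 @ t" using append_Cons_eq_decomp[OF B(1)[symmetric]] by blast
  have "rotation p ((e' # s @ [e]) @ q)" using rot by simp
  then have "rotation p (q @ e' # q2 @ t)" using rotation_swap t by fastforce
  moreover have "snd e \<in> index_set r w" "fst e2 \<in> index_set r w"
    using rotation_arcs[OF rotB] rotation_arcs[OF assms(1)] arc_ends by auto
  ultimately have "passage p (snd e) q e' q2 (fst e2)"
    unfolding passage_def using B assms chain_in_rotation[OF assms(1)] by blast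
  then show ?thesis using that min by blast
qed

text \<open>
  Some edge is traversed in both directions, and the two crossings have different levels, as the
  orientation at a level fixes the direction of the arrow. The higher one of the two levels is
  the upper end of a block.
\<close>

lemma crossing_above_bottom:
  assumes "p \<noteq> []"
  obtains x y n n' s where "{x, y} \<in> E" "block w x y n n'" "orient w x y n'"
    "rotation p ((tp x n', tp y n') # s)"
proof -
  let ?g = "map (\<lambda>e. (strand w (fst e), strand w (snd e))) (filter (crossing w) p)"
  have cross: "\<exists>n. {x, y} \<in> E \<and> level w x y n \<and> orient w x y n \<and> (tp x n, tp y n) \<in> set p"
    if xy: "(x, y) \<in> set ?g" for x y
  proof -
    obtain e where e: "e \<in> set p" "crossing w e" "x = strand w (fst e)" "y = strand w (snd e)"
      using xy by auto
    obtain x' y' n where *: "{x', y'} \<in> E" "level w x' y' n" "orient w x' y' n" "e = (tp x' n, tp y' n)"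
      using crossing_arrow_cases[of e] e p_arcs by blast
    then have "x' = x" "y' = y" using e crossing_ends by auto
    then show ?thesis using *(1-3) e(1) unfolding *(4) by blast
  qed
  have edges: "{x, y} \<in> E" if "(x, y) \<in> set ?g" for x y using cross[OF that] by blast
  have "chain (strand w u) ?g (strand w u)"
    using crossing_walk_strands[OF p_arcs closed u] .
  moreover have "?g \<noteq> []" using crossing_exists[OF assms] by (auto simp: filter_empty_conv)
  ultimately obtain x y where xy: "(x, y) \<in> set ?g" "(y, x) \<in> set ?g"
    using closed_walk_in_forest[OF _ _ edges no_loop no_cycle] by blast
  obtain n where n: "{x, y} \<in> E" "level w x y n" "orient w x y n" "(tp x n, tp y n) \<in> set p"
    using cross[OF xy(1)] by blast
  obtain l where l: "{y, x} \<in> E" "level w y x l" "orient w y x l" "(tp y l, tp x l) \<in> set p"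
    using cross[OF xy(2)] by blast
  have ne: "x \<noteq> y" "positions w x y \<noteq> {}" using edge n by (auto simp: level_def)
  have "n \<noteq> l" using n l orient_swap[OF ne(2,1)] by auto
  then consider "n < l" | "l < n" by linarith
  then show ?thesis
  proof cases
    case 1
    have "level w y x n" using n(2) level_swap ne(1) by simp
    then obtain k where k: "block w y x k l" using block_below 1 l(2) by blast
    obtain s where "rotation p ((tp y l, tp x l) # s)" using rotation_Cons_iff[OF l(4)] by blast
    then show ?thesis by (rule that[OF l(1) k l(3)])
  next
    case 2
    have "level w x y l" using l(2) level_swap ne(1) by simp
    then obtain k where k: "block w x y k n" using block_below 2 n(2) by blast
    obtain s where "rotation p ((tp x n, tp y n) # s)" using rotation_Cons_iff[OF n(4)] by blast
    then show ?thesis by (rule that[OF n(1) k n(3)])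
  qed
qed

text \<open>
  The run with the highest minimum cannot have positive minimum, as the adjacent crossings give
  conflicting signs for the letter at the minimum. If no minimum is positive, every run reaches the
  bottom of its strand, and any crossing above the bottom lies on a roof.
\<close>

theorem closed_walk_contains_roof:
  assumes "p \<noteq> []"
  shows "contains_roof p"
proof (rule ccontr)
  assume no_roof: "\<not> contains_roof p"
  obtain e0 where e0: "e0 \<in> set p" "crossing w e0" using crossing_exists assms by blast
  obtain s0 where rot0: "rotation p (e0 # s0)" using rotation_Cons_iff[OF e0(1)] by blast
  obtain q0 e1 s1 where "s0 = q0 @ e1 # s1" "crossing w e1" "\<forall>d\<in>set q0. \<not> crossing w d"
    using crossings_follow[OF rot0 e0(2)] .
  then obtain m0 where "m0 \<in> run_minima" using run_minimaI[of e0 q0 e1 s1] rot0 e0(2) by blast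
  have fin: "finite run_minima" using run_minima_sub finite_subset finite_index_set by blast
  define M where "M = Max run_minima"
  have M: "M \<in> run_minima" and le_M: "\<And>m. m \<in> run_minima \<Longrightarrow> m \<le> M"
    unfolding M_def using Max_in[OF fin] Max_ge[OF fin] \<open>m0 \<in> run_minima\<close> by blast+
  have M_index: "M \<in> index_set r w" using M run_minima_sub by blast
  show False
  proof (cases "M > 0")
    case True
    obtain e q e' s v where run: "M = min (snd e) v" "rotation p (e # q @ e' # s)" "crossing w e"
      "crossing w e'" "\<forall>d\<in>set q. \<not> crossing w d" "chain (snd e) q v"
      using M by (auto simp: run_minima_def)
    have v: "v = fst e'" by (rule chain_end_unique[OF run(6) chain_in_rotation[OF run(2)]])
    obtain u' q0 where before: "passage p u' q0 e q (fst e')" "min u' (fst e) \<in> run_minima"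
      using passage_with_run_after[OF run(2-5)] .
    obtain q1 v' where after: "passage p (snd e) q e' q1 v'" "min (snd e') v' \<in> run_minima"
      using passage_with_run_before[OF run(2-5)] .
    have "letter w M < 0"
      using passage_letter_sign(1)[OF p_arcs before(1) no_roof] le_M[OF before(2)] True run(1) v by simp
    moreover have "letter w M > 0"
      using passage_letter_sign(2)[OF p_arcs after(1) no_roof] le_M[OF after(2)] True run(1) v by simp
    ultimately show False by simp
  next
    case False
    then have neg: "m < 0" if "m \<in> run_minima" for m
      using le_M[OF that] M_index by (auto simp: index_set_def)
    obtain x y n n' s where xy: "{x, y} \<in> E" and bl: "block w x y n n'" and o: "orient w x y n'"
      and rot: "rotation p ((tp x n', tp y n') # s)"
      using crossing_above_bottom[OF assms] .
    let ?e = "(tp x n', tp y n')"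
    have n: "0 \<le> n" and lev: "level w x y n'" using bl level_bounds by (auto simp: block_def)
    note ends = crossing_ends[OF xy lev] and ed = edge[OF xy]
    have cr: "crossing w ?e" using ends ed by (simp add: crossing_def)
    obtain q e' s' where A: "s = q @ e' # s'" "crossing w e'" "\<forall>d\<in>set q. \<not> crossing w d"
      using crossings_follow[OF rot cr] .
    have rot': "rotation p (?e # q @ e' # s')" using rot A by simp
    obtain u' q0 where pas: "passage p u' q0 ?e q (fst e')" "min u' (fst ?e) \<in> run_minima"
      using passage_with_run_after[OF rot' cr A(2,3)] .
    \<comment> \<open>a negative index is the lowest one on its strand\<close>
    have bottom: "m \<le> tp (strand w m) n" if "m \<in> run_minima" for m
      using strand_top_ge[of m "strand w m" n] neg[OF that] run_minima_sub that n by auto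
    have sub: "set q0 \<subseteq> vertical_at r w ` {1..len}" "set q \<subseteq> vertical_at r w ` {1..len}"
    proof -
      obtain s1 where "rotation p (q0 @ ?e # q @ s1)" using pas(1) by (auto simp: passage_def)
      then have "set q0 \<subseteq> arcs Q" "set q \<subseteq> arcs Q" using rotation_arcs by force+
      then show "set q0 \<subseteq> vertical_at r w ` {1..len}" "set q \<subseteq> vertical_at r w ` {1..len}"
        using pas(1) not_crossing_vertical unfolding passage_def by blast+
    qed
    have "strand w u' = x" using vertical_walk[OF sub(1)] pas(1) ends by (auto simp: passage_def)
    then have 1: "min u' (tp x n') \<le> tp x n" using bottom[OF pas(2)] ends by (auto simp: min_def)
    have "strand w (fst e') = y" using vertical_walk[OF sub(2)] pas(1) ends by (auto simp: passage_def)
    then have 2: "min (tp y n') (fst e') \<le> tp y n"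
      using bottom[OF run_minimaI[OF rot' cr A(2,3)]] ends by (auto simp: min_def)
    show False
      using passage_contains_roof[OF p_arcs pas(1) xy bl o 1 2] no_roof by simp
  qed
qed

end

end

section \<open>The faces of a strip\<close>

definition level_arrow :: "nat \<Rightarrow> int list \<Rightarrow> nat \<Rightarrow> nat \<Rightarrow> int \<Rightarrow> int \<times> int" where
  "level_arrow r w a b n =
     (if orient w a b n then (strand_top r w a n, strand_top r w b n)
      else (strand_top r w b n, strand_top r w a n))"

definition face_arrows :: "nat \<Rightarrow> int list \<Rightarrow> nat \<Rightarrow> nat \<Rightarrow> int \<Rightarrow> int \<Rightarrow> (int \<times> int) set" where
  "face_arrows r w a b n n' =
     vertical_at r w ` {m \<in> positions w a b. n < m \<and> m \<le> n'} \<union> level_arrow r w a b ` {n, n'}"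

text \<open>
  The height of the arrow at level \<open>n\<close> over the point \<open>x\<close> of the edge.
\<close>

definition level_line :: "nat \<Rightarrow> int list \<Rightarrow> nat \<Rightarrow> nat \<Rightarrow> int \<Rightarrow> real \<Rightarrow> real" where
  "level_line r w a b n x =
     (1 - x) * height r w (strand_top r w a n) + x * height r w (strand_top r w b n)"

definition trapezoid :: "nat \<Rightarrow> int list \<Rightarrow> nat \<Rightarrow> nat \<Rightarrow> int \<Rightarrow> int \<Rightarrow> (real \<times> real) set" where
  "trapezoid r w a b n n' =
     {(x, y). 0 < x \<and> x < 1 \<and> level_line r w a b n x < y \<and> y < level_line r w a b n' x}"

definition closed_trapezoid :: "nat \<Rightarrow> int list \<Rightarrow> nat \<Rightarrow> nat \<Rightarrow> int \<Rightarrow> int \<Rightarrow> (real \<times> real) set" where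
  "closed_trapezoid r w a b n n' =
     {(x, y). 0 \<le> x \<and> x \<le> 1 \<and> level_line r w a b n x \<le> y \<and> y \<le> level_line r w a b n' x}"

lemma closed_segment_wall:
  fixes c y1 y2 :: real
  shows "closed_segment (c, y1) (c, y2) = {(x, y). x = c \<and> min y1 y2 \<le> y \<and> y \<le> max y1 y2}"
proof -
  have "closed_segment (c, y1) (c, y2) = {(c, y) | y. y \<in> closed_segment y1 y2}"
    by (auto simp: closed_segment_def algebra_simps) (metis (no_types) distrib_right diff_add_cancel mult.commute mult.right_neutral)
  then show ?thesis by (auto simp: closed_segment_eq_real_ivl min_def max_def)
qed

lemma closed_segment_across:
  fixes y1 y2 :: real
  shows "closed_segment (0, y1) (1, y2) = {(x, y). 0 \<le> x \<and> x \<le> 1 \<and> y = (1 - x) * y1 + x * y2}"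
  by (auto simp: closed_segment_def)

text \<open>
  Otherwise the component contains a vertical ray.
\<close>

lemma ray_in_unbounded_component:
  fixes F :: "(real \<times> real) set"
  assumes "F \<in> components (strip - V)" "(x, y) \<in> F" "bounded F"
  shows "\<exists>y'\<ge>y. (x, y') \<in> V"
proof (rule ccontr)
  assume none: "\<not> ?thesis"
  have xy: "0 \<le> x" "x \<le> 1" "0 \<le> y"
    using in_components_subset[OF assms(1)] assms(2) by (auto simp: strip_def)
  have conn: "connected ({x} \<times> {y..})" by (intro connected_Times) auto
  have "{x} \<times> {y..} \<subseteq> strip - V" using none xy by (auto simp: strip_def)
  then have sub: "{x} \<times> {y..} \<subseteq> F"
    using components_maximal[OF assms(1) conn] assms(2) by force
  obtain B where B: "\<And>p. p \<in> F \<Longrightarrow> norm p \<le> B" using assms(3)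
    by (auto simp: bounded_iff)
  have "(x, max y (B + 1)) \<in> F" using sub by auto
  then have "norm (x, max y (B + 1)) \<le> B" by (rule B)
  moreover have "\<bar>max y (B + 1)\<bar> \<le> norm (x, max y (B + 1))"
    using norm_snd_le[of "max y (B + 1)" x] by simp
  ultimately show False by linarith
qed

text \<open>
  Otherwise the component contains a point on the bottom side of the strip, which is then a
  frontier point that lies on no arrow.
\<close>

lemma below_arrows_not_face:
  fixes F :: "(real \<times> real) set"
  assumes "F \<in> components (strip - V)" "(x, y) \<in> F" "frontier F \<subseteq> V"
  shows "\<exists>y'\<le>y. (x, y') \<in> V"
proof (rule ccontr)
  assume none: "\<not> ?thesis"
  have F: "F \<subseteq> strip" using in_components_subset[OF assms(1)] by blast
  then have xy: "0 \<le> x" "x \<le> 1" "0 \<le> y" using assms(2) by (auto simp: strip_def)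
  have conn: "connected ({x} \<times> {0..y})" by (intro connected_Times) auto
  have "{x} \<times> {0..y} \<subseteq> strip - V" using none xy by (auto simp: strip_def)
  then have "{x} \<times> {0..y} \<subseteq> F"
    using components_maximal[OF assms(1) conn] assms(2) xy by force
  then have bottom: "(x, 0) \<in> F" using xy by auto
  have "(x, 0) \<notin> interior F"
  proof
    assume "(x, 0) \<in> interior F"
    then obtain e where e: "0 < e" "ball (x, 0) e \<subseteq> F" by (auto simp: mem_interior)
    have "(x, - e / 2) \<in> ball (x, 0) e" using e by (simp add: dist_Pair_Pair dist_real_def)
    then have "(x, - e / 2) \<in> strip" using e(2) F by blast
    then show False using e(1) by (simp add: strip_def)
  qed
  then have "(x, 0) \<in> frontier F" using bottom closure_subset by (auto simp: frontier_def)
  then show False using assms(3) none xy by auto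
qed

context signed_word
begin

lemma height_mono:
  assumes "k \<le> l"
  shows "height r w k \<le> height r w l"
  unfolding height_def using assms by (auto intro!: card_mono)

lemma height_strict_mono:
  assumes "k < l" "l \<in> index_set r w"
  shows "height r w k < height r w l"
proof -
  have "{j \<in> index_set r w. j \<le> k} \<subset> {j \<in> index_set r w. j \<le> l}" using assms
    by force
  then show ?thesis unfolding height_def by (simp add: psubset_card_mono)
qed

lemma height_le_iff:
  assumes "k \<in> index_set r w" "l \<in> index_set r w"
  shows "height r w k \<le> height r w l \<longleftrightarrow> k \<le> l"
  using height_mono height_strict_mono[OF _ assms(1)] by (meson linorder_not_le)

lemma height_ge_1:
  assumes "k \<in> index_set r w"
  shows "height r w k \<ge> 1"
proof -
  have "card {j \<in> index_set r w. j \<le> k} > 0" using assms by (auto simp: card_gt_0_iff)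
  then show ?thesis unfolding height_def by linarith
qed

text \<open>
  The vertical arrows on a strand cover it without gaps.
\<close>

lemma wall_cover:
  assumes "c \<in> {1..r}" "0 \<le> n" "n \<le> n'" "n' \<le> len"
    and "height r w (tp c n) \<le> y" "y \<le> height r w (tp c n')"
  shows "y = height r w (tp c n) \<or> (\<exists>m. strand w m = c \<and> n < m \<and> m \<le> n' \<and>
    height r w (tp c (m - 1)) \<le> y \<and> y \<le> height r w m)"
  using assms(3-6)
proof (induction n' rule: int_ge_induct)
  case (step i)
  have t: "tp c (i + 1) = (if strand w (i + 1) = c then i + 1 else tp c i)"
    using strand_top_step[of c "i + 1"] assms step by simp
  show ?case
  proof (cases "y \<le> height r w (tp c i)")
    case True
    then show ?thesis using step by force
  next
    case False
    then have "strand w (i + 1) = c" using step t by (auto split: if_splits)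
    then show ?thesis using step t False by (intro disjI2 exI[of _ "i + 1"]) auto
  qed
qed simp

end

context bfz_data
begin

text \<open>
  Stated for arbitrary \<open>a\<close> and \<open>b\<close> so that it also shows that a strip without letters has no arrows.
\<close>

lemma strip_arrow_cases:
  assumes "e \<in> strip_arrows r E w a b"
  obtains (vertical) m where "m \<in> positions w a b" "e = vertical_at r w m"
  | (across) n where "positions w a b \<noteq> {}" "a \<noteq> b" "level w a b n" "e = level_arrow r w a b n"
proof -
  have e: "e \<in> arcs Q" "strand w (fst e) \<in> {a, b}" "strand w (snd e) \<in> {a, b}"
    using assms by (auto simp: strip_arrows_def)
  show ?thesis
  proof (cases "crossing w e")
    case True
    obtain x y n where *: "{x, y} \<in> E" "level w x y n" "orient w x y n" "e = (tp x n, tp y n)"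
      using crossing_arrow_cases[OF e(1) True] .
    then have xy: "x \<in> {a, b}" "y \<in> {a, b}" "x \<noteq> y" using e crossing_ends[OF *(1,2)] edge
      by auto
    then have ab: "a \<noteq> b" "x = a \<and> y = b \<or> x = b \<and> y = a" by auto
    then have pos: "positions w a b \<noteq> {}"
      using *(2) positions_commute[of w a b] unfolding level_def by auto
    have "level w a b n" "e = level_arrow r w a b n"
      using * ab level_swap[OF ab(1)] orient_swap[OF pos ab(1)] by (auto simp: level_arrow_def)
    then show ?thesis using across pos ab(1) by blast
  next
    case False
    then have "e \<in> vertical_at r w ` {1..len}" using not_crossing_vertical[of "[e]"] e by simp
    then obtain m where m: "1 \<le> m" "m \<le> len" "e = vertical_at r w m" by auto
    then have "strand w m \<in> {a, b}" using e by (auto simp: vertical_at_def split: if_splits)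
    then show ?thesis using m vertical by (simp add: positions_def)
  qed
qed

context
  fixes a b
  assumes ab: "{a, b} \<in> E" and pos: "positions w a b \<noteq> {}"
begin

abbreviation "ht \<equiv> height r w"
abbreviation "lin \<equiv> level_line r w a b"
abbreviation "sg \<equiv> segment r w a"
abbreviation "pt \<equiv> point r w a"
abbreviation "trap \<equiv> trapezoid r w a b"
abbreviation "ctrap \<equiv> closed_trapezoid r w a b"

lemmas ed = edge[OF ab]

lemma point_a: "strand w k = a \<Longrightarrow> pt k = (0, ht k)" by (simp add: point_def)
lemma point_b: "strand w k = b \<Longrightarrow> pt k = (1, ht k)" using ed by (auto simp: point_def)

lemma strip_arrows_eq:
  "strip_arrows r E w a b =
     vertical_at r w ` positions w a b \<union> level_arrow r w a b ` {n. level w a b n}"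
proof (intro equalityI subsetI)
  fix e assume "e \<in> strip_arrows r E w a b"
  then show "e \<in> vertical_at r w ` positions w a b \<union> level_arrow r w a b ` {n. level w a b n}"
    by (cases rule: strip_arrow_cases) auto
next
  fix e assume "e \<in> vertical_at r w ` positions w a b \<union> level_arrow r w a b ` {n. level w a b n}"
  then show "e \<in> strip_arrows r E w a b"
  proof
    assume "e \<in> vertical_at r w ` positions w a b"
    then obtain m where m: "m \<in> positions w a b" "e = vertical_at r w m" by auto
    then have "1 \<le> m" "m \<le> len" "strand w m \<in> {a, b}" by (auto simp: positions_def)
    then show ?thesis using m vertical_at_props(3)[of m]
      by (auto simp: strip_arrows_def arcs_bfz_quiver vertical_at_def)
  next
    assume "e \<in> level_arrow r w a b ` {n. level w a b n}"
    then obtain n where n: "level w a b n" "e = level_arrow r w a b n" by auto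
    have "level w b a n" "{b, a} \<in> E" using n level_swap ed ab by (auto simp: insert_commute)
    moreover have "orient w b a n \<longleftrightarrow> \<not> orient w a b n"
      using orient_swap[OF pos ed(1)] .
    ultimately have "e \<in> crossing_arrows r E w"
      using crossingI[of a b n] crossingI[of b a n] n ab by (auto simp: level_arrow_def)
    then show ?thesis using crossing_ends[OF ab n(1)] n
      by (auto simp: strip_arrows_def arcs_bfz_quiver level_arrow_def)
  qed
qed

lemma face_arrows_subset:
  "block w a b n n' \<Longrightarrow> face_arrows r w a b n n' \<subseteq> strip_arrows r E w a b"
  by (auto simp: face_arrows_def strip_arrows_eq block_def)

lemma segment_level:
  assumes "level w a b n"
  shows "sg (level_arrow r w a b n) = {(x, y). 0 \<le> x \<and> x \<le> 1 \<and> y = lin n x}"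
proof -
  have "sg (level_arrow r w a b n) = closed_segment (pt (tp a n)) (pt (tp b n))"
    by (auto simp: segment_def level_arrow_def closed_segment_commute)
  then show ?thesis
    using crossing_ends[OF ab assms] point_a point_b
    by (simp add: closed_segment_across level_line_def)
qed

lemma segment_vertical:
  assumes "m \<in> positions w a b"
  shows "strand w m = a \<Longrightarrow> sg (vertical_at r w m) = {(x, y). x = 0 \<and> ht (tp a (m - 1)) \<le> y \<and> y \<le> ht m}"
    and "strand w m = b \<Longrightarrow> sg (vertical_at r w m) = {(x, y). x = 1 \<and> ht (tp b (m - 1)) \<le> y \<and> y \<le> ht m}"
proof -
  let ?k = "tp (strand w m) (m - 1)"
  have m: "1 \<le> m" "m \<le> len" using assms by (auto simp: positions_def)
  note vp = vertical_at_props[OF m HOL.refl]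
  have le: "ht ?k \<le> ht m" using height_mono vp by simp
  have "sg (vertical_at r w m) = closed_segment (pt ?k) (pt m)"
    by (auto simp: segment_def vertical_at_def closed_segment_commute)
  then show "strand w m = a \<Longrightarrow> sg (vertical_at r w m) = {(x, y). x = 0 \<and> ht (tp a (m - 1)) \<le> y \<and> y \<le> ht m}"
    "strand w m = b \<Longrightarrow> sg (vertical_at r w m) = {(x, y). x = 1 \<and> ht (tp b (m - 1)) \<le> y \<and> y \<le> ht m}"
    using vp le by (auto simp: point_a point_b closed_segment_wall)
qed

lemma line_mono:
  assumes "level w a b n" "level w a b n'" "n \<le> n'" "0 \<le> x" "x \<le> 1"
  shows "lin n x \<le> lin n' x"
proof -
  have "ht (tp a n) \<le> ht (tp a n')" "ht (tp b n) \<le> ht (tp b n')"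
    using height_mono strand_top_mono ed level_bounds[OF assms(1)] assms(3) by auto
  then show ?thesis unfolding level_line_def using assms by (intro add_mono mult_left_mono) auto
qed

text \<open>
  Two level lines may meet at an end (the face between them is a triangle) but not in between.
\<close>

lemma line_strict_mono:
  assumes "level w a b n" "level w a b n'" "n < n'" "0 < x" "x < 1"
  shows "lin n x < lin n' x"
proof -
  note less = level_tops_less[OF ed(2,3) assms(1-3)]
  have le: "ht (tp a n) \<le> ht (tp a n')" "ht (tp b n) \<le> ht (tp b n')"
    using height_mono less by auto
  have "ht (tp a n) < ht (tp a n') \<or> ht (tp b n) < ht (tp b n')"
    using less height_strict_mono crossing_ends[OF ab assms(2)] by (metis add_mono not_le)
  then show ?thesis
  proof
    assume "ht (tp a n) < ht (tp a n')"
    then show ?thesis unfolding level_line_def using le assms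
      by (intro add_less_le_mono mult_left_mono mult_strict_left_mono) auto
  next
    assume "ht (tp b n) < ht (tp b n')"
    then show ?thesis unfolding level_line_def using le assms
      by (intro add_le_less_mono mult_left_mono mult_strict_left_mono) auto
  qed
qed

lemma line_ends: "lin n 0 = ht (tp a n)" "lin n 1 = ht (tp b n)"
  by (simp_all add: level_line_def)

lemma line_combination: "u + v = 1 \<Longrightarrow> lin n (u * x + v * y) = u * lin n x + v * lin n y"
proof -
  assume "u + v = 1"
  then have v: "v = 1 - u" by simp
  show ?thesis unfolding level_line_def v by (simp add: algebra_simps)
qed

text \<open>
  The usual property of a convex set and its interior. It gives both convexity and the closure
  of the trapezoid.
\<close>

lemma closed_in_trapezoid:
  assumes "p \<in> ctrap n n'" "c \<in> trap n n'" "0 < u" "u < 1"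
  shows "(1 - u) *\<^sub>R p + u *\<^sub>R c \<in> trap n n'"
proof -
  obtain x y where p: "p = (x, y)" by (cases p)
  obtain x' y' where c: "c = (x', y')" by (cases c)
  have A: "0 \<le> x" "x \<le> 1" "lin n x \<le> y" "y \<le> lin n' x"
    and B: "0 < x'" "x' < 1" "lin n x' < y'" "y' < lin n' x'"
    using assms by (auto simp: p c trapezoid_def closed_trapezoid_def)
  have u: "0 \<le> 1 - u" using assms by simp
  have uv: "(1 - u) + u = 1" by simp
  have mix: "(1 - u) * s + u * s' < (1 - u) * t + u * t'" if "s \<le> t" "s' < t'" for s t s' t'
    using that assms by (intro add_le_less_mono mult_left_mono mult_strict_left_mono) auto
  have "0 < (1 - u) * x + u * x'" using mix[OF A(1) B(1)] by simp
  moreover have "(1 - u) * x + u * x' < 1" using mix[OF A(2) B(2)] by simp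
  moreover have "lin n ((1 - u) * x + u * x') < (1 - u) * y + u * y'"
    unfolding line_combination[OF uv] using mix[OF A(3) B(3)] .
  moreover have "(1 - u) * y + u * y' < lin n' ((1 - u) * x + u * x')"
    unfolding line_combination[OF uv] using mix[OF A(4) B(4)] .
  ultimately show ?thesis by (simp add: p c trapezoid_def)
qed

lemma trapezoid_subset: "trap n n' \<subseteq> ctrap n n'"
  by (auto simp: trapezoid_def closed_trapezoid_def)

lemma continuous_line [continuous_intros]:
  "continuous_on S f \<Longrightarrow> continuous_on S (\<lambda>p. lin n (f p))"
  unfolding level_line_def by (intro continuous_intros)

lemma trapezoid_conv: "trap n n' = {p. 0 < fst p} \<inter> {p. fst p < 1} \<inter> {p. lin n (fst p) < snd p} \<inter>
    {p. snd p < lin n' (fst p)}"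
  by (auto simp: trapezoid_def)

lemma closed_trapezoid_conv: "ctrap n n' = {p. 0 \<le> fst p} \<inter> {p. fst p \<le> 1} \<inter> {p. lin n (fst p) \<le> snd p} \<inter>
    {p. snd p \<le> lin n' (fst p)}"
  by (auto simp: closed_trapezoid_def)

lemma open_trapezoid: "open (trap n n')"
  unfolding trapezoid_conv by (intro open_Int open_Collect_less continuous_intros)

lemma closed_closed_trapezoid: "closed (ctrap n n')"
  unfolding closed_trapezoid_conv by (intro closed_Int closed_Collect_le continuous_intros)

lemma convex_trapezoid: "convex (trap n n')"
proof (rule convexI)
  fix p q :: "real \<times> real" and u v :: real
  assume pq: "p \<in> trap n n'" "q \<in> trap n n'" and uv: "0 \<le> u" "0 \<le> v" "u + v = 1"
  have u: "u = 1 - v" using uv by simp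
  consider "v = 0" | "v = 1" | "0 < v" "v < 1" using uv by linarith
  then show "u *\<^sub>R p + v *\<^sub>R q \<in> trap n n'"
    by cases (use pq u closed_in_trapezoid[of p n n' q v] trapezoid_subset in auto)
qed

lemma trapezoid_nonempty:
  assumes "level w a b n" "level w a b n'" "n < n'"
  shows "(1 / 2, (lin n (1 / 2) + lin n' (1 / 2)) / 2) \<in> trap n n'"
  using line_strict_mono[OF assms, of "1 / 2"] by (simp add: trapezoid_def)

lemma closure_trapezoid:
  assumes "level w a b n" "level w a b n'" "n < n'"
  shows "closure (trap n n') = ctrap n n'"
proof
  show "closure (trap n n') \<subseteq> ctrap n n'"
    by (rule closure_minimal[OF trapezoid_subset closed_closed_trapezoid])
  obtain c where c: "c \<in> trap n n'" using trapezoid_nonempty[OF assms] by blast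
  show "ctrap n n' \<subseteq> closure (trap n n')"
  proof
    fix p assume p: "p \<in> ctrap n n'"
    show "p \<in> closure (trap n n')"
    proof (cases "p = c")
      case True
      then show ?thesis using c closure_subset by blast
    next
      case False
      have "open_segment p c \<subseteq> trap n n'"
        using closed_in_trapezoid[OF p c] by (auto simp: in_segment)
      then have "closure (open_segment p c) \<subseteq> closure (trap n n')" by (rule closure_mono)
      then show ?thesis using False by (auto simp: closure_open_segment)
    qed
  qed
qed

lemma frontier_trapezoid:
  assumes "level w a b n" "level w a b n'" "n < n'"
  shows "frontier (trap n n') = ctrap n n' - trap n n'"
  using closure_trapezoid[OF assms] open_trapezoid by (simp add: frontier_def interior_open)

lemma bounded_trapezoid: "bounded (trap n n')"
proof -
  have "trap n n' \<subseteq> {0..1} \<times> {min (lin n 0) (lin n 1)..max (lin n' 0) (lin n' 1)}"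
  proof
    fix p assume "p \<in> trap n n'"
    then obtain x y where p: "p = (x, y)" "0 < x" "x < 1" "lin n x < y" "y < lin n' x"
      by (auto simp: trapezoid_def)
    have mix: "min s t \<le> (1 - x) * s + x * t" "(1 - x) * s + x * t \<le> max s t" for s t :: real
      using convex_bound_le[of "- s" "- min s t" "- t" "1 - x" x] convex_bound_le[of s "max s t" t "1 - x" x] p
      by auto
    have "min (lin n 0) (lin n 1) \<le> lin n x" "lin n' x \<le> max (lin n' 0) (lin n' 1)"
      using mix(1)[of "lin n 0" "lin n 1"] mix(2)[of "lin n' 0" "lin n' 1"]
        by (simp_all add: level_line_def)
    then show "p \<in> {0..1} \<times> {min (lin n 0) (lin n 1)..max (lin n' 0) (lin n' 1)}"
      using p by auto
  qed
  moreover have "bounded ({0..1::real} \<times> {min (lin n 0) (lin n 1)..max (lin n' 0) (lin n' 1)})"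
    by (intro bounded_Times bounded_closed_interval)
  ultimately show ?thesis using bounded_subset by blast
qed

abbreviation "U \<equiv> \<Union> (sg ` strip_arrows r E w a b)"

definition "lowest \<equiv> Min (positions w a b) - 1"

lemma level_lowest: "level w a b lowest"
  unfolding lowest_def by (rule lowest_level(1)[OF ab pos HOL.refl])

lemma lowest_less: "m \<in> positions w a b \<Longrightarrow> lowest < m"
  unfolding lowest_def using Min_le[OF finite_positions, of m w a b] by linarith

lemma level_highest: "level w a b len"
  by (rule level_length[OF pos])

lemma between_levels_in_positions:
  assumes "strand w m \<in> {a, b}" "level w a b n" "level w a b n'" "n < m" "m \<le> n'"
  shows "m \<in> positions w a b"
  using assms level_bounds[OF assms(2)] level_bounds[OF assms(3)] by (auto simp: positions_def)

lemma in_U_cases: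
  assumes "(x, y) \<in> U"
  obtains (level) l where "level w a b l" "0 \<le> x" "x \<le> 1" "y = lin l x"
  | (left) m where "m \<in> positions w a b" "strand w m = a" "x = 0" "ht (tp a (m - 1)) \<le> y" "y \<le> ht m"
  | (right) m where "m \<in> positions w a b" "strand w m = b" "x = 1" "ht (tp b (m - 1)) \<le> y" "y \<le> ht m"
proof -
  obtain e where e: "e \<in> strip_arrows r E w a b" "(x, y) \<in> sg e" using assms by blast
  from e(1) consider m where "m \<in> positions w a b" "e = vertical_at r w m"
    | l where "level w a b l" "e = level_arrow r w a b l"
    unfolding strip_arrows_eq by blast
  then show ?thesis
  proof cases
    case 1
    then have "strand w m = a \<or> strand w m = b" by (auto simp: positions_def)
    then show ?thesis
      using 1 e(2) segment_vertical[OF 1(1)] left[OF 1(1)] right[OF 1(1)] by auto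
  next
    case 2
    then show ?thesis using e(2) segment_level[OF 2(1)] level[OF 2(1)] by auto
  qed
qed

lemma level_in_U:
  assumes "level w a b l" "0 \<le> x" "x \<le> 1"
  shows "(x, lin l x) \<in> U"
proof -
  have "level_arrow r w a b l \<in> strip_arrows r E w a b" using assms by (auto simp: strip_arrows_eq)
  moreover have "(x, lin l x) \<in> sg (level_arrow r w a b l)" using assms by (simp add: segment_level)
  ultimately show ?thesis by blast
qed

lemma wall_covered:
  assumes "level w a b n" "level w a b n'" "n \<le> n'"
  shows "lin n 0 \<le> y \<Longrightarrow> y \<le> lin n' 0 \<Longrightarrow> y = lin n 0 \<or>
      (\<exists>m\<in>positions w a b. n < m \<and> m \<le> n' \<and> (0, y) \<in> sg (vertical_at r w m))"
    and "lin n 1 \<le> y \<Longrightarrow> y \<le> lin n' 1 \<Longrightarrow> y = lin n 1 \<or>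
      (\<exists>m\<in>positions w a b. n < m \<and> m \<le> n' \<and> (1, y) \<in> sg (vertical_at r w m))"
proof -
  have n: "0 \<le> n" "n' \<le> len" using assms level_bounds by auto
  note posI = between_levels_in_positions[OF _ assms(1,2)]
  show "y = lin n 0 \<or> (\<exists>m\<in>positions w a b. n < m \<and> m \<le> n' \<and> (0, y) \<in> sg (vertical_at r w m))"
    if "lin n 0 \<le> y" "y \<le> lin n' 0"
  proof -
    have "y = ht (tp a n) \<or> (\<exists>m. strand w m = a \<and> n < m \<and> m \<le> n' \<and> ht (tp a (m - 1)) \<le> y \<and> y \<le> ht m)"
      using wall_cover[OF ed(2) n(1) assms(3) n(2), of y] that by (simp add: line_ends)
    then show ?thesis
    proof (elim disjE exE conjE)
    fix m assume m: "strand w m = a" "n < m" "m \<le> n'" "ht (tp a (m - 1)) \<le> y" "y \<le> ht m"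
    then have "m \<in> positions w a b" using posI by blast
    then show ?thesis using m segment_vertical(1)[of m] by auto
    qed (simp add: line_ends)
  qed
  show "y = lin n 1 \<or> (\<exists>m\<in>positions w a b. n < m \<and> m \<le> n' \<and> (1, y) \<in> sg (vertical_at r w m))"
    if "lin n 1 \<le> y" "y \<le> lin n' 1"
  proof -
    have "y = ht (tp b n) \<or> (\<exists>m. strand w m = b \<and> n < m \<and> m \<le> n' \<and> ht (tp b (m - 1)) \<le> y \<and> y \<le> ht m)"
      using wall_cover[OF ed(3) n(1) assms(3) n(2), of y] that by (simp add: line_ends)
    then show ?thesis
    proof (elim disjE exE conjE)
    fix m assume m: "strand w m = b" "n < m" "m \<le> n'" "ht (tp b (m - 1)) \<le> y" "y \<le> ht m"
    then have "m \<in> positions w a b" using posI by blast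
    then show ?thesis using m segment_vertical(2)[of m] by auto
    qed (simp add: line_ends)
  qed
qed

lemma U_between:
  assumes "(x, y) \<in> U"
  shows "0 \<le> x" "x \<le> 1" "lin lowest x \<le> y" "y \<le> lin len x" "1 \<le> y"
proof -
  have low: "lin lowest x' \<ge> 1" if "0 \<le> x'" "x' \<le> 1" for x'
  proof -
    have "ht (tp a lowest) \<ge> 1" "ht (tp b lowest) \<ge> 1"
      using height_ge_1 crossing_ends[OF ab level_lowest] by auto
    then show ?thesis
      using convex_bound_le[of "- ht (tp a lowest)" "-1" "- ht (tp b lowest)" "1 - x'" x'] that
      by (simp add: level_line_def)
  qed
  have vert: "ht (tp c lowest) \<le> ht (tp c (m - 1))" "ht m \<le> ht (tp c len)"
    if "m \<in> positions w a b" "c \<in> {a, b}" "strand w m = c" for m c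
  proof -
    have m: "1 \<le> m" "m \<le> len" using that by (auto simp: positions_def)
    have c: "c \<in> {1..r}" using that ed by auto
    show "ht (tp c lowest) \<le> ht (tp c (m - 1))"
      using height_mono strand_top_mono[OF c] lowest_less[OF that(1)] level_bounds[OF level_lowest]
        by auto
    show "ht m \<le> ht (tp c len)"
      using height_mono strand_top_ge[OF pos_index[OF m] that(3) m(2)] by auto
  qed
  show "0 \<le> x" "x \<le> 1" "lin lowest x \<le> y" "y \<le> lin len x"
  proof -
    have "0 \<le> x \<and> x \<le> 1 \<and> lin lowest x \<le> y \<and> y \<le> lin len x"
      using assms
    proof (cases rule: in_U_cases)
      case (level l)
      have "lowest \<le> l"
      proof (rule ccontr)
        assume "\<not> lowest \<le> l"
        then have "l < lowest" by simp
        then have "l < len" using level_bounds[OF level_lowest] by simp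
        then have "l + 1 \<in> positions w a b" using level_next_letter[OF level(1)] by simp
        then show False using lowest_less[of "l + 1"] \<open>l < lowest\<close> by simp
      qed
      then show ?thesis
        using level line_mono[OF level_lowest level(1), of x] line_mono[OF level(1) level_highest, of x]
          level_bounds[OF level(1)] by simp
    next
      case (left m)
      then show ?thesis using vert[of m a] line_ends by auto
    next
      case (right m)
      then show ?thesis using vert[of m b] line_ends by auto
    qed
    then show "0 \<le> x" "x \<le> 1" "lin lowest x \<le> y" "y \<le> lin len x" by auto
  qed
  then show "1 \<le> y" using low[of x] by simp
qed

lemma trapezoid_disjoint_U:
  assumes "block w a b n n'"
  shows "trap n n' \<inter> U = {}"
proof (rule ccontr)
  assume "trap n n' \<inter> U \<noteq> {}"
  then obtain x y where xy: "(x, y) \<in> U" "0 < x" "x < 1" "lin n x < y" "y < lin n' x"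
    by (auto simp: trapezoid_def)
  have lev: "level w a b n" "level w a b n'" using assms by (auto simp: block_def)
  show False using xy(1)
  proof (cases rule: in_U_cases)
    case (level l)
    then have "l \<le> n \<or> n' \<le> l" using assms unfolding block_def by (meson not_le)
    then show False
      using line_mono[OF level(1) lev(1), of x] line_mono[OF lev(2) level(1), of x] xy level by auto
  qed (use xy in auto)
qed

lemma trapezoid_subset_strip:
  assumes "level w a b n"
  shows "trap n n' \<subseteq> strip"
proof
  fix p assume "p \<in> trap n n'"
  then obtain x y where p: "p = (x, y)" "0 < x" "x < 1" "lin n x < y" by (auto simp: trapezoid_def)
  have "1 \<le> lin n x" using U_between(5)[OF level_in_U[OF assms]] p by simp
  then show "p \<in> strip" using p by (simp add: strip_def)
qed

lemma frontier_eq_face_arrows: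
  assumes "block w a b n n'"
  shows "frontier (trap n n') = \<Union> (sg ` face_arrows r w a b n n')"
proof -
  have lev: "level w a b n" "level w a b n'" and n: "n < n'" using assms by (auto simp: block_def)
  note fr = frontier_trapezoid[OF lev n]
  have lines: "lin n x \<le> lin n' x" if "0 \<le> x" "x \<le> 1" for x
    using line_mono[OF lev _ that] n by simp
  show ?thesis
  proof (intro equalityI subsetI)
    fix p assume "p \<in> frontier (trap n n')"
    then have pf: "p \<in> ctrap n n' - trap n n'" unfolding fr .
    obtain x y where xy: "p = (x, y)" by (cases p)
    have pc: "0 \<le> x" "x \<le> 1" "lin n x \<le> y" "y \<le> lin n' x"
      and "\<not> (0 < x \<and> x < 1 \<and> lin n x < y \<and> y < lin n' x)"
      using pf unfolding xy by (simp_all add: trapezoid_def closed_trapezoid_def)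
    then have "x = 0 \<or> x = 1 \<or> y = lin n x \<or> y = lin n' x" by linarith
    note p = xy pc this
    have onlevel: "p \<in> \<Union> (sg ` face_arrows r w a b n n')" if "y = lin n x \<or> y = lin n' x"
      using that p segment_level[OF lev(1)] segment_level[OF lev(2)] by (auto simp: face_arrows_def)
    have onwall: "p \<in> \<Union> (sg ` face_arrows r w a b n n')"
      if "m \<in> positions w a b" "n < m" "m \<le> n'" "p \<in> sg (vertical_at r w m)" for m
      using that by (auto simp: face_arrows_def)
    show "p \<in> \<Union> (sg ` face_arrows r w a b n n')"
      using p(6)
    proof (elim disjE)
      assume "x = 0"
      then show ?thesis using wall_covered(1)[OF lev, of y] n p onlevel onwall by auto
    next
      assume "x = 1"
      then show ?thesis using wall_covered(2)[OF lev, of y] n p onlevel onwall by auto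
    qed (use onlevel in auto)
  next
    fix p assume "p \<in> \<Union> (sg ` face_arrows r w a b n n')"
    then obtain e where e: "e \<in> face_arrows r w a b n n'" "p \<in> sg e" by blast
    from e(1) consider m where "m \<in> positions w a b" "n < m" "m \<le> n'" "e = vertical_at r w m"
      | "e = level_arrow r w a b n" | "e = level_arrow r w a b n'"
      unfolding face_arrows_def by blast
    then show "p \<in> frontier (trap n n')"
    proof cases
      case 1
      have m: "1 \<le> m" "m \<le> len" "strand w m = a \<or> strand w m = b" using 1
        by (auto simp: positions_def)
      have bounds: "ht (tp c n) \<le> ht (tp c (m - 1))" "ht m \<le> ht (tp c n')"
        if "strand w m = c" "c \<in> {1..r}" for c
        using height_mono strand_top_mono[OF that(2), of n "m - 1"] strand_top_ge[OF pos_index[OF m(1,2)] that(1) 1(3)]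
          level_bounds[OF lev(1)] 1 by auto
      show ?thesis unfolding fr
        using m(3) bounds ed e(2) segment_vertical[OF 1(1)] 1(4) line_ends
        by (fastforce simp: trapezoid_def closed_trapezoid_def)
    next
      case 2
      then show ?thesis unfolding fr
        using e(2) segment_level[OF lev(1)] lines by (auto simp: trapezoid_def closed_trapezoid_def)
    next
      case 3
      then show ?thesis unfolding fr
        using e(2) segment_level[OF lev(2)] lines by (auto simp: trapezoid_def closed_trapezoid_def)
    qed
  qed
qed

text \<open>
  The frontier of a face determines the set of arrows around it: a level line at another level differs
  at \<open>x = 1/2\<close>, and a vertical arrow outside the block does not lie between the corners.
\<close>

lemma arrow_on_frontier:
  assumes "block w a b n n'" "e \<in> strip_arrows r E w a b" "sg e \<subseteq> frontier (trap n n')"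
  shows "e \<in> face_arrows r w a b n n'"
proof -
  have lev: "level w a b n" "level w a b n'" and n: "n < n'" using assms by (auto simp: block_def)
  note fr = frontier_trapezoid[OF lev n]
  from assms(2) consider m where "m \<in> positions w a b" "e = vertical_at r w m"
    | l where "level w a b l" "e = level_arrow r w a b l"
    unfolding strip_arrows_eq by blast
  then show ?thesis
  proof cases
    case 1
    have m: "1 \<le> m" "m \<le> len" "strand w m = a \<or> strand w m = b" using 1
      by (auto simp: positions_def)
    define c where "c = strand w m"
    define z :: real where "z = (if c = a then 0 else 1)"
    have c: "c \<in> {1..r}" using m ed by (auto simp: c_def)
    note vp = vertical_at_props[OF m(1,2) c_def]
    have le: "ht (tp c (m - 1)) \<le> ht m" using vp height_mono by auto
    have s: "sg (vertical_at r w m) = {(x, y). x = z \<and> ht (tp c (m - 1)) \<le> y \<and> y \<le> ht m}"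
      and z: "lin l z = ht (tp c l)" for l
    proof -
      consider "c = a" "z = 0" "strand w m = a" | "c = b" "z = 1" "strand w m = b"
        using m(3) ed(1) by (auto simp: c_def z_def)
      note cs = this
      show "sg (vertical_at r w m) = {(x, y). x = z \<and> ht (tp c (m - 1)) \<le> y \<and> y \<le> ht m}"
        using cs by cases (simp_all add: segment_vertical[OF 1(1)])
      show "lin l z = ht (tp c l)"
        using cs by cases (simp_all add: line_ends)
    qed
    have "(z, ht (tp c (m - 1))) \<in> sg e" "(z, ht m) \<in> sg e"
      unfolding 1(2) s using le by simp_all
    then have "(z, ht (tp c (m - 1))) \<in> ctrap n n'" "(z, ht m) \<in> ctrap n n'"
      using assms(3) unfolding fr by blast+
    then have h: "ht (tp c n) \<le> ht (tp c (m - 1))" "ht m \<le> ht (tp c n')"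
      using z by (auto simp: closed_trapezoid_def)
    have nb: "0 \<le> n" "0 \<le> n'" using level_bounds lev by auto
    have "tp c n \<le> tp c (m - 1)" "m \<le> tp c n'"
      using h height_le_iff vp pos_index[OF m(1,2)] strand_top_in[OF c nb(1)] strand_top_in[OF c nb(2)]
        by auto
    then have "m \<le> n'" "tp c n < m" using strand_top_le[OF c nb(2)] vp by auto
    moreover have "n < m"
      using strand_top_ge[OF pos_index[OF m(1,2)] c_def[symmetric], of n] \<open>tp c n < m\<close>
        by linarith
    ultimately show ?thesis using 1 by (auto simp: face_arrows_def)
  next
    case 2
    have "(1 / 2, lin l (1 / 2)) \<in> sg e" using segment_level[OF 2(1)] 2 by simp
    then have "(1 / 2, lin l (1 / 2)) \<in> ctrap n n' - trap n n'" using assms(3) fr by blast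
    then have "lin l (1 / 2) = lin n (1 / 2) \<or> lin l (1 / 2) = lin n' (1 / 2)"
      by (auto simp: trapezoid_def closed_trapezoid_def)
    moreover have "k = l" if k: "level w a b k" "lin l (1 / 2) = lin k (1 / 2)" for k
    proof (rule ccontr)
      assume "k \<noteq> l"
      then consider "k < l" | "l < k" by linarith
      then show False
        using line_strict_mono[OF 2(1) k(1), of "1 / 2"] line_strict_mono[OF k(1) 2(1), of "1 / 2"] k(2)
        by cases simp_all
    qed
    ultimately have "l = n \<or> l = n'" using lev by metis
    then show ?thesis using 2(2) by (auto simp: face_arrows_def)
  qed
qed

text \<open>
  The frontier of the trapezoid consists of arrows, and a connected set that meets the trapezoid but
  not its frontier lies inside.
\<close>

lemma component_meets_trapezoid:
  assumes "block w a b n n'" "F \<in> components (strip - U)" "F \<inter> trap n n' \<noteq> {}"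
  shows "F = trap n n'"
proof
  have lev: "level w a b n" "level w a b n'" "n < n'" using assms by (auto simp: block_def)
  have T: "trap n n' \<subseteq> strip - U"
    using trapezoid_disjoint_U[OF assms(1)] trapezoid_subset_strip[OF lev(1)] by blast
  show "trap n n' \<subseteq> F"
    using components_maximal[OF assms(2) convex_connected[OF convex_trapezoid] T assms(3)] .
  have "frontier (trap n n') \<subseteq> U"
    unfolding frontier_eq_face_arrows[OF assms(1)] using face_arrows_subset[OF assms(1)] by blast
  moreover have "F \<subseteq> strip - U" using in_components_subset[OF assms(2)] .
  ultimately have "F \<inter> frontier (trap n n') = {}" by blast
  then show "F \<subseteq> trap n n'"
    using connected_Int_frontier[OF in_components_connected[OF assms(2)] assms(3)] by blast
qed

text \<open>
  Take a point of a face. Vertically above and below it there are arrows, for otherwise the face would be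
  unbounded or reach down to the bottom side of the strip. So the point lies between two consecutive
  level lines; it is not on a wall, as the part of the walls between the lowest and the highest level
  is covered by arrows.
\<close>

lemma faces_eq: "faces r E w a b = {trap n n' | n n'. block w a b n n'}"
proof (intro equalityI subsetI)
  fix F assume "F \<in> faces r E w a b"
  then have F: "F \<in> components (strip - U)" "bounded F" "frontier F \<subseteq> U"
    by (auto simp: faces_def)
  obtain x y where xy: "(x, y) \<in> F" using in_components_nonempty[OF F(1)] by auto
  have sub: "F \<subseteq> strip - U" using in_components_subset[OF F(1)] .
  have x: "0 \<le> x" "x \<le> 1" "0 \<le> y" "(x, y) \<notin> U" using xy sub by (auto simp: strip_def)
  obtain y1 where y1: "(x, y1) \<in> U" "y \<le> y1"
    using ray_in_unbounded_component[OF F(1) xy] F(2) by blast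
  obtain y2 where y2: "(x, y2) \<in> U" "y2 \<le> y"
    using below_arrows_not_face[OF F(1) xy F(3)] U_between(5) by force
  have y12: "y < y1" "y2 < y" using y1 y2 x by (auto simp: order_le_less)
  have between: "lin lowest x < y" "y < lin len x"
    using U_between(3)[OF y2(1)] U_between(4)[OF y1(1)] y12 by auto
  have low_len: "lowest \<le> len" using level_bounds[OF level_lowest] by simp
  have "x \<noteq> 0"
  proof
    assume "x = 0"
    then obtain m where "m \<in> positions w a b" "(0, y) \<in> sg (vertical_at r w m)"
      using wall_covered(1)[OF level_lowest level_highest low_len, of y] between by auto
    then show False using x \<open>x = 0\<close> by (auto simp: strip_arrows_eq)
  qed
  have "x \<noteq> 1"
  proof
    assume "x = 1"
    then obtain m where "m \<in> positions w a b" "(1, y) \<in> sg (vertical_at r w m)"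
      using wall_covered(2)[OF level_lowest level_highest low_len, of y] between by auto
    then show False using x \<open>x = 1\<close> by (auto simp: strip_arrows_eq)
  qed
  \<comment> \<open>the highest level line below the point is followed by one above it\<close>
  define L where "L = {l. level w a b l \<and> lin l x < y}"
  have fin: "finite L" using finite_levels[of a b] by (simp add: L_def)
  define n where "n = Max L"
  have "lowest \<in> L" using level_lowest between by (simp add: L_def)
  then have "n \<in> L" unfolding n_def using fin by (intro Max_in) auto
  then have n: "level w a b n" "lin n x < y" by (auto simp: L_def)
  have "n \<noteq> len" using n between by auto
  then obtain n' where bl: "block w a b n n'" using block_above[OF n(1)] level_bounds[OF n(1)] by force
  have n': "level w a b n'" "n < n'" using bl by (auto simp: block_def)
  have "n' \<notin> L" using Max_ge[OF fin, of n'] n' unfolding n_def by auto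
  then have "y \<le> lin n' x" using n' by (simp add: L_def)
  moreover have "y \<noteq> lin n' x" using level_in_U[OF n'(1) x(1,2)] x by auto
  ultimately have "(x, y) \<in> trap n n'"
    using n x \<open>x \<noteq> 0\<close> \<open>x \<noteq> 1\<close> by (simp add: trapezoid_def)
  then have "F = trap n n'" using component_meets_trapezoid[OF bl F(1)] xy by blast
  then show "F \<in> {trap n n' | n n'. block w a b n n'}" using bl by blast
next
  fix F assume "F \<in> {trap n n' | n n'. block w a b n n'}"
  then obtain n n' where F: "F = trap n n'" and bl: "block w a b n n'" by blast
  have lev: "level w a b n" "level w a b n'" "n < n'" using bl by (auto simp: block_def)
  define p where "p = (1 / 2 :: real, (lin n (1 / 2) + lin n' (1 / 2)) / 2)"
  have p: "p \<in> trap n n'" using trapezoid_nonempty[OF lev] by (simp add: p_def)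
  then have pX: "p \<in> strip - U"
    using trapezoid_disjoint_U[OF bl] trapezoid_subset_strip[OF lev(1)] by blast
  define G where "G = connected_component_set (strip - U) p"
  have G: "G \<in> components (strip - U)" "p \<in> G"
    using pX by (auto simp: G_def components_def)
  then have "G = F" using component_meets_trapezoid[OF bl G(1)] p F by blast
  moreover have "frontier F \<subseteq> U"
    unfolding F frontier_eq_face_arrows[OF bl] using face_arrows_subset[OF bl] by blast
  ultimately show "F \<in> faces r E w a b"
    using G bounded_trapezoid F by (auto simp: faces_def)
qed

lemma adjacent_trapezoids_differ:
  assumes "block w a b k n" "block w a b n n'"
  shows "trap k n \<noteq> trap n n'"
proof -
  have "level w a b k" "level w a b n" "k < n" using assms by (auto simp: block_def)
  then have "trap k n \<noteq> {}" using trapezoid_nonempty by blast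
  moreover have "trap k n \<inter> trap n n' = {}" by (auto simp: trapezoid_def)
  ultimately show ?thesis by blast
qed

end
end

section \<open>Cycles around faces\<close>

lemma chain_verts: "chain u p v \<Longrightarrow> map fst p @ [v] = u # map snd p"
  by (induction p arbitrary: u) auto

text \<open>
  On a closed walk every vertex is left as often as it is entered, so a cycle may be recognised by its
  tails.
\<close>

lemma closed_chain_heads:
  assumes "chain u p u"
  shows "map snd p = rotate1 (map fst p)"
  using chain_verts[OF assms] by (cases p) auto

lemma cycle_bfz_quiver:
  "pre_digraph.cycle (bfz_quiver r E w) c \<longleftrightarrow>
     (\<exists>u\<in>index_set r w. set c \<subseteq> arcs (bfz_quiver r E w) \<and> chain u c u \<and> distinct (map fst c) \<and> c \<noteq> [])"
proof -
  have "distinct (tl (pre_digraph.awalk_verts (bfz_quiver r E w) u c)) \<longleftrightarrow> distinct (map fst c)"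
    if "chain u c u" "c \<noteq> []" for u
  proof -
    have "pre_digraph.awalk_verts (bfz_quiver r E w) u c = fst (hd c) # map snd c"
      using that pre_digraph.awalk_verts_conv'[of "bfz_quiver r E w" u c u]
      unfolding cas_bfz_quiver by (simp add: bfz_quiver_def)
    then show ?thesis using closed_chain_heads[OF that(1)] by simp
  qed
  then show ?thesis
    unfolding pre_digraph.cycle_def pre_digraph.awalk_def cas_bfz_quiver
    by (force simp: bfz_quiver_def)
qed

lemma chain_tail_nth:
  assumes "chain u C v" "k < length C" "chain u (take k C) m"
  shows "fst (C ! k) = m"
proof -
  have "chain u (take k C @ C ! k # drop (Suc k) C) v"
    using assms(1) id_take_nth_drop[OF assms(2)] by simp
  then obtain m' where "chain u (take k C) m'" "fst (C ! k) = m'" by (auto simp: chain_append)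
  then show ?thesis using chain_end_unique[OF assms(3)] by simp
qed

text \<open>
  The tails in \<open>C\<close> being distinct, each vertex has only one successor in \<open>C\<close>.
\<close>

lemma chain_prefix:
  assumes "chain u c v" "chain u C v'" "set c \<subseteq> set C" "distinct (map fst C)" "length c \<le> length C"
  shows "c = take (length c) C"
  using assms(1,3,5)
proof (induction c arbitrary: v rule: rev_induct)
  case (snoc e c)
  let ?k = "length c"
  have c: "chain u c (fst e)" "e \<in> set C" using snoc.prems by (auto simp: chain_append)
  have k: "?k < length C" using snoc.prems by simp
  have c_eq: "c = take ?k C" using snoc.IH[OF c(1)] snoc.prems by simp
  have "fst (C ! ?k) = fst e" using chain_tail_nth[OF assms(2) k] c(1) c_eq by simp
  moreover have "C ! ?k \<in> set C" using k by simp
  ultimately have "C ! ?k = e" using assms(4) c(2) unfolding distinct_map by (metis inj_onD)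
  then show ?case using c_eq k by (simp add: take_Suc_conv_app_nth)
qed simp

text \<open>
  Start both cycles at a common arrow. Then \<open>c\<close> is an initial part of \<open>C\<close> that closes up, hence all of \<open>C\<close>.
\<close>

lemma cycle_unique:
  assumes C: "chain u C u" "distinct (map fst C)"
    and c: "chain v c v" "distinct (map fst c)" "c \<noteq> []" "set c \<subseteq> set C"
  shows "rotation C c"
proof -
  have "hd c \<in> set C" using c(3,4) by auto
  then obtain C1 where rot: "rotation C (hd c # C1)" using rotation_Cons_iff[of "hd c" C] by blast
  define C' where "C' = hd c # C1"
  have rot': "rotation C C'" using rot by (simp add: C'_def)
  obtain v' where "chain v' C' v'" using closed_chain_rotation[OF C(1) rot'] by blast
  moreover have "fst (hd c) = v" using chain_start[OF c(1,3)] .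
  ultimately have C': "chain v C' v" by (auto simp: C'_def)
  have dist: "distinct (map fst C')" using C(2) rot' by (auto simp: rotation_def simp flip: rotate_map)
  have sub: "set c \<subseteq> set C'" using c(4) set_rotation[OF rot'] by simp
  have "distinct c" "distinct C'" using c(2) dist by (auto simp: distinct_map)
  then have len: "length c \<le> length C'"
    using card_mono[OF finite_set sub] by (simp add: distinct_card)
  have pre: "c = take (length c) C'" using chain_prefix[OF c(1) C' sub dist len] .
  have "length c = length C'"
  proof (rule ccontr)
    assume "length c \<noteq> length C'"
    then have k: "length c < length C'" using len by simp
    have "fst (C' ! length c) = v" using chain_tail_nth[OF C' k] c(1) pre by simp
    moreover have "fst (C' ! 0) = v" using C' by (simp add: C'_def)
    moreover have "0 < length C'" using k by linarith
    ultimately have "map fst C' ! length c = map fst C' ! 0" using k by (simp only: nth_map)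
    then have "length c = 0"
      using k \<open>0 < length C'\<close> nth_eq_iff_index_eq[OF dist, of "length c" 0] by simp
    then show False using c by simp
  qed
  then show ?thesis using pre rot' by simp
qed

definition face_cycle :: "nat \<Rightarrow> int list \<Rightarrow> nat \<Rightarrow> nat \<Rightarrow> int \<Rightarrow> int \<Rightarrow> (int \<times> int) list" where
  "face_cycle r w x y n n' = roof r w x y n n' @ [(strand_top r w y n, strand_top r w x n)]"

context bfz_data
begin

lemma face_arrows_swap:
  assumes "positions w a b \<noteq> {}" "a \<noteq> b"
  shows "face_arrows r w b a n n' = face_arrows r w a b n n'"
proof -
  have "level_arrow r w b a l = level_arrow r w a b l" for l
    using orient_swap[OF assms] by (simp add: level_arrow_def)
  then show ?thesis by (simp add: face_arrows_def positions_commute)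
qed

context
  fixes x y n n'
  assumes xy: "{x, y} \<in> E" and bl: "block w x y n n'" and o: "orient w x y n'"
begin

lemma block_facts: "x \<noteq> y" "x \<in> {1..r}" "y \<in> {1..r}" "0 \<le> n" "n < n'" "n' \<le> len"
    "level w x y n" "level w x y n'"
  using edge[OF xy] bl level_bounds by (auto simp: block_def)

lemma chain_roof: "chain (tp x n) (roof r w x y n n') (tp y n)"
  unfolding roof_def
  using chain_up[OF block_facts(2,4) _ block_facts(6)] chain_down[OF block_facts(3,4) _ block_facts(6)]
    block_facts(5) by (auto simp: chain_append)

lemma chain_face_cycle: "chain (tp x n) (face_cycle r w x y n n') (tp x n)"
  unfolding face_cycle_def using chain_roof by (simp add: chain_snoc)

text \<open>
  The signs of the letters in the block are such that all vertical arrows around the face point along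
  the cycle.
\<close>

lemma set_face_cycle: "set (face_cycle r w x y n n') = face_arrows r w x y n n'"
proof -
  note f = block_facts
  have up: "set (up r w x n n') = vertical_at r w ` {m. strand w m = x \<and> n < m \<and> m \<le> n'}"
  proof -
    have "(tp x (m - 1), m) = vertical_at r w m" if "strand w m = x" "n < m" "m \<le> n'" for m
      using block_letter_sign(1)[OF bl o f(1), of m] that f by (auto simp: vertical_at_def)
    then show ?thesis unfolding set_up by (auto simp: image_iff) metis+
  qed
  have down: "set (down r w y n n') = vertical_at r w ` {m. strand w m = y \<and> n < m \<and> m \<le> n'}"
  proof -
    have "(m, tp y (m - 1)) = vertical_at r w m" if "strand w m = y" "n < m" "m \<le> n'" for m
      using block_letter_sign(2)[OF bl o f(1), of m] that f by (auto simp: vertical_at_def)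
    then show ?thesis unfolding set_down by (auto simp: image_iff) metis+
  qed
  have "\<not> orient w x y n" using block_orient(2)[OF bl] o by simp
  then have lv: "level_arrow r w x y n = (tp y n, tp x n)" "level_arrow r w x y n' = (tp x n', tp y n')"
    using o by (auto simp: level_arrow_def)
  have "{m \<in> positions w x y. n < m \<and> m \<le> n'} =
      {m. strand w m = x \<and> n < m \<and> m \<le> n'} \<union> {m. strand w m = y \<and> n < m \<and> m \<le> n'}"
    using f by (auto simp: positions_def)
  then show ?thesis
    unfolding face_cycle_def roof_def face_arrows_def using up down lv by (auto simp: image_Un)
qed

text \<open>
  The tails are the indices on \<open>x\<close> in ascending order followed by those on \<open>y\<close> in descending order.
\<close>

lemma distinct_face_cycle: "distinct (map fst (face_cycle r w x y n n'))"
proof -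
  note f = block_facts
  define X where "X = filter (\<lambda>m. strand w m = x) [n + 1..n']"
  define Y where "Y = filter (\<lambda>m. strand w m = y) [n + 1..n']"
  have X: "strand w m = x" "1 \<le> m" "m \<le> len" "n < m" "m \<le> n'" if "m \<in> set X" for m
    using that f unfolding X_def by auto
  have Y: "strand w m = y" "n < m" if "m \<in> set Y" for m
    using that unfolding Y_def by auto
  have "inj_on (\<lambda>m. tp x (m - 1)) (set X)"
    by (rule inj_on_inverseI[where g = "next_index r w"]) (use X next_index_strand_top in metis)
  moreover have "distinct X" "distinct Y" by (simp_all add: X_def Y_def)
  ultimately have d: "distinct (map (\<lambda>m. tp x (m - 1)) X)" "distinct (rev Y)"
    by (simp_all add: distinct_map)
  have sx: "strand w (tp x (m - 1)) = x" "tp x (m - 1) < tp x n'" if "m \<in> set X" for m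
    using X[OF that] strand_top_props[OF f(2), of "m - 1"] strand_top_ge[of m x n'] pos_index[of m]
      by auto
  have s: "strand w (tp x n') = x" "strand w (tp y n) = y" "tp y n \<le> n"
    using crossing_ends[OF xy f(7)] crossing_ends[OF xy f(8)] strand_top_le[OF f(3,4)] by auto
  have eq: "map fst (face_cycle r w x y n n') = map (\<lambda>m. tp x (m - 1)) X @ tp x n' # rev Y @ [tp y n]"
    by (simp add: face_cycle_def roof_def up_def down_def rev_map comp_def X_def Y_def)
  have "tp x n' \<notin> (\<lambda>m. tp x (m - 1)) ` set X" using sx(2) by force
  moreover have "tp x n' \<notin> set Y" using s(1) Y(1) f(1) by metis
  moreover have "tp y n \<notin> set Y" using s(3) Y(2) by (meson not_le)
  moreover have "\<not> (\<exists>m\<in>set X. tp x (m - 1) = tp y n \<or> tp x (m - 1) \<in> set Y)"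
    using sx(1) s(2) Y(1) f(1) by metis
  moreover have "tp x n' \<noteq> tp y n" using s f(1) by metis
  ultimately show ?thesis unfolding eq using d by auto
qed

end

lemma face_cycle_arrows:
  assumes ab: "{a, b} \<in> E" and bl: "block w a b n n'"
    and xy: "x = a \<and> y = b \<or> x = b \<and> y = a" and o: "orient w x y n'"
  shows "set (face_cycle r w x y n n') = face_arrows r w a b n n'"
proof -
  have pos: "positions w a b \<noteq> {}" using bl by (auto simp: block_def level_def)
  have "{x, y} \<in> E" "block w x y n n'"
    using ab bl xy block_swap[OF edge(1)[OF ab]] by (auto simp: insert_commute)
  then show ?thesis
    using set_face_cycle[OF _ _ o] xy face_arrows_swap[OF pos edge(1)[OF ab]] by auto
qed

text \<open>
  Some cycle with the required properties exists, namely the face cycle. As the arrows of any other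
  such cycle lie on the frontier of the face, it is the same up to rotation, whichever one is chosen.
\<close>

lemma bounding_cycle_trapezoid:
  assumes ab: "{a, b} \<in> E" and bl: "block w a b n n'"
    and xy: "x = a \<and> y = b \<or> x = b \<and> y = a" and o: "orient w x y n'"
  shows "rotation (face_cycle r w x y n n') (bounding_cycle r E w a b (trapezoid r w a b n n'))"
proof -
  have pos: "positions w a b \<noteq> {}" and lev: "level w a b n" "level w a b n'"
    using bl by (auto simp: block_def level_def)
  note ed = edge[OF ab]
  have xyE: "{x, y} \<in> E" and blxy: "block w x y n n'"
    using ab bl xy block_swap[OF ed(1)] by (auto simp: insert_commute)
  let ?C = "face_cycle r w x y n n'" and ?T = "trapezoid r w a b n n'"
  note ch = chain_face_cycle[OF xyE blxy o] and dist = distinct_face_cycle[OF xyE blxy o]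
  note set = face_cycle_arrows[OF ab bl xy o]
  have sub: "set ?C \<subseteq> strip_arrows r E w a b"
    unfolding set by (rule face_arrows_subset[OF ab pos bl])
  define good where "good c \<longleftrightarrow> pre_digraph.cycle (bfz_quiver r E w) c \<and> set c \<subseteq> strip_arrows r E w a b \<and>
    \<Union> (segment r w a ` set c) = frontier ?T" for c
  have "?C \<noteq> []" by (simp add: face_cycle_def)
  moreover have "set ?C \<subseteq> arcs Q" using sub by (auto simp: strip_arrows_def)
  moreover have "tp x n \<in> index_set r w" using crossing_ends[OF xyE] blxy by (auto simp: block_def)
  ultimately have "good ?C"
    unfolding good_def cycle_bfz_quiver using ch dist sub
    unfolding frontier_eq_face_arrows[OF ab pos bl] set by blast
  then have good: "good (bounding_cycle r E w a b ?T)"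
    unfolding bounding_cycle_def good_def[symmetric] by (rule someI)
  define c where "c = bounding_cycle r E w a b ?T"
  have c: "set c \<subseteq> strip_arrows r E w a b" "\<Union> (segment r w a ` set c) = frontier ?T"
    "\<exists>u. chain u c u" "distinct (map fst c)" "c \<noteq> []"
    using good unfolding c_def[symmetric] good_def cycle_bfz_quiver by auto
  have "e \<in> face_arrows r w a b n n'" if "e \<in> set c" for e
    using arrow_on_frontier[OF ab pos bl, of e] c that by blast
  then have "set c \<subseteq> set ?C" unfolding set by blast
  then show ?thesis using cycle_unique[OF ch dist _ c(4,5)] c(3) c_def by blast
qed

text \<open>
  Twice the contribution of one arrow to the signed area.
\<close>

definition shoelace :: "nat \<Rightarrow> int \<times> int \<Rightarrow> real" where
  "shoelace a e = fst (point r w a (fst e)) * snd (point r w a (snd e)) -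
     fst (point r w a (snd e)) * snd (point r w a (fst e))"

lemma signed_area_shoelace: "signed_area r w a c = sum_list (map (shoelace a) c) / 2"
  by (simp add: signed_area_def shoelace_def[abs_def] case_prod_unfold)

lemma signed_area_rotation:
  assumes "rotation p q"
  shows "signed_area r w a q = signed_area r w a p"
proof -
  have "mset (rotate1 xs) = mset xs" for xs :: "(int \<times> int) list" by (cases xs) auto
  then have "mset (rotate k p) = mset p" for k by (induction k) auto
  then have "mset q = mset p" using assms by (auto simp: rotation_def)
  then have "mset (map (shoelace a) q) = mset (map (shoelace a) p)" by simp
  then have "sum_mset (mset (map (shoelace a) q)) = sum_mset (mset (map (shoelace a) p))"
    by (rule arg_cong)
  then show ?thesis unfolding signed_area_shoelace sum_mset_sum_list by simp
qed

lemma shoelace_up_down: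
  assumes "c \<in> {1..r}" "0 \<le> n" "n \<le> n'" "n' \<le> len"
  shows "sum_list (map (shoelace a) (up r w c n n')) =
      (if c = a then 0 else height r w (tp c n') - height r w (tp c n))"
    and "sum_list (map (shoelace a) (down r w c n n')) =
      (if c = a then 0 else height r w (tp c n) - height r w (tp c n'))"
proof -
  have "sum_list (map (shoelace a) (up r w c n n')) =
      (if c = a then 0 else height r w (tp c n') - height r w (tp c n)) \<and>
    sum_list (map (shoelace a) (down r w c n n')) =
      (if c = a then 0 else height r w (tp c n) - height r w (tp c n'))"
    using assms(3,4)
  proof (induction n' rule: int_ge_induct)
    case (step i)
    have "tp c (i + 1) = (if strand w (i + 1) = c then i + 1 else tp c i)"
      using strand_top_step[of c "i + 1"] assms step by simp
    moreover have "strand w (tp c i) = c" using strand_strand_top[OF assms(1)] assms(2) step by simp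
    ultimately show ?case
      using step by (auto simp: up_step down_step shoelace_def point_def)
  qed simp
  then show "sum_list (map (shoelace a) (up r w c n n')) =
      (if c = a then 0 else height r w (tp c n') - height r w (tp c n))"
    "sum_list (map (shoelace a) (down r w c n n')) =
      (if c = a then 0 else height r w (tp c n) - height r w (tp c n'))" by auto
qed

text \<open>
  Up to sign, twice the area is the sum of the lengths of the vertical sides, because the strip has
  width one; they do not both vanish.
\<close>

lemma signed_area_nonzero:
  assumes ab: "{a, b} \<in> E" and bl: "block w a b n n'"
  shows "signed_area r w a (bounding_cycle r E w a b (trapezoid r w a b n n')) \<noteq> 0"
proof -
  have pos: "positions w a b \<noteq> {}" and lev: "level w a b n" "level w a b n'"
    using bl by (auto simp: block_def level_def)
  note ed = edge[OF ab]
  obtain x y where xy: "x = a \<and> y = b \<or> x = b \<and> y = a" and o: "orient w x y n'"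
    using orient_swap[OF pos ed(1), of n'] by blast
  have n: "0 \<le> n" "n < n'" "n' \<le> len" using bl level_bounds by (auto simp: block_def)
  have r: "x \<in> {1..r}" "y \<in> {1..r}" "x \<noteq> y" using xy ed by auto
  define dx where "dx = height r w (tp x n') - height r w (tp x n)"
  define dy where "dy = height r w (tp y n') - height r w (tp y n)"
  have d: "0 \<le> dx" "0 \<le> dy" "dx + dy \<noteq> 0"
  proof -
    have "tp a n + tp b n < tp a n' + tp b n'" "tp a n \<le> tp a n'" "tp b n \<le> tp b n'"
      using level_tops_less[OF ed(2,3) lev n(2)] by auto
    then have le: "tp x n \<le> tp x n'" "tp y n \<le> tp y n'"
      and "tp x n < tp x n' \<or> tp y n < tp y n'"
      using xy by auto
    moreover have "tp x n' \<in> index_set r w" "tp y n' \<in> index_set r w"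
      using crossing_ends[OF ab lev(2)] xy by auto
    ultimately have "0 < dx \<or> 0 < dy" unfolding dx_def dy_def using height_strict_mono by force
    moreover show "0 \<le> dx" "0 \<le> dy" unfolding dx_def dy_def using height_mono le by auto
    ultimately show "dx + dy \<noteq> 0" by linarith
  qed
  have pt: "fst (point r w a (tp x l)) = (if x = a then 0 else 1)" "snd (point r w a (tp x l)) = height r w (tp x l)"
    "fst (point r w a (tp y l)) = (if y = a then 0 else 1)" "snd (point r w a (tp y l)) = height r w (tp y l)"
    if "0 \<le> l" for l
    using strand_strand_top[OF r(1) that] strand_strand_top[OF r(2) that] by (simp_all add: point_def)
  have n': "0 \<le> n'" using n by simp
  note ud = shoelace_up_down[OF r(1) n(1) less_imp_le[OF n(2)] n(3)]
    shoelace_up_down[OF r(2) n(1) less_imp_le[OF n(2)] n(3)]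
  have "2 * signed_area r w a (face_cycle r w x y n n') = (if x = a then - (dx + dy) else dx + dy)"
    unfolding signed_area_shoelace face_cycle_def roof_def
    using xy ed(1) n
    by (auto simp: ud shoelace_def pt[OF n(1)] pt[OF n'] dx_def dy_def)
  then have "signed_area r w a (face_cycle r w x y n n') \<noteq> 0" using d by (auto split: if_splits)
  then show ?thesis
    using signed_area_rotation[OF bounding_cycle_trapezoid[OF ab bl xy o]] by simp
qed

text \<open>
  Different levels have different pairs of tops.
\<close>

lemma level_arrow_in_face:
  assumes ab: "{a, b} \<in> E" and l: "level w a b l" and bl: "block w a b n n'"
  shows "level_arrow r w a b l \<in> face_arrows r w a b n n' \<longleftrightarrow> l = n \<or> l = n'"
proof
  have lev: "level w a b n" "level w a b n'" using bl by (auto simp: block_def)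
  note ed = edge[OF ab]
  assume "level_arrow r w a b l \<in> face_arrows r w a b n n'"
  then consider m where "m \<in> positions w a b" "level_arrow r w a b l = vertical_at r w m"
    | k where "k = n \<or> k = n'" "level_arrow r w a b l = level_arrow r w a b k"
    by (auto simp: face_arrows_def)
  then show "l = n \<or> l = n'"
  proof cases
    case 1
    then have "level_arrow r w a b l \<in> vertical_at r w ` {1..len}" by (auto simp: positions_def)
    then have "\<not> crossing w (level_arrow r w a b l)" by (rule vertical_not_crossing)
    then show ?thesis using crossing_ends[OF ab l] ed
      by (auto simp: crossing_def level_arrow_def split: if_splits)
  next
    case 2
    then have k: "level w a b k" using lev by auto
    have "tp a l + tp b l = tp a k + tp b k"
      using 2(2) by (auto simp: level_arrow_def split: if_splits)
    then have "l = k"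
      using level_tops_less(1)[OF ed(2,3) l k] level_tops_less(1)[OF ed(2,3) k l]
      by (cases l k rule: linorder_cases) auto
    then show ?thesis using 2 by auto
  qed
qed (auto simp: face_arrows_def)

text \<open>
  Without letters there are no arrows over the edge, and the whole strip is unbounded.
\<close>

lemma faces_empty:
  assumes "positions w a b = {}"
  shows "faces r E w a b = {}"
proof -
  have "strip_arrows r E w a b = {}"
    using assms strip_arrow_cases[of _ a b] by blast
  then have "F \<notin> faces r E w a b" for F
  proof -
    have False if F: "F \<in> components (strip - {})" "bounded F"
    proof -
      obtain x y where "(x, y) \<in> F" using in_components_nonempty[OF F(1)] by auto
      then show False using ray_in_unbounded_component[OF F(1) _ F(2)] by blast
    qed
    then show ?thesis using \<open>strip_arrows r E w a b = {}\<close> by (auto simp: faces_def)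
  qed
  then show ?thesis by blast
qed

end

section \<open>Edges and sheets\<close>

definition adj :: "nat set set \<Rightarrow> nat \<Rightarrow> nat \<Rightarrow> bool" where
  "adj E x y \<longleftrightarrow> {x, y} \<in> E"

lemma adj_sym: "adj E x y \<Longrightarrow> adj E y x"
  by (simp add: adj_def insert_commute)

text \<open>
  Makes the condition on the interior of a path amenable to reversal and to list recursion.
\<close>

lemma interior_conv:
  "(\<forall>m. 0 < m \<and> Suc m < length p \<longrightarrow> P (p ! m)) \<longleftrightarrow> (\<forall>x\<in>set (butlast (tl p)). P x)"
proof -
  have "set (butlast (tl p)) = {p ! m | m. 0 < m \<and> Suc m < length p}"
  proof (intro equalityI subsetI)
    fix x assume "x \<in> set (butlast (tl p))"
    then obtain i where i: "i < length (butlast (tl p))" "x = butlast (tl p) ! i"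
      by (metis in_set_conv_nth)
    then have "x = p ! Suc i" "Suc (Suc i) < length p" by (simp_all add: nth_butlast nth_tl)
    then show "x \<in> {p ! m | m. 0 < m \<and> Suc m < length p}" by blast
  next
    fix x assume "x \<in> {p ! m | m. 0 < m \<and> Suc m < length p}"
    then obtain m where m: "0 < m" "Suc m < length p" "x = p ! m" by blast
    then have "x = butlast (tl p) ! (m - 1)" "m - 1 < length (butlast (tl p))"
      by (auto simp: nth_butlast nth_tl)
    then show "x \<in> set (butlast (tl p))" by auto
  qed
  then show ?thesis by auto
qed

definition unramified_path :: "nat \<Rightarrow> nat set set \<Rightarrow> nat list \<Rightarrow> bool" where
  "unramified_path r E p \<longleftrightarrow> distinct p \<and> set p \<subseteq> {1..r} \<and> successively (adj E) p \<and>
     (\<forall>x\<in>set (butlast (tl p)). \<not> degree E x > 2)"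

lemma branch_iff: "branch r E p \<longleftrightarrow> 2 \<le> length p \<and> unramified_path r E p \<and>
     (\<forall>i\<in>{hd p, last p}. degree E i = 1 \<or> degree E i > 2)"
proof -
  have "(\<forall>m. Suc m < length p \<longrightarrow> {p ! m, p ! Suc m} \<in> E) \<longleftrightarrow> successively (adj E) p"
    by (auto simp: successively_conv_nth adj_def)
  then show ?thesis
    unfolding branch_def unramified_path_def interior_conv[of p "\<lambda>x. \<not> degree E x > 2"]
    by (simp only: conj_ac)
qed

lemma unramified_path_rev: "unramified_path r E (rev p) \<longleftrightarrow> unramified_path r E p"
proof -
  have "successively (adj E) (rev p) \<longleftrightarrow> successively (adj E) p"
    unfolding successively_rev by (rule successively_cong) (auto simp: adj_sym)
  moreover have "set (butlast (tl (rev p))) = set (butlast (tl p))"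
    by (metis butlast_rev butlast_tl rev_rev_ident set_rev)
  ultimately show ?thesis by (simp add: unramified_path_def)
qed

lemma branch_rev: "branch r E (rev p) \<longleftrightarrow> branch r E p"
proof (cases "p = []")
  case False
  then show ?thesis by (auto simp: branch_iff unramified_path_rev hd_rev last_rev)
qed simp

context
  fixes r E
  assumes graph: "is_graph r E" and no_loop: "\<not> has_loop E" and no_cycle: "\<not> has_cycle E"
begin

lemma adj_props: "adj E x y \<Longrightarrow> x \<noteq> y \<and> x \<in> {1..r} \<and> y \<in> {1..r}"
  using graph no_loop by (auto simp: is_graph_def has_loop_def adj_def)

text \<open>
  There are no loops and no parallel edges, so the degree counts neighbours.
\<close>

lemma degree_eq: "degree E x = card {y. adj E x y}"
proof -
  have "{e \<in> E. x \<in> e} = (\<lambda>y. {x, y}) ` {y. adj E x y}"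
  proof (intro equalityI subsetI)
    fix e assume e: "e \<in> {e \<in> E. x \<in> e}"
    then have "card e = 2" using graph no_loop by (auto simp: is_graph_def has_loop_def)
    then obtain y where "e = {x, y}" using e by (auto simp: card_2_iff)
    then show "e \<in> (\<lambda>y. {x, y}) ` {y. adj E x y}" using e by (auto simp: adj_def)
  qed (auto simp: adj_def)
  moreover have "inj_on (\<lambda>y. {x, y}) {y. adj E x y}"
    by (auto simp: inj_on_def doubleton_eq_iff)
  ultimately show ?thesis by (simp add: degree_def card_image)
qed

lemma finite_neighbours: "finite {y. adj E x y}"
  by (rule finite_subset[of _ "{1..r}"]) (use adj_props in auto)

lemma degree_le_2_neighbours:
  assumes "\<not> degree E x > 2" "adj E x y" "adj E x z" "y \<noteq> z" "adj E x v"
  shows "v = y \<or> v = z"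
proof (rule ccontr)
  assume "\<not> ?thesis"
  then have "card {y, z, v} = 3" using assms by auto
  moreover have "card {y, z, v} \<le> card {y. adj E x y}"
    using assms finite_neighbours by (intro card_mono) auto
  ultimately show False using assms by (simp add: degree_eq)
qed

lemma two_neighbours_degree:
  assumes "adj E x y" "adj E x z" "y \<noteq> z"
  shows "degree E x \<noteq> 1"
proof -
  have "card {y, z} \<le> card {y. adj E x y}"
    using assms finite_neighbours by (intro card_mono) auto
  then show ?thesis using assms by (simp add: degree_eq)
qed

text \<open>
  At an interior vertex the path has just two neighbours to choose from, one of which it comes
  from; and it cannot end at a vertex of degree two.
\<close>

lemma continuation_unique:
  assumes "distinct (a # b # ys)" "successively (adj E) (a # b # ys)"
    "\<forall>x\<in>set (butlast (b # ys)). \<not> degree E x > 2" "degree E (last (b # ys)) = 1 \<or> degree E (last (b # ys)) > 2"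
    and "distinct (a # b # zs)" "successively (adj E) (a # b # zs)"
    "\<forall>x\<in>set (butlast (b # zs)). \<not> degree E x > 2" "degree E (last (b # zs)) = 1 \<or> degree E (last (b # zs)) > 2"
  shows "ys = zs"
  using assms
proof (induction ys arbitrary: a b zs)
  case Nil
  show ?case
  proof (cases zs)
    case (Cons c zs')
    then have "adj E b a" "adj E b c" "a \<noteq> c" "\<not> degree E b > 2" using Nil.prems adj_sym
      by auto
    then show ?thesis using Nil.prems(4) two_neighbours_degree[of b a c] by simp
  qed simp
next
  case (Cons c ys)
  have b: "adj E b a" "adj E b c" "a \<noteq> c" "\<not> degree E b > 2" using Cons.prems adj_sym by auto
  show ?case
  proof (cases zs)
    case Nil
    then show ?thesis using Cons.prems(8) b two_neighbours_degree[of b a c] by simp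
  next
    case z: (Cons d zs')
    have "adj E b d" "a \<noteq> d" using Cons.prems z by auto
    then have "d = c" using degree_le_2_neighbours[OF b(4,1,2,3)] by auto
    moreover have "ys = zs'"
      by (rule Cons.IH[of b c]) (use Cons.prems z \<open>d = c\<close> in auto)
    ultimately show ?thesis using z by simp
  qed
qed

lemma branch_continuation:
  assumes "branch r E (xs @ a # b # ys)"
  shows "distinct (a # b # ys)" "successively (adj E) (a # b # ys)"
    "\<forall>x\<in>set (butlast (b # ys)). \<not> degree E x > 2"
    "degree E (last (b # ys)) = 1 \<or> degree E (last (b # ys)) > 2"
proof -
  have p: "unramified_path r E (xs @ a # b # ys)" and l: "degree E (last (xs @ a # b # ys)) = 1 \<or>
      degree E (last (xs @ a # b # ys)) > 2"
    using assms by (auto simp: branch_iff)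
  show "distinct (a # b # ys)" "successively (adj E) (a # b # ys)"
    using p by (auto simp: unramified_path_def successively_append_iff)
  have "set (butlast (b # ys)) \<subseteq> set (butlast (tl (xs @ a # b # ys)))"
    by (cases xs) (auto simp: butlast_append)
  then show "\<forall>x\<in>set (butlast (b # ys)). \<not> degree E x > 2"
    using p unfolding unramified_path_def by blast
  show "degree E (last (b # ys)) = 1 \<or> degree E (last (b # ys)) > 2" using l by simp
qed

lemma branch_through_edge_unique:
  assumes "branch r E (xs @ a # b # ys)" "branch r E (xs' @ a # b # ys')"
  shows "xs = xs'" "ys = ys'"
proof -
  show "ys = ys'"
    using branch_continuation[OF assms(1)] branch_continuation[OF assms(2)]
    by (rule continuation_unique)
  have "branch r E (rev ys @ b # a # rev xs)" "branch r E (rev ys' @ b # a # rev xs')"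
    using assms branch_rev[of r E "xs @ a # b # ys"] branch_rev[of r E "xs' @ a # b # ys'"] by auto
  then have "rev xs = rev xs'"
    using branch_continuation[of "rev ys" b a "rev xs"] branch_continuation[of "rev ys'" b a "rev xs'"]
      continuation_unique[of b a "rev xs" "rev xs'"] by blast
  then show "xs = xs'" by simp
qed

definition passes :: "nat \<Rightarrow> nat \<Rightarrow> nat list \<Rightarrow> bool" where
  "passes a b p \<longleftrightarrow> (\<exists>xs ys. p = xs @ a # b # ys \<or> p = xs @ b # a # ys)"

lemma passes_rev: "passes a b p \<Longrightarrow> passes a b (rev p)"
proof -
  assume "passes a b p"
  then obtain xs ys where "p = xs @ a # b # ys \<or> p = xs @ b # a # ys" by (auto simp: passes_def)
  then have "rev p = rev ys @ b # a # rev xs \<or> rev p = rev ys @ a # b # rev xs" by auto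
  then show "passes a b (rev p)" unfolding passes_def by blast
qed

text \<open>
  If the end of the path has degree two, there is one more edge at it. That edge cannot lead back to the
  path, since this would close a cycle.
\<close>

lemma extend_path:
  assumes p: "unramified_path r E p" "2 \<le> length p"
    and deg: "\<not> (degree E (last p) = 1 \<or> degree E (last p) > 2)"
  shows "\<exists>y. unramified_path r E (p @ [y])"
proof -
  obtain p' x0 x where p_eq: "p = p' @ [x0, x]"
  proof -
    obtain p1 x where 1: "p = p1 @ [x]" using p(2) by (cases p rule: rev_cases) auto
    then obtain p2 x0 where "p1 = p2 @ [x0]" using p(2) by (cases p1 rule: rev_cases) auto
    then show ?thesis using that 1 by simp
  qed
  have adj: "adj E x x0" and dist: "distinct p" and succ: "successively (adj E) p"
    using p(1) by (auto simp: p_eq unramified_path_def successively_append_iff adj_sym)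
  have deg2: "degree E x = 2"
  proof -
    have "degree E x \<noteq> 0" using adj finite_neighbours[of x] by (auto simp: degree_eq)
    then show ?thesis using deg p_eq by auto
  qed
  obtain y where y: "adj E x y" "y \<noteq> x0"
  proof -
    have "card {y. adj E x y} = 2" using deg2 by (simp add: degree_eq)
    then have "{y. adj E x y} \<noteq> {x0}" by auto
    then show ?thesis using that adj by auto
  qed
  have "y \<notin> set p"
  proof
    assume "y \<in> set p"
    then have "y \<in> set p'" using y adj_props[OF y(1)] by (auto simp: p_eq)
    then obtain q1 q2 where q: "p' = q1 @ y # q2" by (meson split_list)
    \<comment> \<open>the part of the path from \<open>y\<close> on, closed up by the edge from \<open>x\<close> to \<open>y\<close>\<close>
    let ?c = "y # q2 @ [x0, x]"
    have "successively (adj E) ?c" using succ by (auto simp: p_eq q successively_append_iff)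
    then have "\<forall>m. Suc m < length ?c \<longrightarrow> {?c ! m, ?c ! Suc m} \<in> E"
      unfolding successively_conv_nth adj_def by auto
    moreover have "{last ?c, hd ?c} \<in> E" using y(1) by (simp add: adj_def)
    moreover have "distinct ?c" using dist by (auto simp: p_eq q)
    moreover have "3 \<le> length ?c" by simp
    ultimately have "has_cycle E" unfolding has_cycle_def by blast
    then show False using no_cycle by simp
  qed
  moreover have "successively (adj E) (p @ [y])"
    using succ y(1) by (auto simp: p_eq successively_append_iff)
  moreover have "\<forall>z\<in>set (butlast (tl (p @ [y]))). \<not> degree E z > 2"
  proof -
    have "set (butlast (tl (p @ [y]))) \<subseteq> insert x (set (butlast (tl p)))"
      by (cases p') (auto simp: p_eq butlast_append)
    then show ?thesis using p(1) deg2 unfolding unramified_path_def by fastforce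
  qed
  ultimately show ?thesis
    using p(1) adj_props[OF y(1)] dist unfolding unramified_path_def by (intro exI[of _ y]) auto
qed

text \<open>
  Take a longest path through the edge without interior ramification points. It cannot be extended
  at either end.
\<close>

lemma branch_through_edge_exists:
  assumes "{a, b} \<in> E"
  shows "\<exists>p. branch r E p \<and> passes a b p"
proof -
  define G where "G p \<longleftrightarrow> unramified_path r E p \<and> passes a b p" for p
  have adj: "adj E a b" using assms by (simp add: adj_def)
  have "unramified_path r E [a, b]"
    using adj adj_props[OF adj] by (auto simp: unramified_path_def)
  moreover have "passes a b [a, b]" unfolding passes_def by (rule exI[of _ "[]"]) auto
  ultimately have "G [a, b]" by (simp add: G_def)
  moreover have "length p \<le> r" if "G p" for p
  proof -
    have "card (set p) \<le> card {1..r}" using that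
      by (intro card_mono) (auto simp: G_def unramified_path_def)
    then show ?thesis using that by (simp add: G_def unramified_path_def distinct_card)
  qed
  ultimately obtain p where p: "G p" and max: "\<And>q. G q \<Longrightarrow> length q \<le> length p"
    using ex_has_greatest_nat[of G "[a, b]" length "Suc r"] by (metis le_imp_less_Suc)
  have end_ok: "degree E (last q) = 1 \<or> degree E (last q) > 2" if q: "G q" "length q = length p" for q
  proof (rule ccontr)
    assume A: "\<not> ?thesis"
    have "2 \<le> length q" using q(1) by (auto simp: G_def passes_def)
    then obtain y where y: "unramified_path r E (q @ [y])"
      using extend_path[of q] q(1) A by (auto simp: G_def)
    have "passes a b (q @ [y])" using q(1) unfolding G_def passes_def by (metis append_Cons append_assoc)
    then have "G (q @ [y])" using y by (simp add: G_def)
    then show False using max[of "q @ [y]"] q(2) by simp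
  qed
  have "G (rev p)" using p unramified_path_rev passes_rev by (simp add: G_def)
  then have "degree E (last (rev p)) = 1 \<or> degree E (last (rev p)) > 2" using end_ok by simp
  moreover have len: "2 \<le> length p" using p by (auto simp: G_def passes_def)
  moreover have "last (rev p) = hd p" using len by (cases p) auto
  ultimately have "branch r E p" using end_ok[OF p] p by (auto simp: branch_iff G_def)
  then show ?thesis using p by (auto simp: G_def)
qed

lemma passes_nth: "passes a b p \<longleftrightarrow> (\<exists>m. Suc m < length p \<and> {p ! m, p ! Suc m} = {a, b})"
proof
  assume "passes a b p"
  then obtain xs ys where "p = xs @ a # b # ys \<or> p = xs @ b # a # ys" by (auto simp: passes_def)
  then show "\<exists>m. Suc m < length p \<and> {p ! m, p ! Suc m} = {a, b}"
    by (intro exI[of _ "length xs"]) (auto simp: nth_append)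
next
  assume "\<exists>m. Suc m < length p \<and> {p ! m, p ! Suc m} = {a, b}"
  then obtain m where m: "Suc m < length p" "{p ! m, p ! Suc m} = {a, b}" by blast
  have "p = take m p @ p ! m # p ! Suc m # drop (Suc (Suc m)) p"
    using m(1) by (metis Cons_nth_drop_Suc Suc_lessD append_take_drop_id)
  then show "passes a b p" using m(2) unfolding passes_def by (metis doubleton_eq_iff)
qed

text \<open>
  Branches through a given edge agree up to reversal, and an orientation of the sheets selects one of
  the two directions. Hence no face occurs twice in the superpotential.
\<close>

lemma edge_in_unique_sheet:
  assumes P: "sheet_orientation r E P" and e: "{a, b} \<in> E"
  obtains p m where "p \<in> P" "Suc m < length p" "{p ! m, p ! Suc m} = {a, b}"
    "\<And>q k. q \<in> P \<Longrightarrow> Suc k < length q \<Longrightarrow> {q ! k, q ! Suc k} = {a, b} \<Longrightarrow> q = p \<and> k = m"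
proof -
  have P1: "branch r E p" if "p \<in> P" for p using P that by (simp add: sheet_orientation_def)
  have P2: "(p \<in> P) \<noteq> (rev p \<in> P)" if "branch r E p" for p using P that
    by (simp add: sheet_orientation_def)
  obtain p where p: "p \<in> P" "passes a b p"
  proof -
    obtain p0 where "branch r E p0" "passes a b p0" using branch_through_edge_exists[OF e] by blast
    then show ?thesis using that P2[of p0] passes_rev[of a b p0] by blast
  qed
  have unique: "q = p" if q: "q \<in> P" "passes a b q" for q
  proof -
    obtain xs ys c d where p_eq: "p = xs @ c # d # ys"
      and cd: "c = a \<and> d = b \<or> c = b \<and> d = a"
      using p(2) by (auto simp: passes_def)
    obtain xs' ys' where "q = xs' @ c # d # ys' \<or> q = xs' @ d # c # ys'"
      using q(2) cd by (auto simp: passes_def)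
    then show ?thesis
    proof
      assume q_eq: "q = xs' @ c # d # ys'"
      then show ?thesis
        using branch_through_edge_unique[of xs c d ys xs' ys'] P1[OF p(1)] P1[OF q(1)] p_eq by simp
    next
      assume q_eq: "q = xs' @ d # c # ys'"
      have "branch r E (rev q)" using P1[OF q(1)] branch_rev by blast
      then have "rev q = p"
        using branch_through_edge_unique[of xs c d ys "rev ys'" "rev xs'"] P1[OF p(1)] p_eq q_eq by simp
      then show ?thesis using P2[OF P1[OF q(1)]] p(1) q(1) by simp
    qed
  qed
  obtain m where m: "Suc m < length p" "{p ! m, p ! Suc m} = {a, b}" using p(2) by (auto simp: passes_nth)
  have "q = p \<and> k = m" if q: "q \<in> P" "Suc k < length q" "{q ! k, q ! Suc k} = {a, b}" for q k
  proof -
    have qp: "q = p" using unique[OF q(1)] q(2,3) passes_nth by blast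
    have dist: "distinct p" using P1[OF p(1)] by (simp add: branch_def)
    have idx: "i = j" if "i < length p" "j < length p" "p ! i = p ! j" for i j
      using dist that nth_eq_iff_index_eq by blast
    have "{p ! k, p ! Suc k} = {p ! m, p ! Suc m}" using q(3) m(2) qp by simp
    then have "k = m \<or> k = Suc m \<and> Suc k = m"
      using idx[of k m] idx[of k "Suc m"] idx[of "Suc k" m] m(1) q(2) qp by (auto simp: doubleton_eq_iff)
    then have "k = m" by linarith
    then show ?thesis using qp by simp
  qed
  then show ?thesis using that[OF p(1) m] by blast
qed

lemma finite_sheets:
  assumes "sheet_orientation r E P"
  shows "finite P"
proof (rule finite_subset)
  show "P \<subseteq> {p. set p \<subseteq> {1..r} \<and> length p \<le> r}"
  proof
    fix p assume "p \<in> P"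
    then have "branch r E p" using assms unfolding sheet_orientation_def by blast
    then have p: "set p \<subseteq> {1..r}" "distinct p" by (simp_all add: branch_def)
    have "card (set p) \<le> card {1..r}" using p(1) by (intro card_mono) auto
    then show "p \<in> {p. set p \<subseteq> {1..r} \<and> length p \<le> r}" using p
      by (simp add: distinct_card)
  qed
  show "finite {p. set p \<subseteq> {1..r} \<and> length p \<le> r}"
    by (rule finite_lists_length_le) simp
qed

end

section \<open>Derivatives of the faces of a strip\<close>

lemma cyclic_derivative_superset:
  assumes "finite A" "Poly_Mapping.keys S \<subseteq> A"
  shows "cyclic_derivative Q a S = (\<Sum>(u, p)\<in>A. \<Sum>i | i < length p \<and> p ! i = a.
     Poly_Mapping.single (head Q a, drop (Suc i) p @ take i p) (Poly_Mapping.lookup S (u, p)))"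
  unfolding cyclic_derivative_def
  using assms by (intro sum.mono_neutral_left) (auto simp: in_keys_iff)

lemma cyclic_derivative_add:
  "cyclic_derivative Q a (S + T) = cyclic_derivative Q a S + cyclic_derivative Q a T"
proof -
  let ?A = "Poly_Mapping.keys S \<union> Poly_Mapping.keys T \<union> Poly_Mapping.keys (S + T)"
  show ?thesis
    by (subst (1 2 3) cyclic_derivative_superset[where A = ?A])
      (auto simp: lookup_add single_add sum.distrib[symmetric] intro!: sum.cong)
qed

lemma cyclic_derivative_zero [simp]: "cyclic_derivative Q a 0 = 0"
  by (simp add: cyclic_derivative_def)

lemma cyclic_derivative_minus: "cyclic_derivative Q a (- S) = - cyclic_derivative Q a S"
  using cyclic_derivative_add[of Q a S "- S"] by (simp add: eq_neg_iff_add_eq_0 add.commute)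

lemma cyclic_derivative_diff:
  "cyclic_derivative Q a (S - T) = cyclic_derivative Q a S - cyclic_derivative Q a T"
  using cyclic_derivative_add[of Q a S "- T"] by (simp add: cyclic_derivative_minus)

lemma cyclic_derivative_sum:
  "cyclic_derivative Q a (sum f A) = (\<Sum>x\<in>A. cyclic_derivative Q a (f x))"
  by (induction A rule: infinite_finite_induct) (auto simp: cyclic_derivative_add)

lemma cyclic_derivative_single:
  "cyclic_derivative Q a (Poly_Mapping.single (u, p) c) = (\<Sum>i | i < length p \<and> p ! i = a.
     Poly_Mapping.single (head Q a, drop (Suc i) p @ take i p) c)"
  by (subst cyclic_derivative_superset[where A = "{(u, p)}"]) auto

lemma distinct_rotation: "rotation p q \<Longrightarrow> distinct q \<longleftrightarrow> distinct p"
  by (auto simp: rotation_def)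

lemma rotation_Cons_unique:
  assumes "distinct (e # z)" "rotation (e # z) (e # z')"
  shows "z' = z"
proof -
  obtain k where k: "e # z' = rotate k (e # z)" using assms(2) by (auto simp: rotation_def)
  define l where "l = k mod length (e # z)"
  have l: "e # z' = rotate l (e # z)" "l < length (e # z)"
    using k rotate_conv_mod[of k "e # z"] by (simp_all add: l_def)
  have "(e # z) ! l = e" using l hd_rotate_conv_nth[of "e # z" l]
    by (metis list.distinct(1) list.sel(1) mod_less)
  then have "(e # z) ! l = (e # z) ! 0" by simp
  then have "l = 0" using assms(1) l(2) nth_eq_iff_index_eq[of "e # z" l 0] by simp
  then show ?thesis using l by simp
qed

lemma rotation_sym: "rotation p q \<Longrightarrow> rotation q p"
proof -
  assume "rotation p q"
  then obtain k where "q = rotate k p" by (auto simp: rotation_def)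
  then have "q = drop (k mod length p) p @ take (k mod length p) p" by (simp add: rotate_drop_take)
  then have "rotation q (take (k mod length p) p @ drop (k mod length p) p)"
    using rotation_swap rotation_refl by metis
  then show ?thesis by simp
qed

lemma rotation_trans: "rotation p q \<Longrightarrow> rotation q s \<Longrightarrow> rotation p s"
  by (auto simp: rotation_def rotate_rotate)

text \<open>
  The derivative does not depend on where a cycle is cut open.
\<close>

lemma cyclic_derivative_rotation:
  assumes "distinct (e # z)" "rotation (e # z) c"
  shows "cyclic_derivative Q e (cycle_potential c) = Poly_Mapping.single (head Q e, z) 1"
proof -
  have dist: "distinct c" using distinct_rotation[OF assms(2)] assms(1) by simp
  have "e \<in> set c" using set_rotation[OF assms(2)] by simp
  then obtain i where i: "i < length c" "c ! i = e" by (auto simp: in_set_conv_nth)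
  have "{j. j < length c \<and> c ! j = e} = {i}"
    using i dist nth_eq_iff_index_eq by blast
  then have D: "cyclic_derivative Q e (cycle_potential c) =
      Poly_Mapping.single (head Q e, drop (Suc i) c @ take i c) 1"
    by (simp add: cycle_potential_def cyclic_derivative_single)
  have "c = take i c @ e # drop (Suc i) c" using i id_take_nth_drop by metis
  then have "rotation (e # z) (take i c @ (e # drop (Suc i) c))" using assms(2) by simp
  then have "rotation (e # z) ((e # drop (Suc i) c) @ take i c)" by (rule rotation_swap)
  then have "drop (Suc i) c @ take i c = z" using rotation_Cons_unique[OF assms(1)] by simp
  then show ?thesis using D by simp
qed

lemma cyclic_derivative_no_arrow:
  assumes "e \<notin> set c"
  shows "cyclic_derivative Q e (cycle_potential c) = 0"
proof -
  have none: "{j. j < length c \<and> c ! j = e} = {}" using assms by auto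
  show ?thesis unfolding cycle_potential_def cyclic_derivative_single none by simp
qed

text \<open>
  The generated ideal is the intersection of all ideals that contain the generators, so closure properties
  are inherited from those ideals.
\<close>

lemma jacobian_ideal_add:
  assumes "x \<in> jacobian_ideal Q S" "y \<in> jacobian_ideal Q S"
  shows "x + y \<in> jacobian_ideal Q S"
  using assms additive_subgroup.a_closed[OF ideal.axioms(1), of _ "path_algebra Q" x y]
  by (auto simp: jacobian_ideal_def genideal_def path_algebra_def)

lemma jacobian_ideal_mult:
  assumes "x \<in> jacobian_ideal Q S" "Poly_Mapping.keys y \<subseteq> paths Q"
  shows "path_mult Q x y \<in> jacobian_ideal Q S"
  using assms ideal.I_r_closed[of _ "path_algebra Q" x y]
  by (auto simp: jacobian_ideal_def genideal_def path_algebra_def)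

lemma cyclic_derivative_in_jacobian_ideal:
  "a \<in> arcs Q \<Longrightarrow> cyclic_derivative Q a S \<in> jacobian_ideal Q S"
  by (auto simp: jacobian_ideal_def genideal_def)

lemma rotation_span_subset_closure: "x \<in> rotation_span Q \<Longrightarrow> x \<in> path_closure (rotation_span Q)"
  unfolding path_closure_def by (auto intro!: bexI[of _ x])

lemma rotation_span_add: "x \<in> rotation_span Q \<Longrightarrow> y \<in> rotation_span Q \<Longrightarrow> x + y \<in> rotation_span Q"
  unfolding rotation_span_def by (rule path_space.span_add)

lemma rotation_span_zero: "0 \<in> rotation_span Q"
  unfolding rotation_span_def by (rule path_space.span_zero)

context bfz_data
begin

lemma awalk_bfz_quiver: "pre_digraph.awalk Q u p v \<longleftrightarrow> u \<in> index_set r w \<and> set p \<subseteq> arcs Q \<and> chain u p v"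
  unfolding pre_digraph.awalk_def cas_bfz_quiver by (simp add: bfz_quiver_def)

lemma path_end_chain: "chain u p v \<Longrightarrow> path_end Q (u, p) = v"
proof (induction p arbitrary: u)
  case (Cons e p)
  then have "path_end Q (snd e, p) = v" by simp
  then show ?case
    by (cases p) (simp_all add: path_end_def pre_digraph.awalk_verts.simps bfz_quiver_def)
qed (simp add: path_end_def pre_digraph.awalk_verts.simps)

text \<open>
  Each single step of a rotation is one of the generating relations.
\<close>

lemma rotation_equivalent:
  assumes "chain u p u" "set p \<subseteq> arcs Q" "p \<noteq> []" "rotation p q"
  shows "Poly_Mapping.single (u, p) c - Poly_Mapping.single (fst (hd q), q) c \<in> rotation_span Q"
proof -
  have "Poly_Mapping.single (u, p) c - Poly_Mapping.single (fst (hd (rotate k p)), rotate k p) c \<in> rotation_span Q" for k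
  proof (induction k)
    case 0
    then show ?case using chain_start[OF assms(1,3)] rotation_span_zero by simp
  next
    case (Suc k)
    let ?q = "rotate k p"
    obtain e s where q: "?q = e # s" using assms(3) by (cases ?q) auto
    obtain v where "chain v ?q v" using closed_chain_rotate[OF assms(1)] by blast
    then have ch: "chain (fst e) (e # s) (fst e)" using q by simp
    have arcs: "set (e # s) \<subseteq> arcs Q" using assms(2) set_rotate[of k p] q by simp
    then have "pre_digraph.awalk Q (tail Q e) (e # s) (tail Q e)"
      using ch arc_ends[of e] unfolding awalk_bfz_quiver by (simp add: bfz_quiver_def)
    then have "Poly_Mapping.single (tail Q e, e # s) 1 - Poly_Mapping.single (head Q e, s @ [e]) 1 \<in> rotation_span Q"
      unfolding rotation_span_def by (intro path_space.span_base) blast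
    then have "path_scale c (Poly_Mapping.single (tail Q e, e # s) 1 - Poly_Mapping.single (head Q e, s @ [e]) 1) \<in> rotation_span Q"
      unfolding rotation_span_def by (rule path_space.span_scale)
    moreover have "path_scale c (Poly_Mapping.single (tail Q e, e # s) 1 - Poly_Mapping.single (head Q e, s @ [e]) 1)
        = Poly_Mapping.single (fst e, e # s) c - Poly_Mapping.single (snd e, s @ [e]) c"
      by (rule poly_mapping_eqI)
        (simp add: path_scale_def Poly_Mapping.map.rep_eq lookup_minus lookup_single when_def bfz_quiver_def)
    moreover have "fst (hd (s @ [e])) = snd e" using ch by (cases s) auto
    ultimately have "Poly_Mapping.single (fst (hd ?q), ?q) c -
        Poly_Mapping.single (fst (hd (rotate (Suc k) p)), rotate (Suc k) p) c \<in> rotation_span Q"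
      using q by simp
    from rotation_span_add[OF Suc.IH this] show ?case by simp
  qed
  then show ?thesis using assms(4) by (auto simp: rotation_def)
qed

text \<open>
  The part of the superpotential that comes from the faces over one edge.
\<close>

definition strip_potential :: "nat \<Rightarrow> nat \<Rightarrow> (int, int \<times> int) path_comb" where
  "strip_potential a b =
     (\<Sum>F | F \<in> faces r E w a b \<and> signed_area r w a (bounding_cycle r E w a b F) < 0.
        cycle_potential (bounding_cycle r E w a b F)) -
     (\<Sum>F | F \<in> faces r E w a b \<and> signed_area r w a (bounding_cycle r E w a b F) > 0.
        cycle_potential (bounding_cycle r E w a b F))"

lemma superpotential_strips:
  "superpotential r E w P = (\<Sum>p\<in>P. \<Sum>m<length p - 1. strip_potential (p ! m) (p ! Suc m))"
  by (simp add: superpotential_def strip_potential_def Let_def)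

lemma face_is_trapezoid:
  assumes "{a, b} \<in> E" "F \<in> faces r E w a b"
  obtains n n' where "block w a b n n'" "F = trapezoid r w a b n n'" "positions w a b \<noteq> {}"
proof -
  have pos: "positions w a b \<noteq> {}" using faces_empty[of a b] assms(2) by auto
  then show ?thesis using assms(2) faces_eq[OF assms(1) pos] that by auto
qed

lemma set_bounding_cycle:
  assumes ab: "{a, b} \<in> E" and bl: "block w a b n n'"
  shows "set (bounding_cycle r E w a b (trapezoid r w a b n n')) = face_arrows r w a b n n'"
proof -
  have pos: "positions w a b \<noteq> {}" using bl by (auto simp: block_def level_def)
  note ed = edge[OF ab]
  obtain x y where xy: "x = a \<and> y = b \<or> x = b \<and> y = a" and o: "orient w x y n'"
    using orient_swap[OF pos ed(1), of n'] by blast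
  show ?thesis
    using set_rotation[OF bounding_cycle_trapezoid[OF ab bl xy o]] face_cycle_arrows[OF ab bl xy o]
      by simp
qed

lemma finite_faces:
  assumes ab: "{a, b} \<in> E"
  shows "finite (faces r E w a b)"
proof (rule finite_subset)
  show "faces r E w a b \<subseteq> (\<lambda>(n, n'). trapezoid r w a b n n') ` ({n. level w a b n} \<times> {n. level w a b n})"
  proof
    fix F assume "F \<in> faces r E w a b"
    then obtain n n' where "block w a b n n'" "F = trapezoid r w a b n n'"
      using face_is_trapezoid[OF ab] by blast
    then show "F \<in> (\<lambda>(n, n'). trapezoid r w a b n n') ` ({n. level w a b n} \<times> {n. level w a b n})"
      unfolding block_def by auto
  qed
  show "finite ((\<lambda>(n, n'). trapezoid r w a b n n') ` ({n. level w a b n} \<times> {n. level w a b n}))"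
    using finite_levels by blast
qed

text \<open>
  No face has area zero, so each of them occurs with one of the two signs.
\<close>

lemma strip_potential_derivative:
  assumes ab: "{a, b} \<in> E"
  shows "cyclic_derivative Q e (strip_potential a b) = (\<Sum>F\<in>faces r E w a b.
     if signed_area r w a (bounding_cycle r E w a b F) < 0
     then cyclic_derivative Q e (cycle_potential (bounding_cycle r E w a b F))
     else - cyclic_derivative Q e (cycle_potential (bounding_cycle r E w a b F)))"
proof -
  let ?A = "\<lambda>F. signed_area r w a (bounding_cycle r E w a b F)"
  let ?D = "\<lambda>F. cyclic_derivative Q e (cycle_potential (bounding_cycle r E w a b F))"
  have "?A F \<noteq> 0" if "F \<in> faces r E w a b" for F
    using face_is_trapezoid[OF ab that] signed_area_nonzero[OF ab] by metis
  then have neg: "{F. F \<in> faces r E w a b \<and> ?A F > 0} = faces r E w a b \<inter> - {F. ?A F < 0}"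
    by (auto simp: not_less less_le)
  have pos: "{F. F \<in> faces r E w a b \<and> ?A F < 0} = faces r E w a b \<inter> {F. ?A F < 0}"
    by auto
  show ?thesis
    unfolding strip_potential_def cyclic_derivative_diff cyclic_derivative_sum
      sum.If_cases[OF finite_faces[OF ab]] pos neg
    by (simp add: sum_negf)
qed

lemma strip_potential_derivative_other:
  assumes "{a, b} \<in> E" "e \<notin> strip_arrows r E w a b"
  shows "cyclic_derivative Q e (strip_potential a b) = 0"
proof -
  have "cyclic_derivative Q e (cycle_potential (bounding_cycle r E w a b F)) = 0"
    if F: "F \<in> faces r E w a b" for F
  proof -
    obtain n n' where bl: "block w a b n n'" "F = trapezoid r w a b n n'" "positions w a b \<noteq> {}"
      using face_is_trapezoid[OF assms(1) F] .
    then have "e \<notin> set (bounding_cycle r E w a b F)"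
      using set_bounding_cycle[OF assms(1) bl(1)] face_arrows_subset[OF assms(1) bl(3,1)] assms(2) by auto
    then show ?thesis by (rule cyclic_derivative_no_arrow)
  qed
  then show ?thesis unfolding strip_potential_derivative[OF assms(1)] by (auto intro!: sum.neutral)
qed

text \<open>
  The way around the face below the level \<open>n\<close> from \<open>x\<close> to \<open>y\<close>, parallel to the roof above that level: it
  completes the arrow at level \<open>n\<close> to a cycle.
\<close>

definition under :: "nat \<Rightarrow> nat \<Rightarrow> int \<Rightarrow> int \<Rightarrow> (int \<times> int) list" where
  "under x y k n = down r w x k n @ (tp x k, tp y k) # up r w y k n"

lemma distinct_face_cycle':
  assumes "{x, y} \<in> E" "block w x y n n'" "orient w x y n'"
  shows "distinct (face_cycle r w x y n n')"
  using distinct_face_cycle[OF assms] by (simp add: distinct_map)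

text \<open>
  The arrow at level \<open>n\<close> lies on two faces, above and below it, or only on the one above if \<open>n\<close> is
  the lowest level. The orientations above and below \<open>n\<close> differ, so the arrow goes from \<open>y\<close> to \<open>x\<close> in
  both of the cycles.
\<close>

lemma strip_potential_derivative_level:
  assumes ab: "{a, b} \<in> E" and xy: "x = a \<and> y = b \<or> x = b \<and> y = a"
    and bl: "block w x y n n'" and o: "orient w x y n'"
  obtains c d where "c \<noteq> 0"
    "\<forall>k. block w x y k n \<longrightarrow> cyclic_derivative Q (tp y n, tp x n) (strip_potential a b) =
       Poly_Mapping.single (tp x n, roof r w x y n n') c + Poly_Mapping.single (tp x n, under x y k n) d"
    "\<not> (\<exists>k. block w x y k n) \<longrightarrow> cyclic_derivative Q (tp y n, tp x n) (strip_potential a b) =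
       Poly_Mapping.single (tp x n, roof r w x y n n') c"
proof -
  let ?g = "(tp y n, tp x n)"
  have pos: "positions w a b \<noteq> {}" using bl xy positions_commute
    by (auto simp: block_def level_def)
  note ed = edge[OF ab]
  have xyE: "{x, y} \<in> E" and yxE: "{y, x} \<in> E" using ab xy by (auto simp: insert_commute)
  have swap: "block w a b i j \<longleftrightarrow> block w x y i j" for i j
    using xy block_swap[OF ed(1)] by auto
  have bl': "block w a b n n'" using bl swap by simp
  have lev: "level w a b n" using bl' by (simp add: block_def)
  have posxy: "positions w x y \<noteq> {}" "x \<noteq> y" using pos xy positions_commute ed by auto
  have on: "\<not> orient w x y n" "orient w y x n"
    using block_orient(2)[OF bl] o orient_swap[OF posxy] by auto
  have g: "?g = level_arrow r w a b n"
    using xy on o orient_swap[OF pos ed(1)] by (auto simp: level_arrow_def)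
  let ?c = "bounding_cycle r E w a b"
  let ?D = "\<lambda>F. cyclic_derivative Q ?g (cycle_potential (?c F))"
  let ?s = "\<lambda>F. if signed_area r w a (?c F) < 0 then ?D F else - ?D F"
  let ?T = "trapezoid r w a b"
  have other: "?D F = 0"
    if F: "F \<in> faces r E w a b" "F \<noteq> ?T n n'" "\<not> (\<exists>k. block w a b k n \<and> F = ?T k n)" for F
  proof -
    obtain i j where ij: "block w a b i j" "F = ?T i j" using face_is_trapezoid[OF ab F(1)] by blast
    have "n \<noteq> i"
    proof
      assume "n = i"
      then have "j = n'" using ij(1) bl' unfolding block_def by (metis linorder_neqE)
      then show False using ij F \<open>n = i\<close> by simp
    qed
    moreover have "n \<noteq> j" using ij F by auto
    ultimately have "?g \<notin> set (?c F)"
      using level_arrow_in_face[OF ab lev ij(1)] set_bounding_cycle[OF ab ij(1)] g ij(2) by simp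
    then show ?thesis by (rule cyclic_derivative_no_arrow)
  qed
  have T: "?T n n' \<in> faces r E w a b" using faces_eq[OF ab pos] bl' by blast
  have hd: "head Q ?g = tp x n" by (simp add: bfz_quiver_def)
  have DT: "?D (?T n n') = Poly_Mapping.single (tp x n, roof r w x y n n') 1"
  proof -
    have fc: "face_cycle r w x y n n' = roof r w x y n n' @ [?g]" by (simp add: face_cycle_def)
    have "rotation (?g # roof r w x y n n') (face_cycle r w x y n n')"
      unfolding fc using rotation_swap[of _ "[?g]" "roof r w x y n n'"] rotation_refl by fastforce
    then have "rotation (?g # roof r w x y n n') (?c (?T n n'))"
      using bounding_cycle_trapezoid[OF ab bl' xy o] rotation_trans by blast
    moreover have "distinct (?g # roof r w x y n n')"
      using distinct_face_cycle'[OF xyE bl o] unfolding fc by simp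
    ultimately show ?thesis using cyclic_derivative_rotation[of ?g] hd by simp
  qed
  \<comment> \<open>a face counts positively if it is clockwise, that is, of negative area\<close>
  define c :: complex where "c = (if signed_area r w a (?c (?T n n')) < 0 then 1 else -1)"
  have sT: "?s (?T n n') = Poly_Mapping.single (tp x n, roof r w x y n n') c"
    unfolding DT c_def by (simp add: single_uminus)
  have c: "c \<noteq> 0" by (simp add: c_def)
  show ?thesis
  proof (cases "\<exists>k. block w x y k n")
    case False
    have "cyclic_derivative Q ?g (strip_potential a b) = (\<Sum>F\<in>{?T n n'}. ?s F)"
      unfolding strip_potential_derivative[OF ab]
      using T other False swap finite_faces[OF ab] by (intro sum.mono_neutral_right) auto
    then have "cyclic_derivative Q ?g (strip_potential a b) = Poly_Mapping.single (tp x n, roof r w x y n n') c"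
      using sT by simp
    then show ?thesis using that c False by blast
  next
    case True
    then obtain k where k: "block w x y k n" by blast
    have k_unique: "j = k" if "block w x y j n" for j
      using k that unfolding block_def by (metis linorder_neqE)
    have k': "block w a b k n" and k'': "block w y x k n"
      using k swap block_swap[OF posxy(2)] by auto
    have "cyclic_derivative Q ?g (strip_potential a b) = (\<Sum>F\<in>{?T n n', ?T k n}. ?s F)"
      unfolding strip_potential_derivative[OF ab]
    proof (rule sum.mono_neutral_right)
      show "{?T n n', ?T k n} \<subseteq> faces r E w a b" using faces_eq[OF ab pos] bl' k' by blast
      show "\<forall>F\<in>faces r E w a b - {?T n n', ?T k n}. ?s F = 0"
      proof
        fix F assume F: "F \<in> faces r E w a b - {?T n n', ?T k n}"
        have "\<not> (\<exists>j. block w a b j n \<and> F = ?T j n)" using F k_unique swap by auto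
        then show "?s F = 0" using other[of F] F by simp
      qed
    qed (rule finite_faces[OF ab])
    also have "\<dots> = ?s (?T n n') + ?s (?T k n)"
      using adjacent_trapezoids_differ[OF ab pos k' bl'] by auto
    finally have D: "cyclic_derivative Q ?g (strip_potential a b) = ?s (?T n n') + ?s (?T k n)" .
    have "?D (?T k n) = Poly_Mapping.single (tp x n, under x y k n) 1"
    proof -
      have fc: "face_cycle r w y x k n = up r w y k n @ (?g # down r w x k n @ [(tp x k, tp y k)])"
        by (simp add: face_cycle_def roof_def)
      have eq: "(?g # down r w x k n @ [(tp x k, tp y k)]) @ up r w y k n = ?g # under x y k n"
        by (simp add: under_def)
      have rot: "rotation (face_cycle r w y x k n) (?g # under x y k n)"
        using rotation_swap[OF rotation_refl[of "face_cycle r w y x k n", unfolded fc(1)]]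
        unfolding fc eq[symmetric] .
      have "rotation (?g # under x y k n) (?c (?T k n))"
        using rotation_trans[OF rotation_sym[OF rot]] bounding_cycle_trapezoid[OF ab k' _ on(2)] xy
          by blast
      moreover have "distinct (?g # under x y k n)"
        using distinct_face_cycle'[OF yxE k'' on(2)] distinct_rotation[OF rot] by simp
      ultimately show ?thesis using cyclic_derivative_rotation[of ?g] hd by simp
    qed
    moreover define d :: complex where "d = (if signed_area r w a (?c (?T k n)) < 0 then 1 else -1)"
    ultimately have sK: "?s (?T k n) = Poly_Mapping.single (tp x n, under x y k n) d"
      by (simp add: single_uminus)
    have "cyclic_derivative Q ?g (strip_potential a b) =
        Poly_Mapping.single (tp x n, roof r w x y n n') c + Poly_Mapping.single (tp x n, under x y k n) d"
      unfolding D sT sK ..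
    then have "\<forall>j. block w x y j n \<longrightarrow> cyclic_derivative Q ?g (strip_potential a b) =
        Poly_Mapping.single (tp x n, roof r w x y n n') c + Poly_Mapping.single (tp x n, under x y j n) d"
      using k_unique by blast
    then show ?thesis using that c True by blast
  qed
qed

end

section \<open>Rigidity\<close>

context bfz_data
begin

text \<open>
  The faces of other strips do not contain the arrow, and the strip over \<open>{x, y}\<close> contributes just
  once.
\<close>

lemma superpotential_derivative:
  assumes P: "sheet_orientation r E P" and xy: "{x, y} \<in> E"
    and bl: "block w x y n n'" and o: "orient w x y n'"
  obtains c d where "c \<noteq> 0"
    "\<forall>k. block w x y k n \<longrightarrow> cyclic_derivative Q (tp y n, tp x n) (superpotential r E w P) =
       Poly_Mapping.single (tp x n, roof r w x y n n') c + Poly_Mapping.single (tp x n, under x y k n) d"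
    "\<not> (\<exists>k. block w x y k n) \<longrightarrow> cyclic_derivative Q (tp y n, tp x n) (superpotential r E w P) =
       Poly_Mapping.single (tp x n, roof r w x y n n') c"
proof -
  let ?g = "(tp y n, tp x n)"
  obtain p m where p: "p \<in> P" "Suc m < length p" "{p ! m, p ! Suc m} = {x, y}"
    and unique: "\<And>q k. q \<in> P \<Longrightarrow> Suc k < length q \<Longrightarrow> {q ! k, q ! Suc k} = {x, y} \<Longrightarrow> q = p \<and> k = m"
    using edge_in_unique_sheet[OF graph no_loop no_cycle P xy] by metis
  let ?D = "\<lambda>q k. cyclic_derivative Q ?g (strip_potential (q ! k) (q ! Suc k))"
  have lev: "level w x y n" using bl by (simp add: block_def)
  have zero: "?D q k = 0" if q: "q \<in> P" "k < length q - 1" "\<not> (q = p \<and> k = m)" for q k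
  proof (rule strip_potential_derivative_other)
    have "branch r E q" using P q(1) unfolding sheet_orientation_def by blast
    then show "{q ! k, q ! Suc k} \<in> E" using q(2) by (simp add: branch_def)
    have ne: "{q ! k, q ! Suc k} \<noteq> {x, y}" 
    proof -
      have "Suc k < length q" using q(2) by linarith
      then show ?thesis using unique[OF q(1), of k] q(3) by blast
    qed
    show "?g \<notin> strip_arrows r E w (q ! k) (q ! Suc k)"
    proof
      assume "?g \<in> strip_arrows r E w (q ! k) (q ! Suc k)"
      then have "x \<in> {q ! k, q ! Suc k}" "y \<in> {q ! k, q ! Suc k}"
        using crossing_ends(1,2)[OF xy lev] by (simp_all add: strip_arrows_def)
      then show False using ne edge(1)[OF xy] by blast
    qed
  qed
  have "cyclic_derivative Q ?g (superpotential r E w P) = (\<Sum>q\<in>P. \<Sum>k<length q - 1. ?D q k)"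
    unfolding superpotential_strips cyclic_derivative_sum ..
  also have "\<dots> = (\<Sum>q\<in>{p}. \<Sum>k<length q - 1. ?D q k)"
    using finite_sheets[OF graph no_loop no_cycle P] p(1) zero
    by (intro sum.mono_neutral_right) (auto intro!: sum.neutral)
  also have "\<dots> = (\<Sum>k<length p - 1. ?D p k)" by simp
  also have "\<dots> = (\<Sum>k\<in>{m}. ?D p k)"
    using p zero[OF p(1)] by (intro sum.mono_neutral_right) auto
  finally have D: "cyclic_derivative Q ?g (superpotential r E w P) = ?D p m" by simp
  \<comment> \<open>the sheet may run through the edge in either direction\<close>
  have "x = p ! m \<and> y = p ! Suc m \<or> x = p ! Suc m \<and> y = p ! m"
    using p(3) by (metis doubleton_eq_iff)
  moreover have "{p ! m, p ! Suc m} \<in> E" using p(3) xy by simp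
  ultimately show ?thesis
    using strip_potential_derivative_level[OF _ _ bl o, of "p ! m" "p ! Suc m"] that unfolding D by metis
qed

lemma face_cycle_arcs:
  assumes "{x, y} \<in> E" "block w x y n n'" "orient w x y n'"
  shows "set (face_cycle r w x y n n') \<subseteq> arcs Q"
proof -
  have pos: "positions w x y \<noteq> {}" using assms by (auto simp: block_def level_def)
  show ?thesis
    unfolding set_face_cycle[OF assms] using face_arrows_subset[OF assms(1) pos assms(2)]
    by (auto simp: strip_arrows_def)
qed

lemma under_walk:
  assumes "{x, y} \<in> E" "block w x y k n" "orient w y x n"
  shows "chain (tp x n) (under x y k n) (tp y n)" "set (under x y k n) \<subseteq> arcs Q"
proof -
  note ed = edge[OF assms(1)]
  have b: "0 \<le> k" "k \<le> n" "n \<le> len" using assms(2) level_bounds by (auto simp: block_def)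
  show "chain (tp x n) (under x y k n) (tp y n)"
    unfolding under_def using chain_down[OF ed(2) b] chain_up[OF ed(3) b] by (auto simp: chain_append)
  have "{y, x} \<in> E" "block w y x k n"
    using assms ed block_swap[of x y] by (auto simp: insert_commute)
  then have "set (face_cycle r w y x k n) \<subseteq> arcs Q" using face_cycle_arcs assms(3) by blast
  then show "set (under x y k n) \<subseteq> arcs Q" by (auto simp: under_def face_cycle_def roof_def)
qed

text \<open>
  Measures how high the crossings are, by the indices at their ends; replacing a roof makes it smaller.
  The summand \<open>2 * int r\<close> keeps the truncation to natural numbers from losing anything.
\<close>

definition crossing_weight :: "(int \<times> int) list \<Rightarrow> nat" where
  "crossing_weight p = (\<Sum>e\<leftarrow>p. if crossing w e then nat (fst e + snd e + 2 * int r) else 0)"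

lemma crossing_weight_append: "crossing_weight (p @ q) = crossing_weight p + crossing_weight q"
  by (simp add: crossing_weight_def)

lemma crossing_weight_Cons: "crossing_weight (e # p) =
    (if crossing w e then nat (fst e + snd e + 2 * int r) else 0) + crossing_weight p"
  by (simp add: crossing_weight_def)

lemma crossing_weight_rotation:
  assumes "rotation p q"
  shows "crossing_weight q = crossing_weight p"
proof -
  have "crossing_weight (rotate1 s) = crossing_weight s" for s
    by (cases s) (auto simp: crossing_weight_def)
  then have "crossing_weight (rotate k p) = crossing_weight p" for k by (induction k) auto
  then show ?thesis using assms by (auto simp: rotation_def)
qed

lemma crossing_weight_vertical:
  assumes "a \<in> {1..r}" "0 \<le> n" "n' \<le> len"
  shows "crossing_weight (up r w a n n') = 0" "crossing_weight (down r w a n n') = 0"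
proof -
  have "\<not> crossing w (tp a (m - 1), m)" "\<not> crossing w (m, tp a (m - 1))"
    if "strand w m = a" "n < m" for m
    using that strand_strand_top[OF assms(1), of "m - 1"] assms(2) by (auto simp: crossing_def)
  then show "crossing_weight (up r w a n n') = 0" "crossing_weight (down r w a n n') = 0"
    unfolding crossing_weight_def by (auto simp: set_up set_down)
qed

text \<open>
  Both paths cross the strip once, the roof at the upper end of the block above \<open>n\<close> and the other
  path at the lower end of the block below \<open>n\<close>.
\<close>

lemma crossing_weight_under_less:
  assumes "{x, y} \<in> E" "block w x y k n" "block w x y n n'"
  shows "crossing_weight (under x y k n) < crossing_weight (roof r w x y n n')"
proof -
  note ed = edge[OF assms(1)]
  have lev: "level w x y k" "level w x y n" "level w x y n'" and less: "k < n" "n < n'"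
    using assms by (auto simp: block_def)
  have b: "0 \<le> k" "0 \<le> n" "n \<le> len" "n' \<le> len" using lev level_bounds by auto
  have cr: "crossing w (tp x l, tp y l)" if "level w x y l" for l
    using crossing_ends[OF assms(1) that] ed by (simp add: crossing_def)
  have lo: "crossing_weight (under x y k n) = nat (tp x k + tp y k + 2 * int r)"
    using crossing_weight_vertical[OF ed(2) b(1,3)] crossing_weight_vertical[OF ed(3) b(1,3)] cr[OF lev(1)]
    by (simp add: under_def crossing_weight_append crossing_weight_Cons)
  have hi: "crossing_weight (roof r w x y n n') = nat (tp x n' + tp y n' + 2 * int r)"
    using crossing_weight_vertical[OF ed(2) b(2,4)] crossing_weight_vertical[OF ed(3) b(2,4)] cr[OF lev(3)]
    by (simp add: roof_def crossing_weight_append crossing_weight_Cons)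
  have "- int r \<le> tp x k" "- int r \<le> tp y k"
    using crossing_ends(3,4)[OF assms(1) lev(1)] by (auto simp: index_set_def)
  moreover have "tp x k + tp y k < tp x n' + tp y n'"
    using level_tops_less(1)[OF ed(2,3) lev(1,3)] less by simp
  ultimately show ?thesis unfolding lo hi by simp
qed

text \<open>
  Rotate a roof to the front of the walk and multiply the derivative by its bottom arrow with the
  remaining walk. This gives an element of the ideal that replaces the roof by the path
  around the face below, or by zero. The new walk has smaller weight. The coefficient \<open>c\<close> is
  arbitrary because the replacement changes it.
\<close>

lemma closed_walk_reduces:
  assumes P: "sheet_orientation r E P"
  shows "chain u p u \<Longrightarrow> set p \<subseteq> arcs Q \<Longrightarrow> u \<in> index_set r w \<Longrightarrow> p \<noteq> [] \<Longrightarrow>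
    \<exists>x\<in>jacobian_ideal Q (superpotential r E w P). Poly_Mapping.single (u, p) c - x \<in> rotation_span Q"
proof (induction "crossing_weight p" arbitrary: p u c rule: less_induct)
  case less
  let ?S = "superpotential r E w P"
  obtain x y n n' s where xy: "{x, y} \<in> E" and bl: "block w x y n n'" and o: "orient w x y n'"
    and rot: "rotation p (roof r w x y n n' @ s)"
    using closed_walk_contains_roof[OF less.prems(1-4)] unfolding contains_roof_def by blast
  let ?R = "roof r w x y n n'"
  have ch_R: "chain (tp x n) ?R (tp y n)" using chain_roof[OF xy bl o] .
  have ne: "?R \<noteq> []" by (simp add: roof_def)
  obtain v where v: "chain v (?R @ s) v" using closed_chain_rotation[OF less.prems(1) rot] by blast
  then have "v = tp x n" using chain_start[OF v] chain_start[OF ch_R ne] ne by simp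
  then have ch_s: "chain (tp y n) s (tp x n)"
    using v chain_end_unique[OF ch_R] by (auto simp: chain_append)
  have lev: "level w x y n" using bl by (simp add: block_def)
  note ends = crossing_ends[OF xy lev]
  have s_arcs: "set s \<subseteq> arcs Q" using set_rotation[OF rot] less.prems(2) by auto
  have g: "(tp y n, tp x n) \<in> arcs Q"
    using face_cycle_arcs[OF xy bl o] by (simp add: face_cycle_def)
  have to_roof: "Poly_Mapping.single (u, p) c - Poly_Mapping.single (tp x n, ?R @ s) c \<in> rotation_span Q"
    using rotation_equivalent[OF less.prems(1,2,4) rot, of c] chain_start[OF ch_R ne] ne by simp
  obtain e d where e: "e \<noteq> 0"
    and D1: "\<forall>k. block w x y k n \<longrightarrow> cyclic_derivative Q (tp y n, tp x n) ?S =
       Poly_Mapping.single (tp x n, ?R) e + Poly_Mapping.single (tp x n, under x y k n) d"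
    and D0: "\<not> (\<exists>k. block w x y k n) \<longrightarrow> cyclic_derivative Q (tp y n, tp x n) ?S =
       Poly_Mapping.single (tp x n, ?R) e"
    using superpotential_derivative[OF P xy bl o] .
  \<comment> \<open>dividing by the coefficient \<open>e\<close> of the roof gives the rotated walk the coefficient \<open>c\<close>\<close>
  define z where "z = Poly_Mapping.single (tp y n, s) (c / e)"
  have "(tp y n, s) \<in> paths Q"
    unfolding paths_def using awalk_bfz_quiver ch_s s_arcs ends by auto
  then have z: "Poly_Mapping.keys z \<subseteq> paths Q" by (simp add: z_def)
  define X where "X = path_mult Q (cyclic_derivative Q (tp y n, tp x n) ?S) z"
  have X: "X \<in> jacobian_ideal Q ?S"
    unfolding X_def using cyclic_derivative_in_jacobian_ideal[OF g] z by (rule jacobian_ideal_mult)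
  have mult: "path_mult Q (Poly_Mapping.single (tp x n, q) f) z = Poly_Mapping.single (tp x n, q @ s) (f * (c / e))"
    if "chain (tp x n) q (tp y n)" for q f
    unfolding z_def path_mult_single using path_end_chain[OF that] by simp
  show ?case
  proof (cases "\<exists>k. block w x y k n")
    case False
    then have "X = Poly_Mapping.single (tp x n, ?R @ s) c"
      unfolding X_def using D0 mult[OF ch_R] e by simp
    then show ?thesis using X to_roof by blast
  next
    case True
    then obtain k where k: "block w x y k n" by blast
    have pos: "positions w x y \<noteq> {}" using lev by (simp add: level_def)
    have on: "orient w y x n" using block_orient(2)[OF bl] o orient_swap[OF pos edge(1)[OF xy]] by simp
    let ?U = "under x y k n"
    note U = under_walk[OF xy k on]
    define f where "f = - (d * (c / e))"
    have X_eq: "X = Poly_Mapping.single (tp x n, ?R @ s) c - Poly_Mapping.single (tp x n, ?U @ s) f"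
      unfolding X_def using D1 k mult[OF ch_R] mult[OF U(1)] e
      by (simp add: path_mult_add_left f_def single_uminus)
    have "crossing_weight (?U @ s) < crossing_weight p"
      using crossing_weight_under_less[OF xy k bl] crossing_weight_rotation[OF rot]
      by (simp add: crossing_weight_append)
    moreover have "chain (tp x n) (?U @ s) (tp x n)" using U ch_s by (auto simp: chain_append)
    ultimately obtain x' where x': "x' \<in> jacobian_ideal Q ?S"
      "Poly_Mapping.single (tp x n, ?U @ s) f - x' \<in> rotation_span Q"
      using less.hyps[of "?U @ s" "tp x n" f] U s_arcs ends by (auto simp: under_def)
    have eq: "Poly_Mapping.single (u, p) c - (X + x') =
        (Poly_Mapping.single (u, p) c - Poly_Mapping.single (tp x n, ?R @ s) c) +
        (Poly_Mapping.single (tp x n, ?U @ s) f - x')"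
      by (simp add: X_eq)
    have "Poly_Mapping.single (u, p) c - (X + x') \<in> rotation_span Q"
      unfolding eq by (rule rotation_span_add[OF to_roof x'(2)])
    then show ?thesis using jacobian_ideal_add[OF X x'(1)] by blast
  qed
qed

lemma superpotential_rigid:
  assumes "sheet_orientation r E P"
  shows "rigid Q (superpotential r E w P)"
  unfolding rigid_def
proof (intro allI impI)
  fix u p assume "pre_digraph.awalk Q u p u \<and> p \<noteq> []"
  then have "chain u p u" "set p \<subseteq> arcs Q" "u \<in> index_set r w" "p \<noteq> []"
    unfolding awalk_bfz_quiver by auto
  from closed_walk_reduces[OF assms this, of 1]
  obtain x where x: "x \<in> jacobian_ideal Q (superpotential r E w P)"
    "Poly_Mapping.single (u, p) 1 - x \<in> rotation_span Q" by blast
  then show "\<exists>x\<in>jacobian_ideal Q (superpotential r E w P).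
      cyclically_equivalent Q (Poly_Mapping.single (u, p) 1) x"
    using rotation_span_subset_closure unfolding cyclically_equivalent_def by blast
qed

end

lemma reduced_word_letters:
  assumes "u \<in> carrier (weyl_group r E)" "reduced_word u us"
  shows "set us \<subseteq> {1..r}"
proof -
  obtain xs where "u = weyl_class r E xs" using assms(1) by (auto simp: weyl_group_def)
  then have "weyl_eq r E xs us" using assms(2) by (auto simp: reduced_word_def weyl_class_def)
  then show ?thesis using weyl_eq_lists by blast
qed

theorem theorem1p1:
  fixes r :: nat and E :: "nat set set" and u v :: "nat list set"
    and w :: "int list" and P :: "nat list set"
  assumes "is_graph r E" and "\<not> has_loop E" and "\<not> has_cycle E"
    and "u \<in> carrier (weyl_group r E)" and "v \<in> carrier (weyl_group r E)"
    and "reduced_pair_word u v w"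
    and "sheet_orientation r E P"
  shows "rigid (bfz_quiver r E w) (superpotential r E w P)"
proof -
  obtain us vs where words: "reduced_word u us" "reduced_word v vs"
    "w \<in> shuffles (map (\<lambda>i. - int i) us) (map int vs)"
    using assms(6) by (auto simp: reduced_pair_word_def)
  have "set us \<subseteq> {1..r}" "set vs \<subseteq> {1..r}"
    using reduced_word_letters assms(4,5) words(1,2) by blast+
  moreover have "set w = (\<lambda>i. - int i) ` set us \<union> int ` set vs"
    using set_shuffles[OF words(3)] by simp
  ultimately have "x \<noteq> 0 \<and> \<bar>x\<bar> \<le> int r" if "x \<in> set w" for x
    using that by auto
  then interpret bfz_data r w E
    using assms(1-3) by unfold_locales auto
  show ?thesis using superpotential_rigid[OF assms(7)] .
qed

end
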